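(* Let $F_n,G_n:\mathbb{R}^d\times\mathcal{P}_2(\mathbb{R}^d)\times\mathbb{R}^d\to\mathbb{R}^d$ ($n\in\mathbb{N}$) be continuous and such that, for a constant $C$ independent of $n$, $|F_n(x,\mu,u)|+|G_n(x,\mu,u)|\le C(1+|x|+|u|+\sqrt{E_2(\mu)})$ for all $(x,\mu,u)$. Suppose $(F_n,G_n)$ converges locally uniformly to a couple $(F,G)$. Suppose that for each $n$ there is a monotone solution $W_n$ on $[0,T]$ of the master equation with coefficients $(F_n,G_n)$, and that there exists $C>0$ such that for all $n$ and all $(t,x,\mu)\in[0,T]\times\mathbb{R}^d\times\mathcal{P}_2(\mathbb{R}^d)$, $|W_n(t,x,\mu)|\le C(1+|x|+\sqrt{E_2(\mu)})$. If $(W_n)_n$ converges locally uniformly to a function $W$, then $W$ is a monotone solution of the master equation with coefficients $(F,G)$.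
   Context: Fix $d\ge1$, $T>0$ and a sufficiently rich probability space $(\Omega,\mathcal{A},\mathbb{P})$ (supporting a collection of independent Brownian motions). $\mathcal{H}=L^2(\Omega,\mathbb{R}^d)$ with $\langle X,Y\rangle=\mathbb{E}[X\cdot Y]$ and norm $\|\cdot\|$; $\mathcal{L}(X)$ is the law of $X$; $\mathcal{P}_2(\mathbb{R}^d)$ carries the Wasserstein distance $\mathcal{W}_2$; $E_q(\mu)=\int|y|^q\mu(dy)$ and $E_q(X)=\mathbb{E}|X|^q$. Lifts: $\tilde W(t,X)=W(t,X,\mathcal{L}(X))$, $\tilde F(X,U)=F(X,\mathcal{L}(X),U)$, $\tilde G(X,U)=G(X,\mathcal{L}(X),U)$. Locally uniform convergence means uniform convergence on compact subsets. The master equation with coefficients $(F,G)$ is $$\partial_t W+F(x,m,W)\cdot\nabla_xW+\int_{\mathbb{R}^d}F(y,m,W(t,y,m))\cdot D_mW(t,x,m)(y)\,m(dy)=G(x,m,W)$$ in $(0,T)\times\mathbb{R}^d\times\mathcal{P}_2(\mathbb{R}^d)$. Test functions: $H^{\mathcal{H}}_{test}$ is the set of functions $\psi(t,X)=\varphi(t)+\langle h,X\rangle-\alpha e^{\lambda t}E_4(X)$ on $[0,T)\times\mathcal{H}$ with $\varphi$ bounded in $C^1([0,\tau],\mathbb{R})$ for every $\tau<T$, $h\in\mathcal{H}$, $\alpha,\lambda>0$ (value $-\infty$ if $E_4(X)=\infty$). For $X\in L^4(\Omega,\mathbb{R}^d)$ and $A\in\mathcal{H}$ with $|X|^2X\cdot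 A\in L^1$, $A\cdot\nabla_X\psi(t,X)=\langle h,A\rangle-4\alpha e^{\lambda t}\mathbb{E}[|X|^2X\cdot A]$. Monotone solution: a continuous $W:[0,T]\times\mathbb{R}^d\times\mathcal{P}_2(\mathbb{R}^d)\to\mathbb{R}^d$ with linear growth ($|W(t,x,\mu)|\le C(1+|x|+\sqrt{E_2(\mu)})$ for some $C$) is a monotone solution of the master equation with coefficients $(F,G)$ if for all $Y,V\in\mathcal{H}$, all $\psi\in H^{\mathcal{H}}_{test}$ and every $(t^*,X^* )\in(0,T)\times L^4(\Omega,\mathbb{R}^d)$ which is a point of minimum of $(t,X)\mapsto\langle\tilde W(t,X)-V,X-Y\rangle-\psi(t,X)$, writing $W^*=\tilde W(t^*,X^* )$, $$\partial_t\psi(t^*,X^* )+\tilde F(X^*,W^* )\cdot\nabla_X\psi(t^*,X^* )\ge\langle\tilde F(X^*,W^* ),W^*-V\rangle+\langle\tilde G(X^*,W^* ),X^*-Y\rangle.$$ *)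

theory Defs
  imports "HOL-Probability.Probability"
begin

definition brownian_motion :: "'w measure \<Rightarrow> (real \<Rightarrow> 'w \<Rightarrow> real) \<Rightarrow> bool" where
  "brownian_motion M B \<longleftrightarrow>
     (\<forall>t\<ge>0. B t \<in> borel_measurable M) \<and>
     (AE w in M. B 0 w = 0) \<and>
     (\<forall>s t. 0 \<le> s \<and> s < t \<longrightarrow>
        distributed M lborel (\<lambda>w. B t w - B s w) (normal_density 0 (sqrt (t - s)))) \<and>
     (\<forall>(n::nat) (r::nat \<Rightarrow> real). 0 \<le> r 0 \<and> mono r \<longrightarrow>
        prob_space.indep_vars M (\<lambda>_. borel) (\<lambda>i w. B (r (Suc i)) w - B (r i) w) {..<n}) \<and>
     (AE w in M. continuous_on {0..} (\<lambda>t. B t w))"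

text \<open>Mutual independence of the processes is independence of their paths, as random elements of
  the product space of real functions on the half line.\<close>

definition indep_brownian_motions ::
  "'w measure \<Rightarrow> ('i \<Rightarrow> real \<Rightarrow> 'w \<Rightarrow> real) \<Rightarrow> 'i set \<Rightarrow> bool" where
  "indep_brownian_motions M B I \<longleftrightarrow>
     (\<forall>i\<in>I. brownian_motion M (B i)) \<and>
     prob_space.indep_vars M (\<lambda>_. PiM {0..} (\<lambda>_. borel)) (\<lambda>i w. \<lambda>t\<in>{0..}. B i t w) I"

definition E_law :: "nat \<Rightarrow> 'a::real_normed_vector measure \<Rightarrow> ennreal" where
  "E_law q \<mu> = (\<integral>\<^sup>+ y. ennreal (norm y ^ q) \<partial>\<mu>)"

definition P2 :: "'a::euclidean_space measure set" where
  "P2 = {\<mu>. prob_space \<mu> \<and> sets \<mu> = sets borel \<and> E_law 2 \<mu> < \<infinity>}"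

definition couplings ::
  "'a::euclidean_space measure \<Rightarrow> 'a measure \<Rightarrow> ('a \<times> 'a) measure set" where
  "couplings \<mu> \<nu> = {\<pi>. prob_space \<pi> \<and> sets \<pi> = sets borel \<and>
     distr \<pi> borel fst = \<mu> \<and> distr \<pi> borel snd = \<nu>}"

definition W2 :: "'a::euclidean_space measure \<Rightarrow> 'a measure \<Rightarrow> real" where
  "W2 \<mu> \<nu> =
     sqrt (enn2real (INF \<pi>\<in>couplings \<mu> \<nu>. \<integral>\<^sup>+ (x, y). ennreal ((norm (x - y))\<^sup>2) \<partial>\<pi>))"

text \<open>The topology of a distance on a set. The definition is that of the metric topology of
  the library, but is usable without first establishing that \<open>W2\<close> satisfies the triangle
  inequality: the sets below form a topology for any function \<open>d\<close>.\<close>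

definition dist_topology :: "'b set \<Rightarrow> ('b \<Rightarrow> 'b \<Rightarrow> real) \<Rightarrow> 'b topology" where
  "dist_topology S d =
     topology (\<lambda>U. U \<subseteq> S \<and> (\<forall>x\<in>U. \<exists>e>0. \<forall>y\<in>S. d x y < e \<longrightarrow> y \<in> U))"

lemma openin_dist_topology:
  "openin (dist_topology S d) U \<longleftrightarrow>
     U \<subseteq> S \<and> (\<forall>x\<in>U. \<exists>e>0. \<forall>y\<in>S. d x y < e \<longrightarrow> y \<in> U)"
proof -
  have "istopology (\<lambda>U. U \<subseteq> S \<and> (\<forall>x\<in>U. \<exists>e>0. \<forall>y\<in>S. d x y < e \<longrightarrow> y \<in> U))"
    unfolding istopology_def
  proof (intro conjI allI impI)
    fix U V
    assume U: "U \<subseteq> S \<and> (\<forall>x\<in>U. \<exists>e>0. \<forall>y\<in>S. d x y < e \<longrightarrow> y \<in> U)"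
      and V: "V \<subseteq> S \<and> (\<forall>x\<in>V. \<exists>e>0. \<forall>y\<in>S. d x y < e \<longrightarrow> y \<in> V)"
    show "U \<inter> V \<subseteq> S" using U by blast
    show "\<forall>x\<in>U \<inter> V. \<exists>e>0. \<forall>y\<in>S. d x y < e \<longrightarrow> y \<in> U \<inter> V"
    proof
      fix x assume "x \<in> U \<inter> V"
      then obtain e1 e2 where "e1 > 0" "\<forall>y\<in>S. d x y < e1 \<longrightarrow> y \<in> U"
        "e2 > 0" "\<forall>y\<in>S. d x y < e2 \<longrightarrow> y \<in> V"
        using U V by blast
      then show "\<exists>e>0. \<forall>y\<in>S. d x y < e \<longrightarrow> y \<in> U \<inter> V"
        by (intro exI[of _ "min e1 e2"]) auto
    qed
  next
    fix \<K>
    assume K: "\<forall>K\<in>\<K>. K \<subseteq> S \<and> (\<forall>x\<in>K. \<exists>e>0. \<forall>y\<in>S. d x y < e \<longrightarrow> y \<in> K)"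
    show "\<Union>\<K> \<subseteq> S" using K by blast
    show "\<forall>x\<in>\<Union>\<K>. \<exists>e>0. \<forall>y\<in>S. d x y < e \<longrightarrow> y \<in> \<Union>\<K>" using K by (meson UnionE UnionI)
  qed
  then show ?thesis
    by (simp add: dist_topology_def topology_inverse')
qed

lemma topspace_dist_topology: "topspace (dist_topology S d) = S"
proof -
  have "openin (dist_topology S d) S"
    unfolding openin_dist_topology by (auto intro: exI[of _ 1])
  then show ?thesis
    by (meson openin_dist_topology openin_subset openin_topspace subset_antisym)
qed

text \<open>Functions of \<open>(t, x, \<mu>)\<close> and of \<open>(x, \<mu>, u)\<close>. They are total in HOL; only their values for
  \<open>\<mu> \<in> P2\<close> (and \<open>t\<close> in the time interval) are ever used. The products carry the sum of the
  distances of the factors.\<close>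

type_synonym 'a sol = "real \<times> 'a \<times> 'a measure \<Rightarrow> 'a"
type_synonym 'a coef = "'a \<times> 'a measure \<times> 'a \<Rightarrow> 'a"

definition sol_space :: "real \<Rightarrow> (real \<times> 'a::euclidean_space \<times> 'a measure) topology" where
  "sol_space T = dist_topology ({0..T} \<times> UNIV \<times> P2)
     (\<lambda>(t, x, \<mu>) (s, y, \<nu>). dist t s + dist x y + W2 \<mu> \<nu>)"

definition coef_space :: "('a::euclidean_space \<times> 'a measure \<times> 'a) topology" where
  "coef_space = dist_topology (UNIV \<times> P2 \<times> UNIV)
     (\<lambda>(x, \<mu>, u) (y, \<nu>, v). dist x y + W2 \<mu> \<nu> + dist u v)"

definition locally_uniform_limit ::
  "'b topology \<Rightarrow> (nat \<Rightarrow> 'b \<Rightarrow> 'c::metric_space) \<Rightarrow> ('b \<Rightarrow> 'c) \<Rightarrow> bool" where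
  "locally_uniform_limit X f g \<longleftrightarrow> (\<forall>K. compactin X K \<longrightarrow> uniform_limit K f g sequentially)"

definition linear_growth :: "real \<Rightarrow> real \<Rightarrow> 'a::euclidean_space sol \<Rightarrow> bool" where
  "linear_growth T C W \<longleftrightarrow> (\<forall>t\<in>{0..T}. \<forall>x. \<forall>\<mu>\<in>P2.
     norm (W (t, x, \<mu>)) \<le> C * (1 + norm x + sqrt (enn2real (E_law 2 \<mu>))))"

text \<open>Elements of \<open>L\<^sup>2\<close> and \<open>L\<^sup>4\<close> are represented by functions; everything below is invariant
  under almost sure equality.\<close>

definition E_rv :: "'w measure \<Rightarrow> nat \<Rightarrow> ('w \<Rightarrow> 'a::euclidean_space) \<Rightarrow> ennreal" where
  "E_rv M q X = (\<integral>\<^sup>+ w. ennreal (norm (X w) ^ q) \<partial>M)"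

definition Lspace :: "'w measure \<Rightarrow> nat \<Rightarrow> ('w \<Rightarrow> 'a::euclidean_space) set" where
  "Lspace M q = {X \<in> borel_measurable M. E_rv M q X < \<infinity>}"

definition pairing ::
  "'w measure \<Rightarrow> ('w \<Rightarrow> 'a::euclidean_space) \<Rightarrow> ('w \<Rightarrow> 'a) \<Rightarrow> real" where
  "pairing M X Y = (\<integral>w. X w \<bullet> Y w \<partial>M)"

abbreviation law :: "'w measure \<Rightarrow> ('w \<Rightarrow> 'a::euclidean_space) \<Rightarrow> 'a measure" where
  "law M X \<equiv> distr M borel X"

definition lift_sol ::
  "'w measure \<Rightarrow> 'a::euclidean_space sol \<Rightarrow> real \<Rightarrow> ('w \<Rightarrow> 'a) \<Rightarrow> 'w \<Rightarrow> 'a" where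
  "lift_sol M W t X = (\<lambda>w. W (t, X w, law M X))"

definition lift_coef ::
  "'w measure \<Rightarrow> 'a::euclidean_space coef \<Rightarrow> ('w \<Rightarrow> 'a) \<Rightarrow> ('w \<Rightarrow> 'a) \<Rightarrow> 'w \<Rightarrow> 'a" where
  "lift_coef M F X U = (\<lambda>w. F (X w, law M X, U w))"

text \<open>Membership in \<open>C\<^sup>1([0,\<tau>])\<close>, with one-sided derivatives at the end points. The
  \<open>C\<^sup>1\<close> norm is then automatically finite.\<close>

definition C1_on_interval :: "real \<Rightarrow> (real \<Rightarrow> real) \<Rightarrow> bool" where
  "C1_on_interval \<tau> \<phi> \<longleftrightarrow>
     (\<exists>\<phi>'. (\<forall>t\<in>{0..\<tau>}. (\<phi> has_real_derivative \<phi>' t) (at t within {0..\<tau>})) \<and>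
           continuous_on {0..\<tau>} \<phi>')"

definition test_data ::
  "'w measure \<Rightarrow> real \<Rightarrow> (real \<Rightarrow> real) \<Rightarrow> ('w \<Rightarrow> 'a::euclidean_space) \<Rightarrow> real \<Rightarrow> real \<Rightarrow> bool" where
  "test_data M T \<phi> h \<alpha> l \<longleftrightarrow>
     (\<forall>\<tau>. 0 < \<tau> \<and> \<tau> < T \<longrightarrow> C1_on_interval \<tau> \<phi>) \<and> h \<in> Lspace M 2 \<and> \<alpha> > 0 \<and> l > 0"

text \<open>Extended real arithmetic gives the value \<open>-\<infinity>\<close> when the fourth moment is infinite.\<close>

definition test_fun ::
  "'w measure \<Rightarrow> (real \<Rightarrow> real) \<Rightarrow> ('w \<Rightarrow> 'a::euclidean_space) \<Rightarrow> real \<Rightarrow> real \<Rightarrow>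
   real \<Rightarrow> ('w \<Rightarrow> 'a) \<Rightarrow> ereal" where
  "test_fun M \<phi> h \<alpha> l t X =
     ereal (\<phi> t + pairing M h X) - ereal (\<alpha> * exp (l * t)) * enn2ereal (E_rv M 4 X)"

definition test_dt ::
  "'w measure \<Rightarrow> (real \<Rightarrow> real) \<Rightarrow> ('w \<Rightarrow> 'a::euclidean_space) \<Rightarrow> real \<Rightarrow> real \<Rightarrow>
   real \<Rightarrow> ('w \<Rightarrow> 'a) \<Rightarrow> real" where
  "test_dt M \<phi> h \<alpha> l t X = deriv (\<lambda>s. real_of_ereal (test_fun M \<phi> h \<alpha> l s X)) t"

text \<open>\<open>A\<close> paired with the gradient in \<open>X\<close>; the fourth moment has gradient \<open>4 |X|\<^sup>2 X\<close>.\<close>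

definition test_grad ::
  "'w measure \<Rightarrow> ('w \<Rightarrow> 'a::euclidean_space) \<Rightarrow> real \<Rightarrow> real \<Rightarrow>
   real \<Rightarrow> ('w \<Rightarrow> 'a) \<Rightarrow> ('w \<Rightarrow> 'a) \<Rightarrow> real" where
  "test_grad M h \<alpha> l t X A =
     pairing M h A
     - 4 * \<alpha> * exp (l * t) * (\<integral>w. (norm (X w))\<^sup>2 * (X w \<bullet> A w) \<partial>M)"

definition penalized ::
  "'w measure \<Rightarrow> 'a::euclidean_space sol \<Rightarrow> ('w \<Rightarrow> 'a) \<Rightarrow> ('w \<Rightarrow> 'a) \<Rightarrow>
   (real \<Rightarrow> ('w \<Rightarrow> 'a) \<Rightarrow> ereal) \<Rightarrow> real \<Rightarrow> ('w \<Rightarrow> 'a) \<Rightarrow> ereal" where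
  "penalized M W V Y \<psi> t X =
     ereal (pairing M (\<lambda>w. lift_sol M W t X w - V w) (\<lambda>w. X w - Y w)) - \<psi> t X"

definition monotone_solution ::
  "'w measure \<Rightarrow> real \<Rightarrow> 'a::euclidean_space coef \<Rightarrow> 'a coef \<Rightarrow> 'a sol \<Rightarrow> bool" where
  "monotone_solution M T F G W \<longleftrightarrow>
     continuous_map (sol_space T) euclidean W \<and>
     (\<exists>C. linear_growth T C W) \<and>
     (\<forall>Y\<in>Lspace M 2. \<forall>V\<in>Lspace M 2. \<forall>\<phi> h \<alpha> l. test_data M T \<phi> h \<alpha> l \<longrightarrow>
       (\<forall>t\<in>{0<..<T}. \<forall>X\<in>Lspace M 4.
          (\<forall>s\<in>{0..<T}. \<forall>Z\<in>Lspace M 2.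
             penalized M W V Y (test_fun M \<phi> h \<alpha> l) t X
             \<le> penalized M W V Y (test_fun M \<phi> h \<alpha> l) s Z) \<longrightarrow>
          (let U = lift_sol M W t X in
             test_dt M \<phi> h \<alpha> l t X + test_grad M h \<alpha> l t X (lift_coef M F X U)
             \<ge> pairing M (lift_coef M F X U) (\<lambda>w. U w - V w)
               + pairing M (lift_coef M G X U) (\<lambda>w. X w - Y w))))"

end

theory Submission
  imports Defs
begin

text \<open>
  Let \<open>(t0, X0)\<close> be a minimum point for \<open>W\<close>. Replace \<open>\<alpha>\<close> by \<open>\<alpha> + 1\<close> in the test function, and
  compensate by the first-order part at \<open>(t0, X0)\<close> of the added term \<open>e\<^sup>\<lambda>\<^sup>t E|X|\<^sup>4\<close> and by
  \<open>- K (t - t0)\<^sup>2\<close>. By uniform convexity of \<open>|x|\<^sup>4\<close> the new functional exceeds the old one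
  by a multiple of \<open>E|X - X0|\<^sup>4 + (t - t0)\<^sup>2\<close>, while at \<open>(t0, X0)\<close> the derivatives of the test
  function are unchanged. The gradient \<open>4 |X0|\<^sup>2 X0\<close> need not be square integrable; it is
  truncated, at a price that vanishes with the truncation.

  The functional of \<open>W\<^sub>n\<close> attains its minimum after an arbitrarily small linear perturbation, by
  Stegall's principle in \<open>L\<^sup>2\<close>. Laws with bounded fourth moment are relatively compact for the
  Wasserstein distance, so the functionals converge uniformly on sets of bounded fourth moment,
  and the minimum points converge to \<open>(t0, X0)\<close>, in \<open>L\<^sup>4\<close> for the second component. The
  inequalities for \<open>W\<^sub>n\<close> then pass to the limit by dominated convergence along a subsequence.
\<close>

text \<open>A strict minimum cannot be produced by subtracting a multiple of E|X - X0|^4 from the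
  test function: admissible functions are affine in X up to a negative multiple of e^(\<lambda>t)
  E|X|^4. Strictness must come out of the quartic term itself, by raising its coefficient and
  correcting with affine terms. The same restriction selects Stegall's principle: its perturbations
  are linear, so they are absorbed into \<open>h\<close>. A perturbation is used because the
  functional is handled only in the strong L^2 topology, where bounded sets are not compact.

  Two further obstacles shape the estimates. Convergence is uniform only on compact sets, whereas X
  may take values in the whole space; linear growth and the fourth moment control large values. And
  \<phi> is controlled only on [0, \<tau>] with \<tau> < T, so one minimises over a compact time
  interval and a ball of bounded fourth moment, and recovers a global minimum from a gap in value
  outside. Convergence in L^4, not merely in L^2, serves the term E[|X|^2 X . F], in which F grows
  linearly.\<close>

section \<open>Sequences in the spaces of states\<close>

text \<open>Without the triangle inequality the \<open>d\<close>-balls need not be open. But an open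
  set contains, by definition, a \<open>d\<close>-ball around each of its points, and the
  epsilon-delta criterion rests on this alone.\<close>

lemma continuous_map_dist_topology:
  fixes f :: "'b \<Rightarrow> 'c::metric_space"
  shows "continuous_map (dist_topology S d) euclidean f \<longleftrightarrow>
    (\<forall>x\<in>S. \<forall>e>0. \<exists>r>0. \<forall>y\<in>S. d x y < r \<longrightarrow> dist (f y) (f x) < e)" (is "?L \<longleftrightarrow> ?R")
proof
  assume L: ?L
  show ?R
  proof (intro ballI allI impI)
    fix x and e :: real assume x: "x \<in> S" "e > 0"
    have "openin (dist_topology S d) {y \<in> S. f y \<in> ball (f x) e}"
      using openin_continuous_map_preimage[OF L, of "ball (f x) e"]
      by (simp add: topspace_dist_topology)
    then obtain r where "r > 0" "\<forall>y\<in>S. d x y < r \<longrightarrow> f y \<in> ball (f x) e"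
      using x unfolding openin_dist_topology by auto
    then show "\<exists>r>0. \<forall>y\<in>S. d x y < r \<longrightarrow> dist (f y) (f x) < e"
      by (auto simp: dist_commute)
  qed
next
  assume R: ?R
  show ?L
    unfolding continuous_map topspace_dist_topology
  proof (intro conjI allI impI)
    show "f ` S \<subseteq> topspace euclidean" by simp
    fix U :: "'c set" assume "openin euclidean U"
    then have U: "open U" by simp
    show "openin (dist_topology S d) {x \<in> S. f x \<in> U}"
      unfolding openin_dist_topology
    proof (intro conjI ballI)
      show "{x \<in> S. f x \<in> U} \<subseteq> S" by auto
      fix x assume x: "x \<in> {x \<in> S. f x \<in> U}"
      then obtain e where e: "e > 0" "\<And>y. dist y (f x) < e \<Longrightarrow> y \<in> U"
        using U by (auto simp: open_dist)
      obtain r where "r > 0" "\<forall>y\<in>S. d x y < r \<longrightarrow> dist (f y) (f x) < e"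
        using R x e(1) by blast
      then show "\<exists>e>0. \<forall>y\<in>S. d x y < e \<longrightarrow> y \<in> {x \<in> S. f x \<in> U}"
        using e(2) by blast
    qed
  qed
qed

text \<open>Locally uniform convergence speaks of compact sets; sequences enter through these. One
  member of the cover absorbs all but finitely many terms. The distance is measured from the limit,
  since \<open>d\<close> is not assumed symmetric.\<close>

lemma compactin_dist_topology_convergent:
  assumes x: "x \<in> S" and y: "\<And>n::nat. y n \<in> S" and lim: "(\<lambda>n. d x (y n)) \<longlonglongrightarrow> 0"
  shows "compactin (dist_topology S d) (insert x (range y))"
  unfolding compactin_def topspace_dist_topology
proof (intro conjI allI impI)
  show "insert x (range y) \<subseteq> S" using x y by auto
  fix \<U> assume U: "Ball \<U> (openin (dist_topology S d)) \<and> insert x (range y) \<subseteq> \<Union>\<U>"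
  then obtain u where u: "u \<in> \<U>" "x \<in> u" by auto
  then obtain e where e: "e > 0" "\<forall>z\<in>S. d x z < e \<longrightarrow> z \<in> u"
    using U unfolding openin_dist_topology by blast
  obtain N where N: "\<And>n. n \<ge> N \<Longrightarrow> d x (y n) < e"
    using order_tendstoD(2)[OF lim e(1)] by (auto simp: eventually_sequentially)
  have "\<forall>n. \<exists>v\<in>\<U>. y n \<in> v" using U by (meson UnionE insertI2 rangeI subsetD)
  then obtain v where v: "\<And>n. v n \<in> \<U>" "\<And>n. y n \<in> v n" by metis
  have "insert x (range y) \<subseteq> \<Union>(insert u (v ` {..<N}))"
  proof
    fix z assume "z \<in> insert x (range y)"
    then consider "z = x" | n where "z = y n" "n < N" | n where "z = y n" "n \<ge> N"
      by (metis insertE rangeE not_less)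
    then show "z \<in> \<Union>(insert u (v ` {..<N}))"
    proof cases
      case 2
      then show ?thesis using v(2)[of n] by blast
    qed (use u e(2) N y in auto)
  qed
  then show "\<exists>\<F>. finite \<F> \<and> \<F> \<subseteq> \<U> \<and> insert x (range y) \<subseteq> \<Union>\<F>"
    using u v by (intro exI[of _ "insert u (v ` {..<N})"]) auto
qed

lemma locally_uniform_limit_tendsto:
  assumes "locally_uniform_limit (dist_topology S d) f g" "x \<in> S"
  shows "(\<lambda>n. f n x) \<longlonglongrightarrow> g x"
proof -
  have "compactin (dist_topology S d) {x}"
    using assms(2) by (simp add: topspace_dist_topology compactin_sing)
  then show ?thesis
    using assms(1) unfolding locally_uniform_limit_def
    by (metis insertI1 tendsto_uniform_limitI)
qed

lemma locally_uniform_limit_subseq: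
  assumes "locally_uniform_limit X f g" "filterlim r at_top sequentially"
  shows "locally_uniform_limit X (\<lambda>n. f (r n)) g"
  using assms unfolding locally_uniform_limit_def
  by (auto intro: filterlim_compose)

lemma locally_uniform_limit_const: "locally_uniform_limit X (\<lambda>n. f) f"
  unfolding locally_uniform_limit_def by (auto simp: uniform_limit_iff)

text \<open>The compact set that is tested consists of a sequence violating continuity together with
  its limit; on it a single \<open>f N\<close> is uniformly close to \<open>g\<close>.\<close>

lemma locally_uniform_limit_continuous:
  fixes f :: "nat \<Rightarrow> 'b \<Rightarrow> 'c::metric_space"
  assumes d: "\<And>x y. d x y \<ge> 0"
    and f: "\<And>n. continuous_map (dist_topology S d) euclidean (f n)"
    and lim: "locally_uniform_limit (dist_topology S d) f g"
  shows "continuous_map (dist_topology S d) euclidean g"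
  unfolding continuous_map_dist_topology
proof (intro ballI allI impI, rule ccontr)
  fix x and e :: real
  assume x: "x \<in> S" and e: "e > 0"
    and no: "\<not> (\<exists>r>0. \<forall>y\<in>S. d x y < r \<longrightarrow> dist (g y) (g x) < e)"
  have "\<forall>n::nat. \<exists>y\<in>S. d x y < inverse (Suc n) \<and> dist (g y) (g x) \<ge> e"
    using no by (metis inverse_positive_iff_positive not_less of_nat_0_less_iff zero_less_Suc)
  then obtain y where y: "\<And>n::nat. y n \<in> S" "\<And>n. d x (y n) < inverse (Suc n)"
      "\<And>n. dist (g (y n)) (g x) \<ge> e"
    by metis
  have yx: "(\<lambda>n. d x (y n)) \<longlonglongrightarrow> 0"
    by (rule tendsto_sandwich[OF _ _ tendsto_const LIMSEQ_inverse_real_of_nat])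
       (use d y(2) in \<open>auto intro!: always_eventually less_imp_le\<close>)
  then have "uniform_limit (insert x (range y)) f g sequentially"
    using lim compactin_dist_topology_convergent[of x S y d] x y(1)
    unfolding locally_uniform_limit_def by blast
  then have "\<forall>\<^sub>F n in sequentially. \<forall>z\<in>insert x (range y). dist (f n z) (g z) < e / 3"
    using e unfolding uniform_limit_iff by (meson divide_pos_pos zero_less_numeral)
  then obtain N where N: "\<And>z. z \<in> insert x (range y) \<Longrightarrow> dist (f N z) (g z) < e / 3"
    by (auto simp: eventually_sequentially)
  obtain r where r: "r > 0" "\<And>z. z \<in> S \<Longrightarrow> d x z < r \<Longrightarrow> dist (f N z) (f N x) < e / 3"
    using f[of N] x e unfolding continuous_map_dist_topology by (metis divide_pos_pos zero_less_numeral)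
  obtain n where n: "d x (y n) < r"
    using order_tendstoD(2)[OF yx r(1)] by (auto simp: eventually_sequentially)
  have "dist (f N (y n)) (f N x) < e / 3" using r(2) n y(1) by blast
  moreover have "dist (f N (y n)) (g (y n)) < e / 3" "dist (f N x) (g x) < e / 3" using N by auto
  moreover have "dist (g (y n)) (g x) \<le> dist (f N (y n)) (g (y n)) + dist (f N (y n)) (f N x) + dist (f N x) (g x)"
    by metric
  ultimately show False using y(3)[of n] by linarith
qed

text \<open>Continuous convergence: the form in which the hypotheses on solutions and coefficients
  are used at a sample point, where the argument moves along with the index.\<close>

lemma locally_uniform_limit_continuous_convergence:
  fixes f :: "nat \<Rightarrow> 'b \<Rightarrow> 'c::metric_space"
  assumes d: "\<And>x y. d x y \<ge> 0"
    and f: "\<And>n. continuous_map (dist_topology S d) euclidean (f n)"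
    and lim: "locally_uniform_limit (dist_topology S d) f g"
    and x: "x \<in> S" and y: "\<And>n. y n \<in> S" and yx: "(\<lambda>n. d x (y n)) \<longlonglongrightarrow> 0"
  shows "(\<lambda>n. f n (y n)) \<longlonglongrightarrow> g x"
proof (rule tendstoI)
  fix e :: real assume e: "e > 0"
  have "uniform_limit (insert x (range y)) f g sequentially"
    using lim compactin_dist_topology_convergent[of x S y d] x y yx
    unfolding locally_uniform_limit_def by blast
  then have "\<forall>\<^sub>F n in sequentially. \<forall>z\<in>insert x (range y). dist (f n z) (g z) < e / 2"
    using e unfolding uniform_limit_iff by (meson half_gt_zero_iff)
  then have 1: "\<forall>\<^sub>F n in sequentially. dist (f n (y n)) (g (y n)) < e / 2"
    by (rule eventually_mono) auto
  have "continuous_map (dist_topology S d) euclidean g"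
    using locally_uniform_limit_continuous[OF d f lim] .
  then obtain r where r: "r > 0" "\<And>z. z \<in> S \<Longrightarrow> d x z < r \<Longrightarrow> dist (g z) (g x) < e / 2"
    using x e unfolding continuous_map_dist_topology by (metis half_gt_zero_iff)
  have 2: "\<forall>\<^sub>F n in sequentially. dist (g (y n)) (g x) < e / 2"
    using order_tendstoD(2)[OF yx r(1)] by (rule eventually_mono) (use r(2) y in blast)
  from 1 2 show "\<forall>\<^sub>F n in sequentially. dist (f n (y n)) (g x) < e"
    by eventually_elim metric
qed

lemma W2_nonneg: "W2 \<mu> \<nu> \<ge> 0"
  by (simp add: W2_def)

section \<open>Moments of random vectors and the Wasserstein distance of their laws\<close>

context prob_space
begin

lemma E_rv_eq_integral:
  "integrable M (\<lambda>w. norm (X w) ^ q) \<Longrightarrow> E_rv M q X = ennreal (\<integral>w. norm (X w) ^ q \<partial>M)"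
  unfolding E_rv_def by (rule nn_integral_eq_integral) auto

lemma Lspace_iff:
  "X \<in> Lspace M q \<longleftrightarrow> X \<in> borel_measurable M \<and> integrable M (\<lambda>w. norm (X w) ^ q)"
proof (cases "X \<in> borel_measurable M")
  case True
  then have "integrable M (\<lambda>w. norm (X w) ^ q) \<longleftrightarrow> E_rv M q X < \<infinity>"
    unfolding integrable_iff_bounded E_rv_def by (simp add: norm_power)
  then show ?thesis using True by (simp add: Lspace_def)
qed (simp add: Lspace_def)

lemma E_law_law: "X \<in> borel_measurable M \<Longrightarrow> E_law q (law M X) = E_rv M q X"
  unfolding E_law_def E_rv_def by (rule nn_integral_distr) auto

lemma sqrt_E_law:
  assumes "X \<in> Lspace M 2"
  shows "sqrt (enn2real (E_law 2 (law M X))) = sqrt (\<integral>w. norm (X w) ^ 2 \<partial>M)"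
  using assms by (simp add: Lspace_iff E_law_law E_rv_eq_integral)

lemma law_in_P2: "X \<in> Lspace M 2 \<Longrightarrow> law M X \<in> P2"
  by (simp add: P2_def E_law_law Lspace_def prob_space_distr)

text \<open>The joint law of \<open>(X, Y)\<close> is a coupling and so bounds the infimum from
  above.\<close>

lemma W2_law_le:
  fixes X Y :: "'a \<Rightarrow> 'b::euclidean_space"
  assumes X: "X \<in> borel_measurable M" and Y: "Y \<in> borel_measurable M"
    and int: "integrable M (\<lambda>w. norm (X w - Y w) ^ 2)"
  shows "W2 (law M X) (law M Y) \<le> sqrt (\<integral>w. norm (X w - Y w) ^ 2 \<partial>M)"
proof -
  let ?p = "distr M borel (\<lambda>w. (X w, Y w))"
  have [measurable]: "(\<lambda>w. (X w, Y w)) \<in> borel_measurable M"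
    using X Y by (rule borel_measurable_Pair)
  have [measurable]: "(\<lambda>z :: 'b \<times> 'b. norm (fst z - snd z)) \<in> borel_measurable borel"
    by (intro borel_measurable_continuous_onI continuous_intros)
  have "distr ?p borel fst = law M X" "distr ?p borel snd = law M Y"
    by (subst distr_distr; simp add: o_def borel_measurable_continuous_onI continuous_on_fst continuous_on_snd)+
  then have "?p \<in> couplings (law M X) (law M Y)"
    by (simp add: couplings_def prob_space_distr)
  then have "(INF \<pi>\<in>couplings (law M X) (law M Y). \<integral>\<^sup>+ (x, y). ennreal ((norm (x - y))\<^sup>2) \<partial>\<pi>)
      \<le> (\<integral>\<^sup>+ (x, y). ennreal ((norm (x - y))\<^sup>2) \<partial>?p)"
    by (rule INF_lower)
  also have "\<dots> = (\<integral>\<^sup>+ w. ennreal (norm (X w - Y w) ^ 2) \<partial>M)"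
    by (subst nn_integral_distr) (auto simp: case_prod_beta)
  also have "\<dots> = ennreal (\<integral>w. norm (X w - Y w) ^ 2 \<partial>M)"
    using int by (rule nn_integral_eq_integral) auto
  finally have "enn2real (INF \<pi>\<in>couplings (law M X) (law M Y). \<integral>\<^sup>+ (x, y). ennreal ((norm (x - y))\<^sup>2) \<partial>\<pi>)
      \<le> (\<integral>w. norm (X w - Y w) ^ 2 \<partial>M)"
    by (auto intro!: enn2real_leI)
  then show ?thesis by (simp add: W2_def)
qed

lemma W2_refl_law: "X \<in> borel_measurable M \<Longrightarrow> W2 (law M X) (law M X) = 0"
  using W2_law_le[of X X] W2_nonneg[of "law M X" "law M X"] by simp

end

section \<open>Lebesgue spaces of random vectors\<close>

lemma subseq_eventually:
  fixes P :: "nat \<Rightarrow> nat \<Rightarrow> bool"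
  assumes "\<And>k. eventually (P k) sequentially"
  shows "\<exists>r. strict_mono r \<and> (\<forall>k. P k (r k))"
proof -
  obtain r where r: "\<forall>n. P n (r n) \<and> r n < r (Suc n)"
  proof (rule dependent_nat_choice[of P "\<lambda>_ x y. x < y", THEN exE])
    show "\<exists>x. P 0 x" using assms[of 0] by (auto simp: eventually_sequentially)
    show "\<exists>y. P (Suc n) y \<and> x < y" for x n
      using eventually_conj[OF assms[of "Suc n"] eventually_gt_at_top[of x]]
      by (auto simp: eventually_sequentially)
  qed auto
  then show ?thesis
    by (intro exI[of _ r]) (auto simp: strict_mono_Suc_iff)
qed

lemma norm_add_power_2: "norm (x + y) ^ 2 \<le> 2 * norm x ^ 2 + 2 * norm y ^ 2"
proof -
  have "norm (x + y) ^ 2 \<le> (norm x + norm y) ^ 2"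
    by (intro power_mono norm_triangle_ineq) auto
  also have "\<dots> \<le> 2 * norm x ^ 2 + 2 * norm y ^ 2"
    using sum_squares_bound[of "norm x" "norm y"] by (simp add: power2_sum)
  finally show ?thesis .
qed

lemma norm_diff_power_2: "norm (x - y) ^ 2 \<le> 2 * norm x ^ 2 + 2 * norm y ^ 2"
  using norm_add_power_2[of x "- y"] by simp

lemma norm_add_power_4: "norm (x + y) ^ 4 \<le> 8 * norm x ^ 4 + 8 * norm y ^ 4"
proof -
  have "norm (x + y) ^ 4 = (norm (x + y) ^ 2) ^ 2" by simp
  also have "\<dots> \<le> (2 * norm x ^ 2 + 2 * norm y ^ 2) ^ 2"
    by (intro power_mono norm_add_power_2) auto
  also have "\<dots> \<le> 2 * (2 * norm x ^ 2) ^ 2 + 2 * (2 * norm y ^ 2) ^ 2"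
    using sum_squares_bound[of "2 * norm x ^ 2" "2 * norm y ^ 2"] by (simp add: power2_sum)
  finally show ?thesis by (simp add: power_mult_distrib)
qed

lemma abs_inner_le: "\<bar>x \<bullet> y\<bar> \<le> norm x ^ 2 + norm y ^ 2"
  using Cauchy_Schwarz_ineq2[of x y] sum_squares_bound[of "norm x" "norm y"]
    zero_le_power2[of "norm x"] zero_le_power2[of "norm y"] by linarith

definition l2_norm :: "'w measure \<Rightarrow> ('w \<Rightarrow> 'a::euclidean_space) \<Rightarrow> real" where
  "l2_norm M X = sqrt (\<integral>w. norm (X w) ^ 2 \<partial>M)"

context prob_space
begin

lemma AE_summable_integral:
  fixes f :: "nat \<Rightarrow> 'a \<Rightarrow> real"
  assumes f: "\<And>k. integrable M (f k)" and nn: "\<And>k w. f k w \<ge> 0"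
    and sum: "summable (\<lambda>k. \<integral>w. f k w \<partial>M)"
  shows "AE w in M. summable (\<lambda>k. f k w)" "integrable M (\<lambda>w. \<Sum>k. f k w)"
proof -
  have [measurable]: "\<And>k. f k \<in> borel_measurable M" using f by auto
  have "(\<integral>\<^sup>+w. (\<Sum>k. ennreal (f k w)) \<partial>M) = (\<Sum>k. \<integral>\<^sup>+w. ennreal (f k w) \<partial>M)"
    by (rule nn_integral_suminf) measurable
  also have "\<dots> = (\<Sum>k. ennreal (\<integral>w. f k w \<partial>M))"
    by (intro suminf_cong nn_integral_eq_integral f AE_I2 nn)
  also have "\<dots> \<noteq> \<infinity>"
    by (subst suminf_ennreal2[OF _ sum]) (simp_all add: nn Bochner_Integration.integral_nonneg)
  finally have "AE w in M. (\<Sum>k. ennreal (f k w)) \<noteq> \<infinity>"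
    by (intro nn_integral_PInf_AE) auto
  then show *: "AE w in M. summable (\<lambda>k. f k w)"
  proof eventually_elim
    case (elim w)
    then show ?case using nn by (intro summable_suminf_not_top) auto
  qed
  show "integrable M (\<lambda>w. \<Sum>k. f k w)"
  proof (rule integrable_suminf)
    show "AE w in M. summable (\<lambda>k. norm (f k w))" using * nn by (simp add: abs_of_nonneg)
    show "summable (\<lambda>k. \<integral>w. norm (f k w) \<partial>M)" using sum nn by (simp add: abs_of_nonneg)
  qed (rule f)
qed

text \<open>The summed error \<open>S\<close> turns \<open>L\<^sup>p\<close> convergence into dominated convergence along a
  subsequence.\<close>

lemma Lp_subseq_dominated:
  fixes X :: "'a \<Rightarrow> 'b::euclidean_space"
  assumes p: "p > 0"
    and int: "\<And>n. integrable M (\<lambda>w. norm (Xn n w - X w) ^ p)"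
    and lim: "(\<lambda>n. \<integral>w. norm (Xn n w - X w) ^ p \<partial>M) \<longlonglongrightarrow> 0"
  obtains r S where "strict_mono r" "integrable M S"
    "AE w in M. (\<lambda>k. Xn (r k) w) \<longlonglongrightarrow> X w"
    "AE w in M. \<forall>k. norm (Xn (r k) w - X w) ^ p \<le> S w"
proof -
  have "\<forall>\<^sub>F n in sequentially. (\<integral>w. norm (Xn n w - X w) ^ p \<partial>M) < (1 / 2) ^ k" for k
    using lim by (rule order_tendstoD) auto
  then have "\<exists>r. strict_mono r \<and> (\<forall>k. (\<integral>w. norm (Xn (r k) w - X w) ^ p \<partial>M) < (1 / 2) ^ k)"
    by (rule subseq_eventually)
  then obtain r :: "nat \<Rightarrow> nat" where r: "strict_mono r"
      "\<And>k. (\<integral>w. norm (Xn (r k) w - X w) ^ p \<partial>M) < (1 / 2) ^ k"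
    by blast
  define f where "f k w = norm (Xn (r k) w - X w) ^ p" for k w
  have sum: "summable (\<lambda>k. \<integral>w. f k w \<partial>M)"
  proof (rule summable_comparison_test'[of "\<lambda>k. (1 / 2) ^ k"])
    show "summable (\<lambda>k. (1 / 2 :: real) ^ k)" by (intro summable_geometric) auto
    show "norm (\<integral>w. f k w \<partial>M) \<le> (1 / 2) ^ k" for k
      using less_imp_le[OF r(2)[of k]] by (simp add: f_def Bochner_Integration.integral_nonneg)
  qed
  have f: "integrable M (f k)" "f k w \<ge> 0" for k w
    using int by (auto simp: f_def[abs_def])
  note S = AE_summable_integral[OF f sum]
  show thesis
  proof (rule that[OF r(1) S(2)])
    show "AE w in M. (\<lambda>k. Xn (r k) w) \<longlonglongrightarrow> X w"
      using S(1)
    proof eventually_elim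
      case (elim w)
      have "(\<lambda>k. root p (f k w)) \<longlonglongrightarrow> root p 0"
        by (intro tendsto_real_root summable_LIMSEQ_zero elim)
      then have "(\<lambda>k. norm (Xn (r k) w - X w)) \<longlonglongrightarrow> 0"
        using p by (simp add: f_def real_root_power_cancel)
      then show ?case by (rule LIM_zero_cancel[OF tendsto_norm_zero_cancel])
    qed
    show "AE w in M. \<forall>k. norm (Xn (r k) w - X w) ^ p \<le> (\<Sum>k. f k w)"
      using S(1)
    proof eventually_elim
      case (elim w)
      have "f k w \<le> (\<Sum>k. f k w)" for k
        using sum_le_suminf[OF elim, of "{k}"] f(2) by simp
      then show ?case by (simp add: f_def)
    qed
  qed
qed

section \<open>The spaces L^2 and L^4, the inner product and completeness\<close>

lemma le_one_plus_square: "a \<ge> 0 \<Longrightarrow> a \<le> 1 + a\<^sup>2" for a :: real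
  using sum_squares_bound[of 1 a] by simp

lemma L2_add:
  fixes X :: "'a \<Rightarrow> 'b::euclidean_space"
  assumes "X \<in> Lspace M 2" "Y \<in> Lspace M 2"
  shows "(\<lambda>w. X w + Y w) \<in> Lspace M 2"
proof -
  have [measurable]: "X \<in> borel_measurable M" "Y \<in> borel_measurable M"
    using assms by (auto simp: Lspace_iff)
  have "integrable M (\<lambda>w. norm (X w + Y w) ^ 2)"
    by (rule Bochner_Integration.integrable_bound[of _ "\<lambda>w. 2 * norm (X w) ^ 2 + 2 * norm (Y w) ^ 2"])
       (use assms norm_add_power_2 in \<open>auto simp: Lspace_iff\<close>)
  then show ?thesis by (simp add: Lspace_iff)
qed

lemma L2_scale:
  fixes X :: "'a \<Rightarrow> 'b::euclidean_space"
  assumes "X \<in> Lspace M 2"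
  shows "(\<lambda>w. c *\<^sub>R X w) \<in> Lspace M 2"
  using assms by (auto simp: Lspace_iff power_mult_distrib)

lemma L2_diff:
  fixes X :: "'a \<Rightarrow> 'b::euclidean_space"
  assumes "X \<in> Lspace M 2" "Y \<in> Lspace M 2"
  shows "(\<lambda>w. X w - Y w) \<in> Lspace M 2"
  using L2_add[OF assms(1) L2_scale[OF assms(2), of "-1"]] by simp

lemma L4_diff:
  fixes X :: "'a \<Rightarrow> 'b::euclidean_space"
  assumes "X \<in> Lspace M 4" "Y \<in> Lspace M 4"
  shows "(\<lambda>w. X w - Y w) \<in> Lspace M 4"
proof -
  have [measurable]: "X \<in> borel_measurable M" "Y \<in> borel_measurable M"
    using assms by (auto simp: Lspace_iff)
  have "integrable M (\<lambda>w. norm (X w - Y w) ^ 4)"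
    by (rule Bochner_Integration.integrable_bound[of _ "\<lambda>w. 8 * norm (X w) ^ 4 + 8 * norm (Y w) ^ 4"])
       (use assms norm_add_power_4[of "X _" "- Y _"] in \<open>auto simp: Lspace_iff\<close>)
  then show ?thesis by (simp add: Lspace_iff)
qed

lemma L4_imp_L2:
  fixes X :: "'a \<Rightarrow> 'b::euclidean_space"
  assumes "X \<in> Lspace M 4"
  shows "X \<in> Lspace M 2"
proof -
  have [measurable]: "X \<in> borel_measurable M" using assms by (auto simp: Lspace_iff)
  have *: "norm x ^ 2 \<le> 1 + norm x ^ 4" for x :: 'b
    using le_one_plus_square[of "norm x ^ 2"] by simp
  have "integrable M (\<lambda>w. norm (X w) ^ 2)"
    by (rule Bochner_Integration.integrable_bound[of _ "\<lambda>w. 1 + norm (X w) ^ 4"])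
       (use assms * in \<open>auto simp: Lspace_iff\<close>)
  then show ?thesis by (simp add: Lspace_iff)
qed

lemma L2_const [simp]: "(\<lambda>w. c :: 'b::euclidean_space) \<in> Lspace M 2"
  by (simp add: Lspace_iff)

lemma pairing_integrable:
  fixes X :: "'a \<Rightarrow> 'b::euclidean_space"
  assumes "X \<in> Lspace M 2" "Y \<in> Lspace M 2"
  shows "integrable M (\<lambda>w. X w \<bullet> Y w)"
proof -
  have [measurable]: "X \<in> borel_measurable M" "Y \<in> borel_measurable M"
    using assms by (auto simp: Lspace_iff)
  show ?thesis
    by (rule Bochner_Integration.integrable_bound[of _ "\<lambda>w. norm (X w) ^ 2 + norm (Y w) ^ 2"])
       (use assms abs_inner_le in \<open>auto simp: Lspace_iff\<close>)
qed

lemma pairing_commute: "pairing M X Y = pairing M Y X"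
  by (simp add: pairing_def inner_commute)

lemma pairing_add_left:
  fixes X :: "'a \<Rightarrow> 'b::euclidean_space"
  assumes "X \<in> Lspace M 2" "Y \<in> Lspace M 2" "Z \<in> Lspace M 2"
  shows "pairing M (\<lambda>w. X w + Y w) Z = pairing M X Z + pairing M Y Z"
  using assms by (simp add: pairing_def inner_add_left pairing_integrable)

lemma pairing_diff_left:
  fixes X :: "'a \<Rightarrow> 'b::euclidean_space"
  assumes "X \<in> Lspace M 2" "Y \<in> Lspace M 2" "Z \<in> Lspace M 2"
  shows "pairing M (\<lambda>w. X w - Y w) Z = pairing M X Z - pairing M Y Z"
  using assms by (simp add: pairing_def inner_diff_left pairing_integrable)

lemma pairing_diff_right:
  fixes X :: "'a \<Rightarrow> 'b::euclidean_space"
  assumes "X \<in> Lspace M 2" "Y \<in> Lspace M 2" "Z \<in> Lspace M 2"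
  shows "pairing M Z (\<lambda>w. X w - Y w) = pairing M Z X - pairing M Z Y"
  using pairing_diff_left[OF assms] by (simp add: pairing_commute)

lemma pairing_scale_left: "pairing M (\<lambda>w. c *\<^sub>R X w) Z = c * pairing M X Z"
  by (simp add: pairing_def)

lemma pairing_scale_right: "pairing M Z (\<lambda>w. c *\<^sub>R X w) = c * pairing M Z X"
  by (simp add: pairing_def)

lemma l2_norm_square: "(l2_norm M X)\<^sup>2 = pairing M X X"
  by (simp add: l2_norm_def pairing_def power2_norm_eq_inner Bochner_Integration.integral_nonneg)

lemma l2_norm_nonneg [simp]: "l2_norm M X \<ge> 0"
  by (simp add: l2_norm_def)

lemma l2_norm_scale: "l2_norm M (\<lambda>w. c *\<^sub>R X w) = \<bar>c\<bar> * l2_norm M X"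
  by (simp add: l2_norm_def power_mult_distrib real_sqrt_mult)

lemma l2_norm_minus_commute: "l2_norm M (\<lambda>w. X w - Y w) = l2_norm M (\<lambda>w. Y w - X w)"
  by (simp add: l2_norm_def norm_minus_commute)

text \<open>\<open>Lspace\<close> consists of functions, not of classes, so the form is only
  semidefinite. The inequality is read off the nonnegative quadratic |X - sY|^2 in \<open>s\<close>,
  including the case of vanishing leading coefficient.\<close>

lemma pairing_le_l2_norm:
  fixes X :: "'a \<Rightarrow> 'b::euclidean_space"
  assumes X: "X \<in> Lspace M 2" and Y: "Y \<in> Lspace M 2"
  shows "\<bar>pairing M X Y\<bar> \<le> l2_norm M X * l2_norm M Y"
proof -
  define a b c where "a = pairing M X X" and "b = pairing M X Y" and "c = pairing M Y Y"
  have nn: "a \<ge> 0" "c \<ge> 0" unfolding a_def c_def l2_norm_square[symmetric] by auto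
  have "0 \<le> a - 2 * s * b + s\<^sup>2 * c" for s
  proof -
    let ?D = "\<lambda>w. X w - s *\<^sub>R Y w"
    have "0 \<le> pairing M ?D ?D" unfolding l2_norm_square[symmetric] by simp
    also have "\<dots> = pairing M X ?D - s * pairing M Y ?D"
      using X Y by (subst pairing_diff_left) (auto intro: L2_scale L2_diff simp: pairing_scale_left)
    also have "\<dots> = a - 2 * s * b + s\<^sup>2 * c"
      using X Y unfolding a_def b_def c_def
      by (simp add: pairing_diff_right L2_scale pairing_scale_right pairing_commute[of Y X]
          power2_eq_square algebra_simps)
    finally show ?thesis .
  qed
  note quad = this
  have "b\<^sup>2 \<le> a * c"
  proof (cases "c = 0")
    case True
    have "b = 0"
    proof (rule ccontr)
      assume "b \<noteq> 0"
      \<comment> \<open>For this \<open>s\<close> the quadratic, which is now affine in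
        \<open>s\<close>, takes the value -1.\<close>
      then show False using quad[of "(a + 1) / (2 * b)"] True nn by simp
    qed
    then show ?thesis using nn by simp
  next
    case False
    then have "c > 0" using nn by simp
    then show ?thesis using quad[of "b / c"] by (simp add: field_simps power2_eq_square)
  qed
  also have "a * c = (l2_norm M X * l2_norm M Y)\<^sup>2"
    by (simp add: a_def c_def power_mult_distrib l2_norm_square)
  finally show ?thesis
    unfolding b_def by (metis abs_le_square_iff abs_mult abs_of_nonneg l2_norm_nonneg)
qed

lemma l2_norm_triangle:
  fixes X :: "'a \<Rightarrow> 'b::euclidean_space"
  assumes X: "X \<in> Lspace M 2" and Y: "Y \<in> Lspace M 2"
  shows "l2_norm M (\<lambda>w. X w + Y w) \<le> l2_norm M X + l2_norm M Y"
proof -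
  have XY: "(\<lambda>w. X w + Y w) \<in> Lspace M 2" using X Y by (rule L2_add)
  have "(l2_norm M (\<lambda>w. X w + Y w))\<^sup>2 = pairing M X (\<lambda>w. X w + Y w) + pairing M Y (\<lambda>w. X w + Y w)"
    using X Y XY by (simp add: l2_norm_square pairing_add_left)
  also have "\<dots> \<le> (l2_norm M X + l2_norm M Y) * l2_norm M (\<lambda>w. X w + Y w)"
    using pairing_le_l2_norm[OF X XY] pairing_le_l2_norm[OF Y XY] by (simp add: algebra_simps)
  finally show ?thesis
    using l2_norm_nonneg[of X] l2_norm_nonneg[of Y] l2_norm_nonneg[of "\<lambda>w. X w + Y w"]
    by (cases "l2_norm M (\<lambda>w. X w + Y w) = 0") (auto simp: power2_eq_square)
qed

lemma l2_norm_triangle_diff: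
  fixes X :: "'a \<Rightarrow> 'b::euclidean_space"
  assumes X: "X \<in> Lspace M 2" and Y: "Y \<in> Lspace M 2" and Z: "Z \<in> Lspace M 2"
  shows "l2_norm M (\<lambda>w. X w - Z w) \<le> l2_norm M (\<lambda>w. X w - Y w) + l2_norm M (\<lambda>w. Y w - Z w)"
  using l2_norm_triangle[OF L2_diff[OF X Y] L2_diff[OF Y Z]] by simp

text \<open>Riesz-Fischer for representatives: a rapidly Cauchy subsequence converges almost surely,
  and Fatou's lemma shows that its limit is the limit in norm of the whole sequence.\<close>

lemma L2_complete:
  fixes Xn :: "nat \<Rightarrow> 'a \<Rightarrow> 'b::euclidean_space"
  assumes L2: "\<And>n. Xn n \<in> Lspace M 2"
    and Cauchy: "\<And>e. e > 0 \<Longrightarrow> \<exists>N. \<forall>m\<ge>N. \<forall>n\<ge>N. l2_norm M (\<lambda>w. Xn m w - Xn n w) < e"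
  obtains X where "X \<in> Lspace M 2" "(\<lambda>n. l2_norm M (\<lambda>w. Xn n w - X w)) \<longlonglongrightarrow> 0"
proof -
  have [measurable]: "\<And>n. Xn n \<in> borel_measurable M" using L2 by (auto simp: Lspace_iff)
  have int: "integrable M (\<lambda>w. norm (Xn m w - Xn n w) ^ 2)" for m n
    using L2_diff[OF L2 L2] by (simp add: Lspace_iff)
  have "\<forall>\<^sub>F N in sequentially. \<forall>m\<ge>N. \<forall>n\<ge>N. l2_norm M (\<lambda>w. Xn m w - Xn n w) < (1 / 2) ^ k" for k
  proof -
    obtain N where "\<forall>m\<ge>N. \<forall>n\<ge>N. l2_norm M (\<lambda>w. Xn m w - Xn n w) < (1 / 2) ^ k"
      using Cauchy[of "(1 / 2) ^ k"] by auto
    then show ?thesis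
      unfolding eventually_sequentially by (intro exI[of _ N]) (auto intro: le_trans)
  qed
  then have "\<exists>r. strict_mono r \<and> (\<forall>k. \<forall>m\<ge>r k. \<forall>n\<ge>r k. l2_norm M (\<lambda>w. Xn m w - Xn n w) < (1 / 2) ^ k)"
    by (rule subseq_eventually)
  then obtain r :: "nat \<Rightarrow> nat" where r: "strict_mono r"
      "\<And>k m n. m \<ge> r k \<Longrightarrow> n \<ge> r k \<Longrightarrow> l2_norm M (\<lambda>w. Xn m w - Xn n w) < (1 / 2) ^ k"
    by blast
  define f where "f k w = norm (Xn (r (Suc k)) w - Xn (r k) w)" for k w
  \<comment> \<open>The weights \<open>2 ^ k\<close> convert geometric bounds in L^2 into geometric
    bounds in L^1, which can be summed.\<close>
  have f_le: "f k w \<le> (1 / 2) ^ k + 2 ^ k * (f k w)\<^sup>2" for k w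
  proof -
    have "f k w = (1 / 2) ^ k * (2 ^ k * f k w)" by (simp add: power_divide)
    also have "\<dots> \<le> (1 / 2) ^ k * (1 + (2 ^ k * f k w)\<^sup>2)"
      by (intro mult_left_mono le_one_plus_square) (auto simp: f_def)
    also have "\<dots> = (1 / 2) ^ k + 2 ^ k * (f k w)\<^sup>2"
      by (simp add: power_divide power_mult_distrib field_simps power2_eq_square)
    finally show ?thesis .
  qed
  have intf2: "integrable M (\<lambda>w. (f k w)\<^sup>2)" for k using int by (simp add: f_def)
  have intf: "integrable M (f k)" for k
  proof (rule Bochner_Integration.integrable_bound[of _ "\<lambda>w. (1 / 2) ^ k + 2 ^ k * (f k w)\<^sup>2"])
    show "integrable M (\<lambda>w. (1 / 2) ^ k + 2 ^ k * (f k w)\<^sup>2)" using intf2 by auto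
    show "f k \<in> borel_measurable M" unfolding f_def by measurable
    show "AE w in M. norm (f k w) \<le> norm ((1 / 2) ^ k + 2 ^ k * (f k w)\<^sup>2)"
      using f_le order_trans[OF f_le abs_ge_self] by (auto simp: f_def)
  qed
  have If: "(\<integral>w. f k w \<partial>M) \<le> 2 * (1 / 2) ^ k" for k
  proof -
    have "l2_norm M (\<lambda>w. Xn (r (Suc k)) w - Xn (r k) w) \<le> (1 / 2) ^ k"
      using r(2)[of k "r (Suc k)" "r k"] r(1) by (simp add: less_imp_le strict_mono_less_eq)
    then have "(l2_norm M (\<lambda>w. Xn (r (Suc k)) w - Xn (r k) w))\<^sup>2 \<le> ((1 / 2) ^ k)\<^sup>2"
      by (intro power_mono) auto
    then have f2: "(\<integral>w. (f k w)\<^sup>2 \<partial>M) \<le> ((1 / 2) ^ k)\<^sup>2"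
      by (simp add: l2_norm_def f_def Bochner_Integration.integral_nonneg)
    have "(\<integral>w. f k w \<partial>M) \<le> (\<integral>w. (1 / 2) ^ k + 2 ^ k * (f k w)\<^sup>2 \<partial>M)"
      by (intro integral_mono f_le intf) (use intf2 in auto)
    also have "\<dots> = (1 / 2) ^ k + 2 ^ k * (\<integral>w. (f k w)\<^sup>2 \<partial>M)"
      using intf2 by (simp add: prob_space)
    also have "\<dots> \<le> (1 / 2) ^ k + 2 ^ k * ((1 / 2) ^ k)\<^sup>2"
      using f2 by (intro add_left_mono mult_left_mono) auto
    also have "\<dots> = 2 * (1 / 2) ^ k"
      by (simp add: power2_eq_square power_divide)
    finally show ?thesis .
  qed
  have "summable (\<lambda>k. \<integral>w. f k w \<partial>M)"
  proof (rule summable_comparison_test'[of "\<lambda>k. 2 * (1 / 2) ^ k"])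
    show "summable (\<lambda>k. 2 * (1 / 2 :: real) ^ k)" by (intro summable_mult summable_geometric) auto
    show "norm (\<integral>w. f k w \<partial>M) \<le> 2 * (1 / 2) ^ k" for k
      using If[of k] Bochner_Integration.integral_nonneg[of M "f k"] by (simp add: f_def)
  qed
  then have AEs: "AE w in M. summable (\<lambda>k. f k w)"
    by (intro AE_summable_integral intf) (auto simp: f_def)
  define X where "X w = lim (\<lambda>k. Xn (r k) w)" for w
  have [measurable]: "X \<in> borel_measurable M" unfolding X_def by measurable
  have AEX: "AE w in M. (\<lambda>k. Xn (r k) w) \<longlonglongrightarrow> X w"
    using AEs
  proof eventually_elim
    case (elim w)
    have "summable (\<lambda>k. Xn (r (Suc k)) w - Xn (r k) w)"
      by (rule summable_norm_cancel) (use elim in \<open>simp add: f_def\<close>)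
    then have "convergent (\<lambda>n. \<Sum>k<n. Xn (r (Suc k)) w - Xn (r k) w)"
      by (simp add: summable_iff_convergent)
    then have "convergent (\<lambda>n. Xn (r n) w - Xn (r 0) w)"
      by (simp add: sum_lessThan_telescope[where f = "\<lambda>k. Xn (r k) w"])
    then have "convergent (\<lambda>n. (Xn (r n) w - Xn (r 0) w) + Xn (r 0) w)"
      by (intro convergent_add convergent_const)
    then show ?case by (simp add: X_def convergent_LIMSEQ_iff)
  qed
  \<comment> \<open>The first index is fixed and only the second one runs along the subsequence, so
    the estimate holds for every \<open>n \<ge> r k\<close>.\<close>
  have Fatou: "(\<integral>\<^sup>+w. ennreal (norm (Xn n w - X w) ^ 2) \<partial>M) \<le> ennreal (((1 / 2) ^ k)\<^sup>2)"
    if n: "n \<ge> r k" for n k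
  proof -
    have "(\<integral>\<^sup>+w. ennreal (norm (Xn n w - X w) ^ 2) \<partial>M)
        = (\<integral>\<^sup>+w. liminf (\<lambda>j. ennreal (norm (Xn n w - Xn (r j) w) ^ 2)) \<partial>M)"
    proof (rule nn_integral_cong_AE)
      show "AE w in M. ennreal (norm (Xn n w - X w) ^ 2)
          = liminf (\<lambda>j. ennreal (norm (Xn n w - Xn (r j) w) ^ 2))"
        using AEX
      proof eventually_elim
        case (elim w)
        have "(\<lambda>j. ennreal (norm (Xn n w - Xn (r j) w) ^ 2)) \<longlonglongrightarrow> ennreal (norm (Xn n w - X w) ^ 2)"
          by (intro tendsto_intros elim)
        then show ?case by (rule lim_imp_Liminf[OF trivial_limit_sequentially, symmetric])
      qed
    qed
    also have "\<dots> \<le> liminf (\<lambda>j. \<integral>\<^sup>+w. ennreal (norm (Xn n w - Xn (r j) w) ^ 2) \<partial>M)"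
      by (rule nn_integral_liminf) measurable
    also have "\<dots> \<le> limsup (\<lambda>j. \<integral>\<^sup>+w. ennreal (norm (Xn n w - Xn (r j) w) ^ 2) \<partial>M)"
      by (rule Liminf_le_Limsup) simp
    also have "\<dots> \<le> ennreal (((1 / 2) ^ k)\<^sup>2)"
    proof (rule Limsup_bounded)
      show "\<forall>\<^sub>F j in sequentially. (\<integral>\<^sup>+w. ennreal (norm (Xn n w - Xn (r j) w) ^ 2) \<partial>M) \<le> ennreal (((1 / 2) ^ k)\<^sup>2)"
        using eventually_ge_at_top[of k]
      proof eventually_elim
        case (elim j)
        then have "l2_norm M (\<lambda>w. Xn n w - Xn (r j) w) \<le> (1 / 2) ^ k"
          using r(2)[of k n "r j"] r(1) n by (simp add: less_imp_le strict_mono_less_eq)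
        then have "(l2_norm M (\<lambda>w. Xn n w - Xn (r j) w))\<^sup>2 \<le> ((1 / 2) ^ k)\<^sup>2"
          by (intro power_mono) auto
        then have "(\<integral>w. norm (Xn n w - Xn (r j) w) ^ 2 \<partial>M) \<le> ((1 / 2) ^ k)\<^sup>2"
          by (simp add: l2_norm_def Bochner_Integration.integral_nonneg)
        then show ?case
          using int by (subst nn_integral_eq_integral) (auto intro: ennreal_leI)
      qed
    qed
    finally show ?thesis .
  qed
  have intX: "integrable M (\<lambda>w. norm (Xn n w - X w) ^ 2)" if "n \<ge> r 0" for n
    unfolding integrable_iff_bounded using Fatou[OF that] by (auto intro: le_less_trans)
  have l2le: "l2_norm M (\<lambda>w. Xn n w - X w) \<le> (1 / 2) ^ k" if "n \<ge> r k" for n k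
  proof -
    have "n \<ge> r 0" using that r(1) by (meson le0 order_trans strict_mono_less_eq)
    then have "ennreal (\<integral>w. norm (Xn n w - X w) ^ 2 \<partial>M) \<le> ennreal (((1 / 2) ^ k)\<^sup>2)"
      using Fatou[OF that] by (subst (asm) nn_integral_eq_integral) (auto intro: intX)
    then have "(\<integral>w. norm (Xn n w - X w) ^ 2 \<partial>M) \<le> ((1 / 2) ^ k)\<^sup>2"
      by (subst (asm) ennreal_le_iff) auto
    then show ?thesis unfolding l2_norm_def by (intro real_le_lsqrt) auto
  qed
  show thesis
  proof (rule that[of X])
    have "(\<lambda>w. Xn (r 0) w - X w) \<in> Lspace M 2"
      using intX[of "r 0"] by (simp add: Lspace_iff)
    from L2_diff[OF L2[of "r 0"] this] show "X \<in> Lspace M 2" by simp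
    show "(\<lambda>n. l2_norm M (\<lambda>w. Xn n w - X w)) \<longlonglongrightarrow> 0"
    proof (rule LIMSEQ_I)
      fix e :: real assume "e > 0"
      then obtain k where k: "(1 / 2) ^ k < e" using real_arch_pow_inv[of e "1/2"] by auto
      then have "norm (l2_norm M (\<lambda>w. Xn n w - X w) - 0) < e" if "n \<ge> r k" for n
        using l2le[OF that] by simp
      then show "\<exists>no. \<forall>n\<ge>no. norm (l2_norm M (\<lambda>w. Xn n w - X w) - 0) < e" by blast
    qed
  qed
qed

section \<open>Stegall's variational principle\<close>

lemma l2_norm_zero [simp]: "l2_norm M (\<lambda>w. 0) = 0"
  by (simp add: l2_norm_def)

lemma l2_norm_diff_square:
  fixes X :: "'a \<Rightarrow> 'b::euclidean_space"
  assumes X: "X \<in> Lspace M 2" and Y: "Y \<in> Lspace M 2"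
  shows "(l2_norm M (\<lambda>w. X w - Y w))\<^sup>2 = (l2_norm M X)\<^sup>2 - 2 * pairing M Y X + (l2_norm M Y)\<^sup>2"
  unfolding l2_norm_square
  using X Y by (simp add: pairing_diff_left pairing_diff_right L2_diff pairing_commute[of X Y])

text \<open>Tilting by \<open>-2 \<eta> \<xi> p0\<close>, where \<open>p0\<close> nearly minimises \<open>f + h0 - \<eta> |\<xi>|\<^sup>2\<close>, turns the
  subtracted square into \<open>\<eta> |\<xi> - \<xi> p0|\<^sup>2\<close> and so localises all near-minimisers.\<close>

lemma slice_small:
  fixes f :: "'p \<Rightarrow> real" and \<xi> :: "'p \<Rightarrow> 'a \<Rightarrow> 'b::euclidean_space"
  assumes D: "D \<noteq> {}" and xi: "\<And>p. p \<in> D \<Longrightarrow> \<xi> p \<in> Lspace M 2"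
    and R: "R > 0" "\<And>p. p \<in> D \<Longrightarrow> l2_norm M (\<xi> p) \<le> R"
    and B: "\<And>p. p \<in> D \<Longrightarrow> f p \<ge> B"
    and h0: "h0 \<in> Lspace M 2" and \<rho>: "\<rho> > 0" and r: "r > 0"
  shows "\<exists>h x \<delta>. h \<in> Lspace M 2 \<and> x \<in> Lspace M 2 \<and> \<delta> > 0 \<and> l2_norm M (\<lambda>w. h w - h0 w) \<le> \<rho> \<and>
    (\<forall>p\<in>D. f p + pairing M h (\<xi> p) \<le> (INF p\<in>D. f p + pairing M h (\<xi> p)) + \<delta>
        \<longrightarrow> l2_norm M (\<lambda>w. \<xi> p w - x w) \<le> r)"
proof -
  \<comment> \<open>\<open>\<eta>\<close> makes the bound \<open>2 * \<eta> * R\<close> on the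
    change of tilt equal to \<open>\<rho>\<close>. The slack \<open>\<delta>\<close> is spent twice,
    for \<open>p0\<close> and for the near-minimiser, so \<open>\<eta>\<close> times the squared
    distance is at most \<open>2 * \<delta> = \<eta> * r\<^sup>2\<close>.\<close>
  define \<eta> where "\<eta> = \<rho> / (2 * R)"
  define \<delta> where "\<delta> = \<eta> * r\<^sup>2 / 2"
  have pos: "\<eta> > 0" "\<delta> > 0" using R \<rho> r by (auto simp: \<eta>_def \<delta>_def)
  define g where "g p = f p + pairing M h0 (\<xi> p) - \<eta> * (l2_norm M (\<xi> p))\<^sup>2" for p
  have pair_ge: "pairing M h (\<xi> p) \<ge> - (l2_norm M h * R)" if "p \<in> D" "h \<in> Lspace M 2" for p h
    using pairing_le_l2_norm[OF that(2) xi[OF that(1)]]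
      mult_left_mono[OF R(2)[OF that(1)], of "l2_norm M h"] by simp
  have "g p \<ge> B - l2_norm M h0 * R - \<eta> * R\<^sup>2" if "p \<in> D" for p
  proof -
    have "(l2_norm M (\<xi> p))\<^sup>2 \<le> R\<^sup>2" using R(2)[OF that] by (intro power_mono) auto
    then have "\<eta> * (l2_norm M (\<xi> p))\<^sup>2 \<le> \<eta> * R\<^sup>2" using pos by (intro mult_left_mono) auto
    then show ?thesis using B[OF that] pair_ge[OF that h0] by (simp add: g_def)
  qed
  then have bdd: "bdd_below (g ` D)" by (intro bdd_belowI2)
  have "\<exists>p\<in>D. g p < (INF p\<in>D. g p) + \<delta>"
    using cINF_less_iff[OF D bdd, of "(INF p\<in>D. g p) + \<delta>"] pos by auto
  then obtain p0 where p0: "p0 \<in> D" "g p0 < (INF p\<in>D. g p) + \<delta>" by blast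
  define x where "x = \<xi> p0"
  define h where "h w = h0 w - (2 * \<eta>) *\<^sub>R x w" for w
  have x: "x \<in> Lspace M 2" using xi p0 by (simp add: x_def)
  have h: "h \<in> Lspace M 2" unfolding h_def using h0 x by (intro L2_diff L2_scale)
  have eq: "f p + pairing M h (\<xi> p) = g p + \<eta> * (l2_norm M (\<lambda>w. \<xi> p w - x w))\<^sup>2 - \<eta> * (l2_norm M x)\<^sup>2"
    if "p \<in> D" for p
    using xi[OF that] x h0 unfolding h_def g_def
    by (simp add: l2_norm_diff_square pairing_diff_left L2_scale pairing_scale_left algebra_simps)
  have "f p + pairing M h (\<xi> p) \<ge> B - l2_norm M h * R" if "p \<in> D" for p
    using B[OF that] pair_ge[OF that h] by simp
  then have "(INF p\<in>D. f p + pairing M h (\<xi> p)) \<le> f p0 + pairing M h (\<xi> p0)"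
    by (intro cINF_lower bdd_belowI2[of _ "B - l2_norm M h * R"] p0)
  also have "\<dots> = g p0 - \<eta> * (l2_norm M x)\<^sup>2"
    by (simp add: eq[OF p0(1)] x_def)
  finally have v: "(INF p\<in>D. f p + pairing M h (\<xi> p)) \<le> g p0 - \<eta> * (l2_norm M x)\<^sup>2" .
  have "l2_norm M (\<lambda>w. \<xi> p w - x w) \<le> r"
    if p: "p \<in> D" "f p + pairing M h (\<xi> p) \<le> (INF p\<in>D. f p + pairing M h (\<xi> p)) + \<delta>" for p
  proof -
    have "g p \<ge> (INF p\<in>D. g p)" using bdd p by (intro cINF_lower)
    then have "\<eta> * (l2_norm M (\<lambda>w. \<xi> p w - x w))\<^sup>2 \<le> 2 * \<delta>"
      using v p p0(2) eq[OF p(1)] by linarith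
    then have "(l2_norm M (\<lambda>w. \<xi> p w - x w))\<^sup>2 \<le> r\<^sup>2"
      using pos by (simp add: \<delta>_def)
    then show ?thesis using r by (meson less_imp_le power2_le_imp_le)
  qed
  moreover have "l2_norm M (\<lambda>w. h w - h0 w) \<le> \<rho>"
  proof -
    have "l2_norm M (\<lambda>w. h w - h0 w) = 2 * \<eta> * l2_norm M x"
      using l2_norm_scale[of "- (2 * \<eta>)" x] pos by (simp add: h_def)
    also have "\<dots> \<le> 2 * \<eta> * R" using R(2)[OF p0(1)] pos by (simp add: x_def)
    also have "\<dots> = \<rho>" using R by (simp add: \<eta>_def)
    finally show ?thesis .
  qed
  ultimately show ?thesis using h x pos by blast
qed

text \<open>The tilt acts through \<open>\<xi>\<close>, so a component that \<open>\<xi>\<close>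
  forgets (later, the time) is not tilted. No semicontinuity of \<open>f\<close> is at hand, hence
  only a minimising sequence with convergent image under \<open>\<xi>\<close> is asserted and
  attainment is left to the application. \<open>slice_small\<close> is iterated with radii
  \<open>(1 / 2) ^ k\<close>, each tilt so close to the previous one that near-minimisers for the
  limit tilt are still near-minimisers for every earlier tilt.\<close>

theorem stegall_L2:
  fixes f :: "'p \<Rightarrow> real" and \<xi> :: "'p \<Rightarrow> 'a \<Rightarrow> 'b::euclidean_space"
  assumes D: "D \<noteq> {}" and xi: "\<And>p. p \<in> D \<Longrightarrow> \<xi> p \<in> Lspace M 2"
    and R: "R > 0" "\<And>p. p \<in> D \<Longrightarrow> l2_norm M (\<xi> p) \<le> R"
    and B: "\<And>p. p \<in> D \<Longrightarrow> f p \<ge> B" and \<epsilon>: "\<epsilon> > 0"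
  obtains h x p v where "h \<in> Lspace M 2" "l2_norm M h \<le> \<epsilon>" "x \<in> Lspace M 2" "\<And>k::nat. p k \<in> D"
    "(\<lambda>k. l2_norm M (\<lambda>w. \<xi> (p k) w - x w)) \<longlonglongrightarrow> 0"
    "(\<lambda>k. f (p k) + pairing M h (\<xi> (p k))) \<longlonglongrightarrow> v"
    "\<And>q. q \<in> D \<Longrightarrow> v \<le> f q + pairing M h (\<xi> q)"
proof -
  define v where "v h = (INF p\<in>D. f p + pairing M h (\<xi> p))" for h
  have bdd: "bdd_below ((\<lambda>p. f p + pairing M h (\<xi> p)) ` D)" if h: "h \<in> Lspace M 2" for h
  proof (rule bdd_belowI2[of _ "B - l2_norm M h * R"])
    fix p assume p: "p \<in> D"
    show "B - l2_norm M h * R \<le> f p + pairing M h (\<xi> p)"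
      using B[OF p] pairing_le_l2_norm[OF h xi[OF p]]
        mult_left_mono[OF R(2)[OF p], of "l2_norm M h"] by simp
  qed
  have v_le: "v h \<le> f p + pairing M h (\<xi> p)" if "h \<in> Lspace M 2" "p \<in> D" for h p
    unfolding v_def using bdd[OF that(1)] that(2) by (rule cINF_lower)
  have tilt: "\<bar>pairing M h (\<xi> p) - pairing M h' (\<xi> p)\<bar> \<le> l2_norm M (\<lambda>w. h w - h' w) * R"
    if "h \<in> Lspace M 2" "h' \<in> Lspace M 2" "p \<in> D" for h h' p
  proof -
    have "\<bar>pairing M h (\<xi> p) - pairing M h' (\<xi> p)\<bar> = \<bar>pairing M (\<lambda>w. h w - h' w) (\<xi> p)\<bar>"
      using that xi by (simp add: pairing_diff_left)
    also have "\<dots> \<le> l2_norm M (\<lambda>w. h w - h' w) * l2_norm M (\<xi> p)"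
      using that xi by (intro pairing_le_l2_norm L2_diff) auto
    also have "\<dots> \<le> l2_norm M (\<lambda>w. h w - h' w) * R"
      using R(2) that by (intro mult_left_mono) auto
    finally show ?thesis .
  qed
  have v_lip: "v h \<le> v h' + l2_norm M (\<lambda>w. h w - h' w) * R"
    if "h \<in> Lspace M 2" "h' \<in> Lspace M 2" for h h'
  proof -
    have "v h - l2_norm M (\<lambda>w. h w - h' w) * R \<le> v h'"
      unfolding v_def[of h']
    proof (rule cINF_greatest[OF D])
      fix p assume "p \<in> D"
      then show "v h - l2_norm M (\<lambda>w. h w - h' w) * R \<le> f p + pairing M h' (\<xi> p)"
        using v_le[OF that(1), of p] tilt[OF that, of p] by linarith
    qed
    then show ?thesis by simp
  qed
  define S where "S k s \<longleftrightarrow> (case s of (h, x, \<delta>) \<Rightarrow> h \<in> Lspace M 2 \<and> x \<in> Lspace M 2 \<and> \<delta> > 0 \<and>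
      (\<forall>p\<in>D. f p + pairing M h (\<xi> p) \<le> v h + \<delta> \<longrightarrow> l2_norm M (\<lambda>w. \<xi> p w - x w) \<le> (1 / 2) ^ k))"
    for k :: nat and s :: "('a \<Rightarrow> 'b) \<times> ('a \<Rightarrow> 'b) \<times> real"
  have step: "\<exists>h x \<delta>. S k (h, x, \<delta>) \<and> l2_norm M (\<lambda>w. h w - h0 w) \<le> \<rho> \<and> \<delta> \<le> c"
    if h0: "h0 \<in> Lspace M 2" "\<rho> > 0" and c: "c > 0" for k h0 \<rho> c
  proof -
    obtain h x \<delta> where hx: "h \<in> Lspace M 2" "x \<in> Lspace M 2" "\<delta> > 0"
      "l2_norm M (\<lambda>w. h w - h0 w) \<le> \<rho>"
      "\<forall>p\<in>D. f p + pairing M h (\<xi> p) \<le> v h + \<delta> \<longrightarrow> l2_norm M (\<lambda>w. \<xi> p w - x w) \<le> (1 / 2) ^ k"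
      using slice_small[where f = f and \<xi> = \<xi> and r = "(1 / 2) ^ k", OF D xi R B h0]
      unfolding v_def by auto
    then have "S k (h, x, min \<delta> c)" using c unfolding S_def by auto
    then show ?thesis using hx(4) by (intro exI[of _ h] exI[of _ x] exI[of _ "min \<delta> c"]) auto
  qed
  \<comment> \<open>Moving the tilt by \<open>c\<close> in norm changes the functional by at most
    \<open>c * R\<close>. With steps \<open>\<delta> / (8 * R)\<close> and slacks at least halved,
    all later steps together amount to \<open>\<delta> / (4 * R)\<close>, that is to a quarter of
    the slack.\<close>
  define Q where "Q s s' \<longleftrightarrow> l2_norm M (\<lambda>w. fst s' w - fst s w) \<le> snd (snd s) / (8 * R) \<and>
      snd (snd s') \<le> snd (snd s) / 2"
    for s s' :: "('a \<Rightarrow> 'b) \<times> ('a \<Rightarrow> 'b) \<times> real"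
  \<comment> \<open>The first tilt may use \<open>\<epsilon> / 2\<close>; the bound on the first
    slack leaves at most \<open>2 * R * \<epsilon> / (4 * R)\<close>, again
    \<open>\<epsilon> / 2\<close>, for all later ones.\<close>
  obtain s0 where s0: "S 0 s0" "l2_norm M (fst s0) \<le> \<epsilon> / 2" "snd (snd s0) \<le> 2 * R * \<epsilon>"
    using step[of "\<lambda>w. 0" "\<epsilon> / 2" "2 * R * \<epsilon>" 0] R \<epsilon> by auto
  have "\<exists>s. \<forall>n. (S n (s n) \<and> (n = 0 \<longrightarrow> s n = s0)) \<and> Q (s n) (s (Suc n))"
  proof (rule dependent_nat_choice)
    show "\<exists>s. S 0 s \<and> ((0::nat) = 0 \<longrightarrow> s = s0)" using s0(1) by (intro exI[of _ s0]) simp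
  next
    fix s n assume s: "S n s \<and> (n = 0 \<longrightarrow> s = s0)"
    obtain h x \<delta> where sx: "s = (h, x, \<delta>)" by (cases s)
    have "h \<in> Lspace M 2" "\<delta> > 0" using s unfolding sx S_def by auto
    then show "\<exists>s'. (S (Suc n) s' \<and> (Suc n = 0 \<longrightarrow> s' = s0)) \<and> Q s s'"
      using step[of h "\<delta> / (8 * R)" "\<delta> / 2" "Suc n"] R(1) unfolding Q_def sx by fastforce
  qed
  then obtain s where s: "\<And>n. S n (s n)" "s 0 = s0" "\<And>n. Q (s n) (s (Suc n))" by auto
  define H \<delta> where "H n = fst (s n)" and "\<delta> n = snd (snd (s n))" for n
  have H: "H n \<in> Lspace M 2" and \<delta>: "\<delta> n > 0" for n
    using s(1)[of n] unfolding S_def H_def \<delta>_def by (auto split: prod.splits)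
  define xc where "xc n = fst (snd (s n))" for n
  have xc: "xc n \<in> Lspace M 2" for n
    using s(1)[of n] unfolding S_def xc_def by (auto split: prod.splits)
  have slice: "l2_norm M (\<lambda>w. \<xi> p w - xc n w) \<le> (1 / 2) ^ n"
    if "p \<in> D" "f p + pairing M (H n) (\<xi> p) \<le> v (H n) + \<delta> n" for n p
    using s(1)[of n] that unfolding S_def xc_def H_def \<delta>_def by (auto split: prod.splits)
  have Hstep: "l2_norm M (\<lambda>w. H (Suc n) w - H n w) \<le> \<delta> n / (8 * R)" and \<delta>step: "\<delta> (Suc n) \<le> \<delta> n / 2" for n
    using s(3)[of n] unfolding Q_def H_def \<delta>_def by auto
  \<comment> \<open>The telescoping bound closes the induction because halving gives
    \<open>\<delta> n / 2 \<le> \<delta> n - \<delta> (Suc n)\<close>.\<close>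
  have Hdist: "l2_norm M (\<lambda>w. H (k + m) w - H k w) \<le> (\<delta> k - \<delta> (k + m)) / (4 * R)" for k m
  proof (induction m)
    case (Suc m)
    have "l2_norm M (\<lambda>w. H (k + Suc m) w - H k w)
        \<le> l2_norm M (\<lambda>w. H (Suc (k + m)) w - H (k + m) w) + l2_norm M (\<lambda>w. H (k + m) w - H k w)"
      using l2_norm_triangle_diff[OF H H H] by simp
    also have "\<dots> \<le> \<delta> (k + m) / (8 * R) + (\<delta> k - \<delta> (k + m)) / (4 * R)"
      using Hstep Suc.IH by (intro add_mono) auto
    also have "\<dots> \<le> (\<delta> k - \<delta> (k + Suc m)) / (4 * R)"
      using \<delta>step[of "k + m"] R(1) by (simp add: field_simps)
    finally show ?case .
  qed simp
  have \<delta>le: "\<delta> n \<le> \<delta> 0 * (1 / 2) ^ n" for n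
  proof (induction n)
    case (Suc n)
    then show ?case using \<delta>step[of n] by simp
  qed simp
  have \<delta>lim: "\<delta> \<longlonglongrightarrow> 0"
  proof (rule tendsto_sandwich[OF _ _ tendsto_const])
    show "(\<lambda>n. \<delta> 0 * (1 / 2) ^ n) \<longlonglongrightarrow> 0"
      by (intro tendsto_mult_right_zero LIMSEQ_power_zero) auto
  qed (use \<delta>le \<delta> in \<open>auto intro!: always_eventually less_imp_le\<close>)
  have \<delta>mono: "\<delta> m \<le> \<delta> k" if "k \<le> m" for k m
  proof (rule lift_Suc_antimono_le[OF _ that])
    show "\<delta> (Suc n) \<le> \<delta> n" for n using \<delta>step[of n] \<delta>[of n] by simp
  qed
  have Hdist': "l2_norm M (\<lambda>w. H m w - H k w) \<le> \<delta> k / (4 * R)" if "k \<le> m" for k m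
  proof -
    have "l2_norm M (\<lambda>w. H m w - H k w) \<le> (\<delta> k - \<delta> m) / (4 * R)"
      using Hdist[of k "m - k"] that by simp
    also have "\<dots> \<le> \<delta> k / (4 * R)" using \<delta>[of m] R(1) by (simp add: field_simps)
    finally show ?thesis .
  qed
  have H_Cauchy: "\<exists>N. \<forall>m\<ge>N. \<forall>n\<ge>N. l2_norm M (\<lambda>w. H m w - H n w) < e" if e: "e > 0" for e
  proof -
    obtain N where N: "\<delta> N < 2 * R * e"
      using order_tendstoD(2)[OF \<delta>lim, of "2 * R * e"] e R(1) by (auto simp: eventually_sequentially)
    have "l2_norm M (\<lambda>w. H m w - H n w) < e" if "m \<ge> N" "n \<ge> N" for m n
    proof -
      have "l2_norm M (\<lambda>w. H m w - H n w) \<le> \<delta> N / (4 * R) + \<delta> N / (4 * R)"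
        using l2_norm_triangle_diff[OF H[of m] H[of N] H[of n]] Hdist'[OF that(1)] Hdist'[OF that(2)]
          l2_norm_minus_commute[of "H N" "H n"] by linarith
      also have "\<dots> < e" using N R(1) by (simp add: field_simps)
      finally show ?thesis .
    qed
    then show ?thesis by blast
  qed
  obtain h where h: "h \<in> Lspace M 2" "(\<lambda>n. l2_norm M (\<lambda>w. H n w - h w)) \<longlonglongrightarrow> 0"
    by (rule L2_complete[OF H H_Cauchy])
  have hH: "l2_norm M (\<lambda>w. h w - H k w) \<le> \<delta> k / (4 * R)" for k
  proof -
    have "(\<lambda>m. l2_norm M (\<lambda>w. H m w - h w) + \<delta> k / (4 * R)) \<longlonglongrightarrow> 0 + \<delta> k / (4 * R)"
      by (intro tendsto_intros h)
    then have lim: "(\<lambda>m. l2_norm M (\<lambda>w. H m w - h w) + \<delta> k / (4 * R)) \<longlonglongrightarrow> \<delta> k / (4 * R)"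
      by simp
    have "\<forall>\<^sub>F m in sequentially.
        l2_norm M (\<lambda>w. h w - H k w) \<le> l2_norm M (\<lambda>w. H m w - h w) + \<delta> k / (4 * R)"
      using eventually_ge_at_top[of k]
    proof eventually_elim
      case (elim m)
      show ?case
        using l2_norm_triangle_diff[OF h(1) H[of m] H[of k]] Hdist'[OF elim]
          l2_norm_minus_commute[of h "H m"] by linarith
    qed
    then show ?thesis by (rule tendsto_lowerbound[OF lim _ trivial_limit_sequentially])
  qed
  have "\<exists>p\<in>D. f p + pairing M h (\<xi> p) < v h + \<delta> k / 4" for k
    using cINF_less_iff[OF D bdd[OF h(1)], of "v h + \<delta> k / 4"] \<delta>[of k] by (auto simp: v_def)
  then obtain p where p: "\<And>k. p k \<in> D" "\<And>k. f (p k) + pairing M h (\<xi> (p k)) < v h + \<delta> k / 4"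
    by metis
  \<comment> \<open>Three quarters of the slack \<open>\<delta> k\<close> are spent: for replacing
    \<open>h\<close> by \<open>H k\<close>, for the near-minimality of \<open>p m\<close>, and for
    comparing the two infima.\<close>
  have close: "l2_norm M (\<lambda>w. \<xi> (p m) w - xc k w) \<le> (1 / 2) ^ k" if "k \<le> m" for k m
  proof (rule slice[OF p(1)])
    have *: "l2_norm M (\<lambda>w. h w - H k w) * R \<le> \<delta> k / 4"
      using hH[of k] R(1) by (simp add: field_simps)
    have "f (p m) + pairing M (H k) (\<xi> (p m)) \<le> f (p m) + pairing M h (\<xi> (p m)) + \<delta> k / 4"
      using tilt[OF h(1) H[of k] p(1)[of m]] * by linarith
    also have "\<dots> \<le> v h + \<delta> k / 2" using p(2)[of m] \<delta>mono[OF that] by linarith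
    also have "\<dots> \<le> v (H k) + \<delta> k" using v_lip[OF h(1) H[of k]] * \<delta>[of k] by linarith
    finally show "f (p m) + pairing M (H k) (\<xi> (p m)) \<le> v (H k) + \<delta> k" .
  qed
  have p_Cauchy: "\<exists>N. \<forall>m\<ge>N. \<forall>n\<ge>N. l2_norm M (\<lambda>w. \<xi> (p m) w - \<xi> (p n) w) < e" if e: "e > 0" for e
  proof -
    obtain N where N: "(1 / 2) ^ N < e / 2" using real_arch_pow_inv[of "e / 2" "1 / 2"] e by auto
    have "l2_norm M (\<lambda>w. \<xi> (p m) w - \<xi> (p n) w) < e" if "m \<ge> N" "n \<ge> N" for m n
      using l2_norm_triangle_diff[OF xi[OF p(1)[of m]] xc[of N] xi[OF p(1)[of n]]]
        close[OF that(1)] close[OF that(2)] N l2_norm_minus_commute[of "xc N" "\<xi> (p n)"]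
      by linarith
    then show ?thesis by blast
  qed
  obtain x where x: "x \<in> Lspace M 2" "(\<lambda>k. l2_norm M (\<lambda>w. \<xi> (p k) w - x w)) \<longlonglongrightarrow> 0"
    by (rule L2_complete[OF xi[OF p(1)] p_Cauchy])
  have hsmall: "l2_norm M h \<le> \<epsilon>"
  proof -
    have "l2_norm M h \<le> l2_norm M (\<lambda>w. h w - H 0 w) + l2_norm M (H 0)"
      using l2_norm_triangle[OF L2_diff[OF h(1) H[of 0]] H[of 0]] by simp
    also have "\<dots> \<le> \<delta> 0 / (4 * R) + \<epsilon> / 2"
      using hH[of 0] s0(2) by (intro add_mono) (auto simp: H_def s)
    also have "\<dots> \<le> \<epsilon>" using s0(3) R(1) by (simp add: \<delta>_def s field_simps)
    finally show ?thesis .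
  qed
  have "(\<lambda>k. f (p k) + pairing M h (\<xi> (p k))) \<longlonglongrightarrow> v h"
  proof (rule tendsto_sandwich[OF _ _ tendsto_const])
    have "(\<lambda>k. v h + \<delta> k / 4) \<longlonglongrightarrow> v h + 0 / 4" by (intro tendsto_intros \<delta>lim) simp
    then show "(\<lambda>k. v h + \<delta> k / 4) \<longlonglongrightarrow> v h" by simp
  qed (use p v_le[OF h(1)] in \<open>auto intro!: always_eventually less_imp_le\<close>)
  from that[OF h(1) hsmall x(1) p(1) x(2) this v_le[OF h(1)]] show thesis .
qed

end

section \<open>Coding vectors by real numbers\<close>

text \<open>A Cantor-set code: it is used with digits 0 and 1 only, so that every tail is at most
  1/3, distinct digit sequences have distinct values, and rounding down recovers the digits.\<close>

definition code4 :: "(nat \<Rightarrow> int) \<Rightarrow> real" where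
  "code4 a = (\<Sum>j. of_int (a j) / 4 ^ Suc j)"

lemma summable_code4:
  assumes "\<And>j. a j \<in> {0, 1::int}"
  shows "summable (\<lambda>j. of_int (a j) / 4 ^ Suc j :: real)"
proof (rule summable_comparison_test')
  show "summable (\<lambda>j. (1 / 4 :: real) ^ j)" by (intro summable_geometric) auto
  show "norm (of_int (a j) / 4 ^ Suc j :: real) \<le> (1 / 4) ^ j" for j
    using assms[of j] by (auto simp: power_divide divide_simps)
qed

lemma code4_range:
  assumes a: "\<And>j. a j \<in> {0, 1::int}"
  shows "0 \<le> code4 a" "code4 a \<le> 1 / 3"
proof -
  show "0 \<le> code4 a"
    unfolding code4_def
  proof (intro suminf_nonneg summable_code4 a)
    show "0 \<le> real_of_int (a n) / 4 ^ Suc n" for n using a[of n] by auto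
  qed
  have g: "(\<lambda>j. (1 / 4) * (1 / 4 :: real) ^ j) sums ((1 / 4) * (1 / (1 - 1 / 4)))"
    by (intro sums_mult geometric_sums) auto
  have "code4 a \<le> (\<Sum>j. (1 / 4) * (1 / 4 :: real) ^ j)"
    unfolding code4_def
  proof (rule suminf_le)
    show "of_int (a j) / 4 ^ Suc j \<le> (1 / 4) * (1 / 4 :: real) ^ j" for j
      using a[of j] by (auto simp: power_divide)
  qed (use summable_code4[of a, OF a] g in \<open>auto simp: sums_iff\<close>)
  also have "\<dots> = 1 / 3" using g by (simp add: sums_iff)
  finally show "code4 a \<le> 1 / 3" .
qed

lemma code4_shift:
  assumes a: "\<And>j. a j \<in> {0, 1::int}"
  shows "4 * code4 a = of_int (a 0) + code4 (\<lambda>j. a (Suc j))"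
proof -
  have "code4 a = (\<Sum>j. of_int (a (Suc j)) / 4 ^ Suc (Suc j)) + of_int (a 0) / 4"
    unfolding code4_def using suminf_split_head[OF summable_code4[of a, OF a]] by simp
  moreover have "4 * (\<Sum>j. of_int (a (Suc j)) / 4 ^ Suc (Suc j) :: real) = code4 (\<lambda>j. a (Suc j))"
    unfolding code4_def
    by (subst suminf_mult[symmetric])
       (use summable_Suc_iff[THEN iffD2, OF summable_code4[of a, OF a]] in \<open>simp_all add: field_simps\<close>)
  ultimately show ?thesis by simp
qed

text \<open>After a shift by \<open>n\<close> places the remainder is again a code, hence lies in
  [0, 1/3] and does not disturb the floor. The two claims feed each other and are proved in one
  induction.\<close>

lemma code4_split:
  assumes a: "\<And>j. a j \<in> {0, 1::int}"
  shows "4 ^ n * code4 a = of_int \<lfloor>4 ^ n * code4 a\<rfloor> + code4 (\<lambda>j. a (n + j))"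
    and "\<lfloor>4 ^ Suc n * code4 a\<rfloor> = 4 * \<lfloor>4 ^ n * code4 a\<rfloor> + a n"
proof -
  have fl: "\<lfloor>of_int N + code4 (\<lambda>j. a (n + j))\<rfloor> = N" for N n
    using code4_range[of "\<lambda>j. a (n + j)"] a by (simp add: floor_unique)
  have *: "4 ^ n * code4 a = of_int \<lfloor>4 ^ n * code4 a\<rfloor> + code4 (\<lambda>j. a (n + j)) \<and>
      \<lfloor>4 ^ Suc n * code4 a\<rfloor> = 4 * \<lfloor>4 ^ n * code4 a\<rfloor> + a n" for n
  proof (induction n)
    case 0
    have "4 * code4 a = of_int (a 0) + code4 (\<lambda>j. a (1 + j))"
      using code4_shift[of a, OF a] by simp
    then show ?case using fl[of 0 0] fl[of "a 0" 1] by simp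
  next
    case (Suc n)
    have s: "4 * code4 (\<lambda>j. a (n + j)) = of_int (a n) + code4 (\<lambda>j. a (Suc n + j))" for n
      using code4_shift[of "\<lambda>j. a (n + j)"] a by simp
    have "4 ^ Suc n * code4 a = of_int (4 * \<lfloor>4 ^ n * code4 a\<rfloor> + a n) + code4 (\<lambda>j. a (Suc n + j))"
      using Suc.IH s[of n] by simp
    then have 1: "4 ^ Suc n * code4 a = of_int \<lfloor>4 ^ Suc n * code4 a\<rfloor> + code4 (\<lambda>j. a (Suc n + j))"
      using fl[of "4 * \<lfloor>4 ^ n * code4 a\<rfloor> + a n" "Suc n"] by (simp only:)
    have "4 ^ Suc (Suc n) * code4 a
        = of_int (4 * \<lfloor>4 ^ Suc n * code4 a\<rfloor> + a (Suc n)) + code4 (\<lambda>j. a (Suc (Suc n) + j))"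
      using 1 s[of "Suc n"] by simp
    then have "\<lfloor>4 ^ Suc (Suc n) * code4 a\<rfloor> = 4 * \<lfloor>4 ^ Suc n * code4 a\<rfloor> + a (Suc n)"
      using fl[of "4 * \<lfloor>4 ^ Suc n * code4 a\<rfloor> + a (Suc n)" "Suc (Suc n)"] by (simp only:)
    with 1 show ?case by blast
  qed
  show "4 ^ n * code4 a = of_int \<lfloor>4 ^ n * code4 a\<rfloor> + code4 (\<lambda>j. a (n + j))"
    "\<lfloor>4 ^ Suc n * code4 a\<rfloor> = 4 * \<lfloor>4 ^ n * code4 a\<rfloor> + a n"
    using *[of n] by auto
qed

definition digit4 :: "nat \<Rightarrow> real \<Rightarrow> int" where
  "digit4 j c = \<lfloor>4 ^ Suc j * c\<rfloor> mod 4"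

lemma digit4_code4:
  assumes a: "\<And>j. a j \<in> {0, 1::int}"
  shows "digit4 j (code4 a) = a j"
  unfolding digit4_def code4_split(2)[of a, OF a] using a[of j] by auto

text \<open>Since the digits are at most 1, codes stay away from the right end of their base 4
  cylinders, so that convergence of codes forces convergence of digits.\<close>

lemma code4_convergent:
  assumes a: "\<And>m j. a m j \<in> {0, 1::int}" and lim: "(\<lambda>m::nat. code4 (a m)) \<longlonglongrightarrow> c"
  shows "\<exists>N. \<forall>m\<ge>N. \<forall>m'\<ge>N. a m j = a m' j"
proof -
  have ev: "\<exists>N. \<forall>m\<ge>N. \<forall>m'\<ge>N. \<lfloor>4 ^ n * code4 (a m)\<rfloor> = \<lfloor>4 ^ n * code4 (a m')\<rfloor>" for n
  proof -
    have "(\<lambda>m. 4 ^ n * code4 (a m)) \<longlonglongrightarrow> 4 ^ n * c" by (intro tendsto_intros lim)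
    \<comment> \<open>Scaled codes within 1/6 of their limit differ by less than 1/3, and their
      fractional parts by at most 1/3, so their integer parts differ by less than 1.\<close>
    then obtain N where N: "\<And>m. m \<ge> N \<Longrightarrow> dist (4 ^ n * code4 (a m)) (4 ^ n * c) < 1 / 6"
      unfolding lim_sequentially by (metis zero_less_divide_1_iff zero_less_numeral)
    have "\<lfloor>4 ^ n * code4 (a m)\<rfloor> = \<lfloor>4 ^ n * code4 (a m')\<rfloor>" if "m \<ge> N" "m' \<ge> N" for m m'
    proof -
      let ?f = "\<lambda>m. \<lfloor>4 ^ n * code4 (a m)\<rfloor>"
      have r: "0 \<le> code4 (\<lambda>j. a m (n + j))" "code4 (\<lambda>j. a m (n + j)) \<le> 1 / 3" for m
        using code4_range[of "\<lambda>j. a m (n + j)"] a by auto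
      have "\<bar>4 ^ n * code4 (a m) - 4 ^ n * code4 (a m')\<bar> < 1 / 3"
        using N[OF that(1)] N[OF that(2)] unfolding dist_real_def by linarith
      then have "\<bar>real_of_int (?f m) - real_of_int (?f m')\<bar> < 1"
        using code4_split(1)[of "a m" n, OF a] code4_split(1)[of "a m'" n, OF a] r[of m] r[of m']
        by linarith
      then show ?thesis by linarith
    qed
    then show ?thesis by blast
  qed
  obtain N1 where N1: "\<forall>m\<ge>N1. \<forall>m'\<ge>N1. \<lfloor>4 ^ j * code4 (a m)\<rfloor> = \<lfloor>4 ^ j * code4 (a m')\<rfloor>"
    using ev by blast
  obtain N2 where N2: "\<forall>m\<ge>N2. \<forall>m'\<ge>N2. \<lfloor>4 ^ Suc j * code4 (a m)\<rfloor> = \<lfloor>4 ^ Suc j * code4 (a m')\<rfloor>"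
    using ev by blast
  have "a m j = a m' j" if "m \<ge> max N1 N2" "m' \<ge> max N1 N2" for m m'
    using code4_split(2)[of "a m" j, OF a] code4_split(2)[of "a m'" j, OF a]
      N1[rule_format, of m m'] N2[rule_format, of m m'] that by simp
  then show ?thesis by blast
qed

definition bit2 :: "nat \<Rightarrow> real \<Rightarrow> int" where
  "bit2 k y = \<lfloor>2 ^ Suc k * y\<rfloor> mod 2"

lemma bit2_range: "bit2 k y \<in> {0, 1}"
  by (auto simp: bit2_def)

lemma floor_double: "\<lfloor>2 * z :: real\<rfloor> = 2 * \<lfloor>z\<rfloor> + \<lfloor>2 * z\<rfloor> mod 2"
proof -
  have "\<lfloor>2 * z\<rfloor> div 2 = \<lfloor>z\<rfloor>" using floor_divide_real_eq_div[of 2 "2 * z"] by simp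
  then show ?thesis by (metis mult_div_mod_eq)
qed

lemma sum_bit2:
  assumes "0 \<le> y" "y < 1"
  shows "(\<Sum>k<K. of_int (bit2 k y) / 2 ^ Suc k) = real_of_int \<lfloor>2 ^ K * y\<rfloor> / 2 ^ K"
proof (induction K)
  case 0
  then show ?case using assms by (simp add: floor_eq_iff)
next
  case (Suc K)
  have "real_of_int \<lfloor>2 ^ Suc K * y\<rfloor> = 2 * real_of_int \<lfloor>2 ^ K * y\<rfloor> + of_int (bit2 K y)"
    using floor_double[of "2 ^ K * y"] unfolding bit2_def
    by (metis mult.assoc of_int_add of_int_mult of_int_numeral power_Suc)
  then show ?case using Suc.IH by (simp add: field_simps)
qed

lemma sum_bit2_close:
  assumes "0 \<le> y" "y < 1"
  shows "\<bar>(\<Sum>k<K. of_int (bit2 k y) / 2 ^ Suc k) - y\<bar> \<le> (1 / 2) ^ K"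
proof -
  have "real_of_int \<lfloor>2 ^ K * y\<rfloor> \<le> 2 ^ K * y" "2 ^ K * y < real_of_int \<lfloor>2 ^ K * y\<rfloor> + 1" by linarith+
  then have "\<bar>real_of_int \<lfloor>2 ^ K * y\<rfloor> - 2 ^ K * y\<bar> \<le> 1" by linarith
  then have "\<bar>real_of_int \<lfloor>2 ^ K * y\<rfloor> - 2 ^ K * y\<bar> / 2 ^ K \<le> 1 / 2 ^ K"
    by (rule divide_right_mono) auto
  moreover have "real_of_int \<lfloor>2 ^ K * y\<rfloor> / 2 ^ K - y = (real_of_int \<lfloor>2 ^ K * y\<rfloor> - 2 ^ K * y) / 2 ^ K"
    by (simp add: field_simps)
  ultimately show ?thesis unfolding sum_bit2[OF assms] by (simp add: power_divide abs_divide)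
qed

lemma bit2_lim:
  assumes "0 \<le> y" "y < 1"
  shows "(\<lambda>K. \<Sum>k<K. of_int (bit2 k y) / 2 ^ Suc k) \<longlonglongrightarrow> y"
proof (rule Lim_transform_bound[where g = "\<lambda>K. (1 / 2 :: real) ^ K", THEN LIM_zero_cancel])
  show "\<forall>\<^sub>F K in sequentially. norm ((\<Sum>k<K. of_int (bit2 k y) / 2 ^ Suc k) - y) \<le> norm ((1 / 2 :: real) ^ K)"
    using sum_bit2_close[OF assms] by simp
qed (auto intro: LIMSEQ_power_zero)

text \<open>Only convergence is claimed: at a dyadic limit the bits of the limit can differ from the
  eventual bits, as for \<open>1 / 2 - (1 / 2) ^ m\<close>.\<close>

lemma bit2_convergent:
  assumes y: "\<And>m. 0 \<le> y m" "\<And>m. y m < 1"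
    and ev: "\<And>k. \<exists>N. \<forall>m\<ge>N. \<forall>m'\<ge>N. bit2 k (y m) = bit2 k (y m')"
  shows "convergent (y :: nat \<Rightarrow> real)"
  unfolding Cauchy_convergent_iff[symmetric] Cauchy_def
proof (intro allI impI)
  fix e :: real assume "e > 0"
  then obtain K where K: "(1 / 2) ^ K < e / 2" using real_arch_pow_inv[of "e / 2" "1 / 2"] by auto
  obtain N where N: "\<And>k. \<forall>m\<ge>N k. \<forall>m'\<ge>N k. bit2 k (y m) = bit2 k (y m')" using ev by metis
  define N' where "N' = Max (insert 0 (N ` {..<K}))"
  have N': "N k \<le> N'" if "k < K" for k unfolding N'_def using that by (intro Max_ge) auto
  have "dist (y m) (y n) < e" if "m \<ge> N'" "n \<ge> N'" for m n
  proof -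
    have "(\<Sum>k<K. of_int (bit2 k (y m)) / 2 ^ Suc k :: real) = (\<Sum>k<K. of_int (bit2 k (y n)) / 2 ^ Suc k)"
    proof (intro sum.cong refl)
      fix k assume "k \<in> {..<K}"
      then have "bit2 k (y m) = bit2 k (y n)" using N[of k] N'[of k] that by (meson lessThan_iff order_trans)
      then show "of_int (bit2 k (y m)) / 2 ^ Suc k = (of_int (bit2 k (y n)) / 2 ^ Suc k :: real)" by simp
    qed
    then show ?thesis
      using sum_bit2_close[OF y, of m K] sum_bit2_close[OF y, of n K] K unfolding dist_real_def by linarith
  qed
  then show "\<exists>M. \<forall>m\<ge>M. \<forall>n\<ge>M. dist (y m) (y n) < e" by blast
qed

section \<open>The real line squeezed into the unit interval, and the coding of vectors\<close>

definition squash :: "real \<Rightarrow> real" where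
  "squash t = 1 / 2 + t / (2 * (1 + \<bar>t\<bar>))"

definition unsquash :: "real \<Rightarrow> real" where
  "unsquash y = (2 * y - 1) / (1 - \<bar>2 * y - 1\<bar>)"

lemma squash_range: "0 < squash t" "squash t < 1"
  unfolding squash_def by (auto simp: field_simps abs_if)

lemma unsquash_squash: "unsquash (squash t) = t"
proof -
  have "2 * squash t - 1 = t / (1 + \<bar>t\<bar>)" by (simp add: squash_def field_simps)
  moreover have "1 - \<bar>t / (1 + \<bar>t\<bar>)\<bar> = 1 / (1 + \<bar>t\<bar>)" by (simp add: abs_divide field_simps)
  ultimately show ?thesis by (simp add: unsquash_def add_pos_nonneg[THEN less_imp_neq, symmetric])
qed

lemma squash_mono:
  assumes "s \<le> t"
  shows "squash s \<le> squash t"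
proof (cases "s < 0 \<and> 0 \<le> t")
  case True
  then have "s / (2 * (1 + \<bar>s\<bar>)) \<le> 0" "0 \<le> t / (2 * (1 + \<bar>t\<bar>))"
    by (auto intro!: divide_nonpos_pos)
  then show ?thesis by (simp add: squash_def)
next
  case False
  then show ?thesis using assms by (auto simp: squash_def field_simps abs_if)
qed

lemma squash_measurable [measurable]: "squash \<in> borel_measurable borel"
  unfolding squash_def by measurable

lemma unsquash_measurable [measurable]: "unsquash \<in> borel_measurable borel"
  unfolding unsquash_def by measurable

lemma unsquash_tendsto:
  assumes "(y \<longlongrightarrow> l) F" "0 < l" "l < 1"
  shows "((\<lambda>m. unsquash (y m)) \<longlongrightarrow> unsquash l) F"
  unfolding unsquash_def using assms by (intro tendsto_intros) (auto simp: abs_if)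

lemma bit2_measurable [measurable]: "(\<lambda>y. real_of_int (bit2 k y)) \<in> borel_measurable borel"
  unfolding bit2_def by measurable

lemma digit4_measurable [measurable]: "(\<lambda>y. real_of_int (digit4 k y)) \<in> borel_measurable borel"
  unfolding digit4_def by measurable


definition coord :: "nat \<Rightarrow> 'b::euclidean_space" where
  "coord = (SOME u. bij_betw u {0..<DIM('b)} Basis)"

lemma coord_bij: "bij_betw (coord :: nat \<Rightarrow> 'b::euclidean_space) {0..<DIM('b)} Basis"
  unfolding coord_def using ex_bij_betw_nat_finite[OF finite_Basis] by (rule someI_ex)

text \<open>The bits of all coordinates are merged into one sequence. Positions whose second component
  is at least the dimension carry junk, which decoding ignores.\<close>

definition vec_bits :: "'b::euclidean_space \<Rightarrow> nat \<Rightarrow> int" where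
  "vec_bits x j = bit2 (fst (prod_decode j)) (squash (x \<bullet> coord (snd (prod_decode j))))"

definition encode :: "'b::euclidean_space \<Rightarrow> real" where
  "encode x = code4 (vec_bits x)"

text \<open>\<open>lim\<close> and \<open>digit4\<close> are total and measurable, so this is a
  measurable left inverse of \<open>encode\<close> defined on the whole line; off the range of
  \<open>encode\<close> its value carries no meaning.\<close>

definition decode :: "real \<Rightarrow> 'b::euclidean_space" where
  "decode c = (\<Sum>i<DIM('b). unsquash (lim (\<lambda>K. \<Sum>k<K. of_int (digit4 (prod_encode (k, i)) c) / 2 ^ Suc k)) *\<^sub>R coord i)"

lemma vec_bits_range: "vec_bits x j \<in> {0, 1}"
  unfolding vec_bits_def by (rule bit2_range)

lemma sum_coord: "(\<Sum>i<DIM('b). (x \<bullet> coord i) *\<^sub>R coord i) = (x :: 'b::euclidean_space)"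
proof -
  have "(\<Sum>i<DIM('b). (x \<bullet> coord i) *\<^sub>R coord i) = (\<Sum>b\<in>Basis. (x \<bullet> b) *\<^sub>R b)"
    by (rule sum.reindex_bij_betw) (use coord_bij[where 'b = 'b] in \<open>simp add: atLeast0LessThan\<close>)
  then show ?thesis by (simp add: euclidean_representation)
qed

lemma decode_encode: "decode (encode x) = (x :: 'b::euclidean_space)"
proof -
  have d: "digit4 j (encode x) = vec_bits x j" for j
    unfolding encode_def using vec_bits_range by (rule digit4_code4)
  have "lim (\<lambda>K. \<Sum>k<K. of_int (digit4 (prod_encode (k, i)) (encode x)) / 2 ^ Suc k)
      = squash (x \<bullet> coord i)" for i
    unfolding d vec_bits_def prod_encode_inverse fst_conv snd_conv
    by (intro limI bit2_lim less_imp_le squash_range)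
  then show ?thesis by (simp add: decode_def unsquash_squash sum_coord)
qed

lemma encode_measurable [measurable]: "(encode :: 'b::euclidean_space \<Rightarrow> real) \<in> borel_measurable borel"
proof -
  have [measurable]: "(\<lambda>x. real_of_int (vec_bits (x :: 'b) j)) \<in> borel_measurable borel" for j
    unfolding vec_bits_def by measurable
  show ?thesis unfolding encode_def code4_def suminf_eq_lim by measurable
qed

lemma decode_measurable [measurable]: "decode \<in> borel_measurable borel"
  unfolding decode_def by measurable

lemma encode_range: "0 \<le> encode x" "encode x \<le> 1 / 3"
  unfolding encode_def using code4_range[of "vec_bits x"] vec_bits_range by auto

text \<open>Convergent codes make the squashed coordinates converge, but possibly to 0 or 1, which
  means escape to infinity. Since the limit already exists, a norm bound at infinitely many indices
  is enough to exclude this.\<close>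

lemma encode_convergent:
  fixes x :: "nat \<Rightarrow> 'b::euclidean_space"
  assumes lim: "(\<lambda>m. encode (x m)) \<longlonglongrightarrow> c"
    and bdd: "\<exists>\<^sub>F m in sequentially. norm (x m) \<le> L"
  shows "convergent x"
proof -
  have "\<exists>l. (\<lambda>m. x m \<bullet> coord i) \<longlonglongrightarrow> l" if i: "i < DIM('b)" for i
  proof -
    define y where "y m = squash (x m \<bullet> coord i)" for m
    have y: "0 < y m" "y m < 1" for m using squash_range by (auto simp: y_def)
    have "\<exists>N. \<forall>m\<ge>N. \<forall>m'\<ge>N. bit2 k (y m) = bit2 k (y m')" for k
    proof -
      have "\<exists>N. \<forall>m\<ge>N. \<forall>m'\<ge>N. vec_bits (x m) (prod_encode (k, i)) = vec_bits (x m') (prod_encode (k, i))"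
        by (rule code4_convergent[of "\<lambda>m. vec_bits (x m)", OF vec_bits_range lim[unfolded encode_def]])
      then show ?thesis by (simp add: vec_bits_def y_def)
    qed
    then have "convergent y"
      using y by (intro bit2_convergent) (auto intro: less_imp_le)
    then obtain l where l: "y \<longlonglongrightarrow> l" by (auto simp: convergent_def)
    have "coord i \<in> (Basis :: 'b set)" using coord_bij[where 'b = 'b] i by (auto simp: bij_betw_def)
    then have c: "- L \<le> x m \<bullet> coord i" "x m \<bullet> coord i \<le> L" if "norm (x m) \<le> L" for m
      using Basis_le_norm[of "coord i" "x m"] that by linarith+
    have fr: "\<exists>\<^sub>F m in sequentially. squash (- L) \<le> y m \<and> y m \<le> squash L"
      using bdd by (rule frequently_elim1) (auto simp: y_def intro!: squash_mono c)
    have "squash (- L) \<le> l"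
    proof (rule ccontr)
      assume "\<not> squash (- L) \<le> l"
      then have "\<forall>\<^sub>F m in sequentially. y m < squash (- L)" using order_tendstoD(2)[OF l] by simp
      then have "\<not> (\<exists>\<^sub>F m in sequentially. squash (- L) \<le> y m \<and> y m \<le> squash L)"
        unfolding not_frequently by (rule eventually_mono) auto
      then show False using fr by blast
    qed
    moreover have "l \<le> squash L"
    proof (rule ccontr)
      assume "\<not> l \<le> squash L"
      then have "\<forall>\<^sub>F m in sequentially. squash L < y m" using order_tendstoD(1)[OF l] by simp
      then have "\<not> (\<exists>\<^sub>F m in sequentially. squash (- L) \<le> y m \<and> y m \<le> squash L)"
        unfolding not_frequently by (rule eventually_mono) auto
      then show False using fr by blast
    qed
    ultimately have "0 < l" "l < 1" using squash_range[of "- L"] squash_range[of L] by linarith+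
    from unsquash_tendsto[OF l this] have "(\<lambda>m. x m \<bullet> coord i) \<longlonglongrightarrow> unsquash l"
      by (simp add: y_def unsquash_squash)
    then show ?thesis by blast
  qed
  then obtain l where l: "\<And>i. i < DIM('b) \<Longrightarrow> (\<lambda>m. x m \<bullet> coord i) \<longlonglongrightarrow> l i" by metis
  have "(\<lambda>m. \<Sum>i<DIM('b). (x m \<bullet> coord i) *\<^sub>R coord i :: 'b) \<longlonglongrightarrow> (\<Sum>i<DIM('b). l i *\<^sub>R coord i)"
    using l by (intro tendsto_intros) auto
  then show ?thesis unfolding sum_coord by (auto simp: convergent_def)
qed

section \<open>Compactness of sets of laws\<close>

context prob_space
begin

lemma E_rv_le_of_AE_limit:
  fixes Z :: "nat \<Rightarrow> 'a \<Rightarrow> 'b::euclidean_space"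
  assumes Z[measurable]: "\<And>n. Z n \<in> borel_measurable M" "Zl \<in> borel_measurable M"
    and R: "\<And>n. E_rv M 4 (Z n) \<le> ennreal R"
    and lim: "AE w in M. (\<lambda>n. Z n w) \<longlonglongrightarrow> Zl w"
  shows "E_rv M 4 Zl \<le> ennreal R"
proof -
  have "E_rv M 4 Zl = (\<integral>\<^sup>+w. liminf (\<lambda>n. ennreal (norm (Z n w) ^ 4)) \<partial>M)"
    unfolding E_rv_def
  proof (rule nn_integral_cong_AE)
    show "AE w in M. ennreal (norm (Zl w) ^ 4) = liminf (\<lambda>n. ennreal (norm (Z n w) ^ 4))"
      using lim
    proof eventually_elim
      case (elim w)
      have "(\<lambda>n. ennreal (norm (Z n w) ^ 4)) \<longlonglongrightarrow> ennreal (norm (Zl w) ^ 4)"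
        by (intro tendsto_intros elim)
      then show ?case by (rule lim_imp_Liminf[OF trivial_limit_sequentially, symmetric])
    qed
  qed
  also have "\<dots> \<le> liminf (\<lambda>n. E_rv M 4 (Z n))"
    unfolding E_rv_def by (rule nn_integral_liminf) measurable
  also have "\<dots> \<le> limsup (\<lambda>n. E_rv M 4 (Z n))"
    by (rule Liminf_le_Limsup) simp
  also have "\<dots> \<le> ennreal R"
    by (rule Limsup_bounded) (use R in simp)
  finally show ?thesis .
qed

text \<open>By Fatou's lemma the lower limit of the fourth powers is integrable, hence finite almost
  surely. The bound and the indices depend on the sample point, which is all that
  \<open>encode_convergent\<close> asks for.\<close>

lemma AE_frequently_bounded:
  fixes Z :: "nat \<Rightarrow> 'a \<Rightarrow> 'b::euclidean_space"
  assumes Z[measurable]: "\<And>n. Z n \<in> borel_measurable M"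
    and R: "\<And>n. E_rv M 4 (Z n) \<le> ennreal R"
  shows "AE w in M. \<exists>L. \<exists>\<^sub>F n in sequentially. norm (Z n w) \<le> L"
proof -
  have "(\<integral>\<^sup>+w. liminf (\<lambda>n. ennreal (norm (Z n w) ^ 4)) \<partial>M) \<le> liminf (\<lambda>n. E_rv M 4 (Z n))"
    unfolding E_rv_def by (rule nn_integral_liminf) measurable
  also have "\<dots> \<le> limsup (\<lambda>n. E_rv M 4 (Z n))"
    by (rule Liminf_le_Limsup) simp
  also have "\<dots> \<le> ennreal R"
    by (rule Limsup_bounded) (use R in simp)
  finally have "(\<integral>\<^sup>+w. liminf (\<lambda>n. ennreal (norm (Z n w) ^ 4)) \<partial>M) \<noteq> \<infinity>"
    using ennreal_less_top[of R] by (metis infinity_ennreal_def not_le)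
  then have "AE w in M. liminf (\<lambda>n. ennreal (norm (Z n w) ^ 4)) \<noteq> \<infinity>"
    by (intro nn_integral_PInf_AE) measurable
  then show ?thesis
  proof eventually_elim
    case (elim w)
    then obtain c where c: "liminf (\<lambda>n. ennreal (norm (Z n w) ^ 4)) < ennreal c"
      using ennreal_Ex_less_of_nat[of "liminf (\<lambda>n. ennreal (norm (Z n w) ^ 4))"]
      by (auto simp: less_top ennreal_of_nat_eq_real_of_nat)
    have "\<exists>\<^sub>F n in sequentially. ennreal (norm (Z n w) ^ 4) < ennreal c"
    proof (rule ccontr)
      assume "\<not> ?thesis"
      then have "\<forall>\<^sub>F n in sequentially. ennreal c \<le> ennreal (norm (Z n w) ^ 4)"
        unfolding not_frequently by (rule eventually_mono) (simp only: not_less)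
      then have "ennreal c \<le> liminf (\<lambda>n. ennreal (norm (Z n w) ^ 4))" by (rule Liminf_bounded)
      then show False using c by simp
    qed
    then have "\<exists>\<^sub>F n in sequentially. norm (Z n w) \<le> 1 + c"
    proof (rule frequently_elim1)
      fix n assume "ennreal (norm (Z n w) ^ 4) < ennreal c"
      then have c: "norm (Z n w) ^ 4 < c" by (simp add: ennreal_less_iff)
      then have "c > 0" by (meson le_less_trans norm_ge_zero zero_le_power)
      show "norm (Z n w) \<le> 1 + c"
      proof (cases "norm (Z n w) \<le> 1")
        case True
        then show ?thesis using \<open>c > 0\<close> by simp
      next
        case False
        then have "norm (Z n w) \<le> norm (Z n w) ^ 4" by (intro self_le_power) auto
        then show ?thesis using c by simp
      qed
    qed
    then show ?case by blast
  qed
qed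

text \<open>Bounded fourth moments make the squares uniformly integrable: where a square exceeds the
  level \<open>L\<close>, it is at most the fourth power divided by \<open>L\<close>.\<close>

lemma L2_tendsto_of_AE:
  fixes Z :: "nat \<Rightarrow> 'a \<Rightarrow> 'b::euclidean_space"
  assumes Z: "\<And>n. Z n \<in> Lspace M 4" "Zl \<in> Lspace M 4"
    and R: "\<And>n. (\<integral>w. norm (Z n w) ^ 4 \<partial>M) \<le> R"
    and lim: "AE w in M. (\<lambda>n. Z n w) \<longlonglongrightarrow> Zl w"
  shows "(\<lambda>n. \<integral>w. norm (Zl w - Z n w) ^ 2 \<partial>M) \<longlonglongrightarrow> 0"
proof (rule tendstoI)
  fix e :: real assume e: "e > 0"
  have [measurable]: "\<And>n. Z n \<in> borel_measurable M" "Zl \<in> borel_measurable M"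
    using Z by (auto simp: Lspace_iff)
  define R' where "R' = 8 * (\<integral>w. norm (Zl w) ^ 4 \<partial>M) + 8 * R"
  have D: "(\<lambda>w. Zl w - Z n w) \<in> Lspace M 4" for n using Z by (intro L4_diff)
  have D2: "integrable M (\<lambda>w. norm (Zl w - Z n w) ^ 2)" for n
    using L4_imp_L2[OF D] by (simp add: Lspace_iff)
  have D4: "integrable M (\<lambda>w. norm (Zl w - Z n w) ^ 4)" for n
    using D by (simp add: Lspace_iff)
  have I4: "(\<integral>w. norm (Zl w - Z n w) ^ 4 \<partial>M) \<le> R'" for n
  proof -
    have "(\<integral>w. norm (Zl w - Z n w) ^ 4 \<partial>M) \<le> (\<integral>w. 8 * norm (Zl w) ^ 4 + 8 * norm (Z n w) ^ 4 \<partial>M)"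
    proof (rule integral_mono[OF D4])
      show "integrable M (\<lambda>w. 8 * norm (Zl w) ^ 4 + 8 * norm (Z n w) ^ 4)"
        using Z by (auto simp: Lspace_iff)
      show "norm (Zl w - Z n w) ^ 4 \<le> 8 * norm (Zl w) ^ 4 + 8 * norm (Z n w) ^ 4" for w
        using norm_add_power_4[of "Zl w" "- Z n w"] by simp
    qed
    also have "\<dots> = 8 * (\<integral>w. norm (Zl w) ^ 4 \<partial>M) + 8 * (\<integral>w. norm (Z n w) ^ 4 \<partial>M)"
      using Z by (subst Bochner_Integration.integral_add) (auto simp: Lspace_iff)
    finally show ?thesis using R[of n] by (simp add: R'_def)
  qed
  have R': "R' \<ge> 0" using I4[of 0] by (rule order_trans[rotated]) simp
  \<comment> \<open>Makes the tail \<open>R' / L\<close> at most \<open>e / 2\<close>; the summand 1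
    keeps \<open>L\<close> positive.\<close>
  define L where "L = 2 * (R' + 1) / e"
  have L: "L > 0" using R' e by (simp add: L_def)
  have lim2: "(\<lambda>n. \<integral>w. min (norm (Zl w - Z n w) ^ 2) L \<partial>M) \<longlonglongrightarrow> (\<integral>w. 0 \<partial>M)"
  proof (rule integral_dominated_convergence[where w = "\<lambda>w. L"])
    show "AE w in M. (\<lambda>n. min (norm (Zl w - Z n w) ^ 2) L) \<longlonglongrightarrow> 0"
      using lim
    proof eventually_elim
      case (elim w)
      have "(\<lambda>n. min (norm (Zl w - Z n w) ^ 2) L) \<longlonglongrightarrow> min (norm (Zl w - Zl w) ^ 2) L"
        by (intro tendsto_intros tendsto_min elim)
      then show ?case using L by simp
    qed
  qed (use L in auto)
  then have "\<forall>\<^sub>F n in sequentially. (\<integral>w. min (norm (Zl w - Z n w) ^ 2) L \<partial>M) < e / 2"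
    using e by (intro order_tendstoD(2)[OF lim2]) simp
  then show "\<forall>\<^sub>F n in sequentially. dist (\<integral>w. norm (Zl w - Z n w) ^ 2 \<partial>M) 0 < e"
  proof eventually_elim
    case (elim n)
    have Imin: "integrable M (\<lambda>w. min (norm (Zl w - Z n w) ^ 2) L)"
      by (rule Bochner_Integration.integrable_bound[OF D2[of n]]) (use L in auto)
    have "(\<integral>w. norm (Zl w - Z n w) ^ 2 \<partial>M)
        \<le> (\<integral>w. min (norm (Zl w - Z n w) ^ 2) L + norm (Zl w - Z n w) ^ 4 / L \<partial>M)"
    proof (rule integral_mono[OF D2])
      show "integrable M (\<lambda>w. min (norm (Zl w - Z n w) ^ 2) L + norm (Zl w - Z n w) ^ 4 / L)"
        using Imin D4 by auto
      fix w
      show "norm (Zl w - Z n w) ^ 2 \<le> min (norm (Zl w - Z n w) ^ 2) L + norm (Zl w - Z n w) ^ 4 / L"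
      proof (cases "norm (Zl w - Z n w) ^ 2 \<le> L")
        case True
        then show ?thesis using L by (simp add: min_def)
      next
        case False
        then have "norm (Zl w - Z n w) ^ 2 * L \<le> norm (Zl w - Z n w) ^ 2 * norm (Zl w - Z n w) ^ 2"
          by (intro mult_left_mono) auto
        then have "norm (Zl w - Z n w) ^ 2 \<le> norm (Zl w - Z n w) ^ 4 / L"
          using L by (simp add: pos_le_divide_eq flip: power_add)
        then show ?thesis using L False by (simp add: min_def)
      qed
    qed
    also have "\<dots> = (\<integral>w. min (norm (Zl w - Z n w) ^ 2) L \<partial>M) + (\<integral>w. norm (Zl w - Z n w) ^ 4 \<partial>M) / L"
      using Imin D4 by (subst Bochner_Integration.integral_add) auto
    also have "\<dots> < e / 2 + e / 2"
    proof (rule add_less_le_mono[OF elim])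
      have "(\<integral>w. norm (Zl w - Z n w) ^ 4 \<partial>M) / L \<le> R' / L"
        using I4 L by (intro divide_right_mono) auto
      also have "\<dots> \<le> e / 2" using R' e by (simp add: L_def field_simps)
      finally show "(\<integral>w. norm (Zl w - Z n w) ^ 4 \<partial>M) / L \<le> e / 2" .
    qed
    finally show ?case by (simp add: Bochner_Integration.integral_nonneg)
  qed
qed

text \<open>Coding reduces the claim to the one-dimensional theorems of Helly and Skorohod: along almost
  surely convergent codes the vectors converge, unless their norms tend to infinity, which Fatou's
  lemma excludes.\<close>

theorem law_compact:
  fixes X :: "nat \<Rightarrow> 'a \<Rightarrow> 'b::euclidean_space"
  assumes X: "\<And>n. X n \<in> Lspace M 4" and R: "\<And>n. (\<integral>w. norm (X n w) ^ 4 \<partial>M) \<le> R"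
  obtains r \<mu> where "strict_mono r" "\<mu> \<in> P2" "(\<lambda>n. W2 \<mu> (law M (X (r n)))) \<longlonglongrightarrow> 0"
proof -
  have [measurable]: "\<And>n. X n \<in> borel_measurable M" using X by (auto simp: Lspace_iff)
  define \<nu> where "\<nu> n = distr M borel (\<lambda>w. encode (X n w))" for n
  have rd: "real_distribution (\<nu> n)" for n unfolding \<nu>_def by (rule real_distribution_distr) measurable
  \<comment> \<open>Codes lie in [0, 1/3], so tightness is immediate. The moment bound enters only
    later, to keep the decoded vectors from escaping to infinity.\<close>
  have "tight \<nu>"
    unfolding tight_def
  proof (intro conjI allI impI rd)
    fix \<epsilon> :: real assume \<epsilon>: "\<epsilon> > 0"
    have "measure (\<nu> n) {-1<..1} = 1" for n
    proof -
      have "-1 < encode (X n w)" "encode (X n w) \<le> 1" for w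
        using encode_range[of "X n w"] by linarith+
      then have "(\<lambda>w. encode (X n w)) -` {-1<..1} \<inter> space M = space M" by auto
      then show ?thesis unfolding \<nu>_def by (subst measure_distr) (auto simp: prob_space)
    qed
    then show "\<exists>a b. a < b \<and> (\<forall>n. 1 - \<epsilon> < measure (\<nu> n) {a<..b})"
      using \<epsilon> by (intro exI[of _ "-1"] exI[of _ 1]) auto
  qed
  then obtain r N where r: "strict_mono r" and N: "real_distribution N" "weak_conv_m (\<nu> \<circ> id \<circ> r) N"
    using tight_imp_convergent_subsubsequence[of \<nu> id] strict_mono_id by (auto simp: strict_mono_def)
  have wc: "weak_conv_m (\<lambda>n. \<nu> (r n)) N" using N(2) by (simp add: o_def)
  obtain \<Omega> :: "real measure" and Ys Y where \<Omega>: "prob_space \<Omega>"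
    and Ys [measurable]: "\<And>n. Ys n \<in> borel_measurable \<Omega>"
    and Yd: "\<And>n. distr \<Omega> borel (Ys n) = \<nu> (r n)"
    and Yl: "\<And>u. u \<in> space \<Omega> \<Longrightarrow> (\<lambda>n. Ys n u) \<longlonglongrightarrow> Y u"
    using Skorohod[OF rd N(1) wc] by blast
  interpret \<Omega>: prob_space \<Omega> by fact
  define Z :: "nat \<Rightarrow> real \<Rightarrow> 'b" where "Z n u = decode (Ys n u)" for n u
  have Zm [measurable]: "Z n \<in> borel_measurable \<Omega>" for n unfolding Z_def by measurable
  have lawZ: "law \<Omega> (Z n) = law M (X (r n))" for n
  proof -
    have "law \<Omega> (Z n) = distr (distr \<Omega> borel (Ys n)) borel decode"
      unfolding Z_def by (subst distr_distr) (auto simp: o_def)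
    also have "\<dots> = law M (X (r n))"
      unfolding Yd \<nu>_def by (subst distr_distr) (auto simp: o_def decode_encode)
    finally show ?thesis .
  qed
  \<comment> \<open>Being a code is a measurable property of the distribution, so it passes from the
    laws \<open>\<nu> (r n)\<close> to the Skorohod representatives \<open>Ys n\<close>, of which
    only the distribution is known.\<close>
  have "AE u in \<Omega>. encode (Z n u) = Ys n u" for n
  proof -
    have "{c \<in> space borel. encode (decode c :: 'b) = c} \<in> sets borel" by measurable
    then have "AE c in \<nu> (r n). encode (decode c :: 'b) = c"
      unfolding \<nu>_def by (subst AE_distr_iff) (auto simp: decode_encode)
    then show ?thesis
      unfolding Yd[symmetric] Z_def by (subst (asm) AE_distr_iff) auto
  qed
  then have enc: "AE u in \<Omega>. \<forall>n. encode (Z n u) = Ys n u" by (simp add: AE_all_countable)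
  have EZ: "E_rv \<Omega> 4 (Z n) \<le> ennreal R" for n
  proof -
    have "E_rv \<Omega> 4 (Z n) = E_rv M 4 (X (r n))"
      using \<Omega>.E_law_law[OF Zm, of 4 n] E_law_law[of "X (r n)" 4] by (simp add: lawZ)
    also have "\<dots> = ennreal (\<integral>w. norm (X (r n) w) ^ 4 \<partial>M)"
      using X by (intro E_rv_eq_integral) (auto simp: Lspace_iff)
    also have "\<dots> \<le> ennreal R" by (intro ennreal_leI R)
    finally show ?thesis .
  qed
  have "AE u in \<Omega>. convergent (\<lambda>n. Z n u)"
    using enc \<Omega>.AE_frequently_bounded[of Z, OF Zm EZ] AE_space
  proof eventually_elim
    case (elim u)
    then obtain L where "\<exists>\<^sub>F n in sequentially. norm (Z n u) \<le> L" by blast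
    moreover have "(\<lambda>n. encode (Z n u)) \<longlonglongrightarrow> Y u" using elim Yl by simp
    ultimately show ?case by (intro encode_convergent)
  qed
  moreover define Zl where "Zl u = lim (\<lambda>n. Z n u)" for u
  ultimately have lim: "AE u in \<Omega>. (\<lambda>n. Z n u) \<longlonglongrightarrow> Zl u"
    by (simp add: convergent_LIMSEQ_iff)
  have Zlm [measurable]: "Zl \<in> borel_measurable \<Omega>" unfolding Zl_def by measurable
  have EZl: "E_rv \<Omega> 4 Zl \<le> ennreal R"
    by (rule \<Omega>.E_rv_le_of_AE_limit[OF Zm Zlm EZ lim])
  have L4: "Z n \<in> Lspace \<Omega> 4" "Zl \<in> Lspace \<Omega> 4" for n
    using EZ[of n] EZl by (auto simp: Lspace_def intro: le_less_trans)
  have R0: "R \<ge> 0" using R[of 0] by (rule order_trans[rotated]) simp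
  have I4: "(\<integral>u. norm (Z n u) ^ 4 \<partial>\<Omega>) \<le> R" for n
  proof -
    have "ennreal (\<integral>u. norm (Z n u) ^ 4 \<partial>\<Omega>) \<le> ennreal R"
      using EZ[of n] L4(1)[of n] by (subst (asm) \<Omega>.E_rv_eq_integral) (auto simp: \<Omega>.Lspace_iff)
    then show ?thesis using R0 by (simp add: ennreal_le_iff)
  qed
  have lim2: "(\<lambda>n. \<integral>u. norm (Zl u - Z n u) ^ 2 \<partial>\<Omega>) \<longlonglongrightarrow> 0"
    by (rule \<Omega>.L2_tendsto_of_AE[OF L4 I4 lim])
  have int: "integrable \<Omega> (\<lambda>u. norm (Zl u - Z n u) ^ 2)" for n
    using \<Omega>.L4_imp_L2[OF \<Omega>.L4_diff[OF L4(2) L4(1)]] by (simp add: \<Omega>.Lspace_iff)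
  show thesis
  proof (rule that[OF r])
    show "law \<Omega> Zl \<in> P2" by (intro \<Omega>.law_in_P2 \<Omega>.L4_imp_L2 L4)
    show "(\<lambda>n. W2 (law \<Omega> Zl) (law M (X (r n)))) \<longlonglongrightarrow> 0"
    proof (rule tendsto_sandwich[OF _ _ tendsto_const])
      show "(\<lambda>n. sqrt (\<integral>u. norm (Zl u - Z n u) ^ 2 \<partial>\<Omega>)) \<longlonglongrightarrow> 0"
        using tendsto_real_sqrt[OF lim2] by simp
      show "\<forall>\<^sub>F n in sequentially. W2 (law \<Omega> Zl) (law M (X (r n))) \<le> sqrt (\<integral>u. norm (Zl u - Z n u) ^ 2 \<partial>\<Omega>)"
        using \<Omega>.W2_law_le[OF Zlm Zm int] by (simp add: lawZ)
    qed (simp add: W2_nonneg)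
  qed
qed

end

section \<open>Lifts\<close>

lemma sol_space_tendsto:
  fixes U :: "'a::euclidean_space sol"
  assumes cont: "\<And>n. continuous_map (sol_space T) euclidean (Us n)"
    and lim: "locally_uniform_limit (sol_space T) Us U"
    and mem: "t \<in> {0..T}" "\<And>n. tn n \<in> {0..T}" "\<mu> \<in> P2" "\<And>n. \<mu>n n \<in> P2"
    and conv: "tn \<longlonglongrightarrow> t" "xn \<longlonglongrightarrow> x" "(\<lambda>n. W2 \<mu> (\<mu>n n)) \<longlonglongrightarrow> 0"
  shows "(\<lambda>n. Us n (tn n, xn n, \<mu>n n)) \<longlonglongrightarrow> U (t, x, \<mu>)"
proof (rule locally_uniform_limit_continuous_convergence[OF _ cont[unfolded sol_space_def] lim[unfolded sol_space_def]])
  have "(\<lambda>n. dist t (tn n) + dist x (xn n) + W2 \<mu> (\<mu>n n)) \<longlonglongrightarrow> dist t t + dist x x + 0"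
    by (intro tendsto_intros conv)
  then show "(\<lambda>n. (\<lambda>(t, x, \<mu>) (s, y, \<nu>). dist t s + dist x y + W2 \<mu> \<nu>) (t, x, \<mu>)
      (tn n, xn n, \<mu>n n)) \<longlonglongrightarrow> 0" by simp
qed (use mem in \<open>auto simp: W2_nonneg\<close>)

lemma coef_space_tendsto:
  fixes F :: "'a::euclidean_space coef"
  assumes cont: "\<And>n. continuous_map coef_space euclidean (Fn n)"
    and lim: "locally_uniform_limit coef_space Fn F"
    and mem: "\<mu> \<in> P2" "\<And>n. \<mu>n n \<in> P2"
    and conv: "xn \<longlonglongrightarrow> x" "(\<lambda>n. W2 \<mu> (\<mu>n n)) \<longlonglongrightarrow> 0" "un \<longlonglongrightarrow> u"
  shows "(\<lambda>n. Fn n (xn n, \<mu>n n, un n)) \<longlonglongrightarrow> F (x, \<mu>, u)"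
proof (rule locally_uniform_limit_continuous_convergence[OF _ cont[unfolded coef_space_def] lim[unfolded coef_space_def]])
  have "(\<lambda>n. dist x (xn n) + W2 \<mu> (\<mu>n n) + dist u (un n)) \<longlonglongrightarrow> dist x x + 0 + dist u u"
    by (intro tendsto_intros conv)
  then show "(\<lambda>n. (\<lambda>(x, \<mu>, u) (y, \<nu>, v). dist x y + W2 \<mu> \<nu> + dist u v) (x, \<mu>, u)
      (xn n, \<mu>n n, un n)) \<longlonglongrightarrow> 0" by simp
qed (use mem in \<open>auto simp: W2_nonneg\<close>)

lemma sol_space_limit_continuous:
  assumes "\<And>n. continuous_map (sol_space T) euclidean (Us n)"
    and "locally_uniform_limit (sol_space T) Us U"
  shows "continuous_map (sol_space T) euclidean U"
  using assms unfolding sol_space_def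
  by (rule locally_uniform_limit_continuous[where f = Us, rotated]) (auto simp: W2_nonneg)

lemma coef_space_limit_continuous:
  assumes "\<And>n. continuous_map coef_space euclidean (Fn n)"
    and "locally_uniform_limit coef_space Fn F"
  shows "continuous_map coef_space euclidean F"
  using assms unfolding coef_space_def
  by (rule locally_uniform_limit_continuous[where f = Fn, rotated]) (auto simp: W2_nonneg)

lemma sol_space_tendsto_const:
  fixes U :: "'a::euclidean_space sol"
  assumes cont: "continuous_map (sol_space T) euclidean U"
    and mem: "t \<in> {0..T}" "\<And>n. tn n \<in> {0..T}" "\<mu> \<in> P2" "\<And>n. \<mu>n n \<in> P2"
    and conv: "tn \<longlonglongrightarrow> t" "xn \<longlonglongrightarrow> x" "(\<lambda>n. W2 \<mu> (\<mu>n n)) \<longlonglongrightarrow> 0"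
  shows "(\<lambda>n. U (tn n, xn n, \<mu>n n)) \<longlonglongrightarrow> U (t, x, \<mu>)"
  by (rule sol_space_tendsto[of T "\<lambda>n. U"]) (use assms locally_uniform_limit_const in auto)

lemma linear_growth_limit:
  fixes U :: "'a::euclidean_space sol"
  assumes gr: "\<And>n. linear_growth T C (Us n)" and lim: "locally_uniform_limit (sol_space T) Us U"
  shows "linear_growth T C U"
  unfolding linear_growth_def
proof (intro ballI allI)
  fix t x \<mu> assume m: "t \<in> {0..T}" "\<mu> \<in> (P2 :: 'a measure set)"
  have "(\<lambda>n. Us n (t, x, \<mu>)) \<longlonglongrightarrow> U (t, x, \<mu>)"
    using lim m unfolding sol_space_def by (intro locally_uniform_limit_tendsto) auto
  then have "(\<lambda>n. norm (Us n (t, x, \<mu>))) \<longlonglongrightarrow> norm (U (t, x, \<mu>))" by (rule tendsto_norm)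
  then show "norm (U (t, x, \<mu>)) \<le> C * (1 + norm x + sqrt (enn2real (E_law 2 \<mu>)))"
    by (rule tendsto_upperbound) (use gr m in \<open>auto simp: linear_growth_def\<close>)
qed

section \<open>Lifts to random vectors: measurability, growth and uniform convergence\<close>

context prob_space
begin

lemma Lspace_measurable: "X \<in> Lspace M q \<Longrightarrow> X \<in> borel_measurable M"
  by (simp add: Lspace_def)

lemma Lspace_integrable: "X \<in> Lspace M q \<Longrightarrow> integrable M (\<lambda>w. norm (X w) ^ q)"
  by (simp add: Lspace_iff)

lemma Lspace_mono:
  fixes Z :: "'a \<Rightarrow> 'b::euclidean_space" and Y :: "'a \<Rightarrow> 'c::euclidean_space"
  assumes [measurable]: "Z \<in> borel_measurable M" and "Y \<in> Lspace M q" "\<And>w. norm (Z w) \<le> norm (Y w)"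
  shows "Z \<in> Lspace M q"
  unfolding Lspace_iff
  by (intro conjI Bochner_Integration.integrable_bound[OF Lspace_integrable[OF assms(2)]])
     (use assms(3) in \<open>auto intro!: power_mono\<close>)

text \<open>Measurability comes from continuity in \<open>x\<close> with the time and the law
  frozen. The constant sequence of laws converges because a law has distance zero to itself
  (\<open>W2_refl_law\<close>).\<close>

lemma lift_sol_measurable:
  fixes U :: "'b::euclidean_space sol"
  assumes U: "continuous_map (sol_space T) euclidean U" and t: "t \<in> {0..T}" and X: "X \<in> Lspace M 2"
  shows "lift_sol M U t X \<in> borel_measurable M"
proof -
  have [measurable]: "X \<in> borel_measurable M" using X by (rule Lspace_measurable)
  have "continuous_on UNIV (\<lambda>x. U (t, x, law M X))"
    unfolding continuous_on_sequentially
  proof (intro allI ballI impI)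
    fix x :: "nat \<Rightarrow> 'b" and a assume "(\<forall>n. x n \<in> UNIV) \<and> x \<longlonglongrightarrow> a"
    then show "((\<lambda>x. U (t, x, law M X)) \<circ> x) \<longlonglongrightarrow> U (t, a, law M X)"
      unfolding o_def using t X
      by (intro sol_space_tendsto_const[OF U]) (auto simp: law_in_P2 W2_refl_law)
  qed
  then have [measurable]: "(\<lambda>x. U (t, x, law M X)) \<in> borel_measurable borel"
    by (rule borel_measurable_continuous_onI)
  show ?thesis unfolding lift_sol_def by measurable
qed

lemma lift_coef_measurable:
  fixes F :: "'b::euclidean_space coef"
  assumes F: "continuous_map coef_space euclidean F" and X: "X \<in> Lspace M 2"
    and [measurable]: "Z \<in> borel_measurable M"
  shows "lift_coef M F X Z \<in> borel_measurable M"
proof -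
  have [measurable]: "X \<in> borel_measurable M" using X by (rule Lspace_measurable)
  have "continuous_on UNIV (\<lambda>p. F (fst p, law M X, snd p))"
    unfolding continuous_on_sequentially
  proof (intro allI ballI impI)
    fix x :: "nat \<Rightarrow> 'b \<times> 'b" and a assume "(\<forall>n. x n \<in> UNIV) \<and> x \<longlonglongrightarrow> a"
    then show "((\<lambda>p. F (fst p, law M X, snd p)) \<circ> x) \<longlonglongrightarrow> F (fst a, law M X, snd a)"
      unfolding o_def using X
      by (intro coef_space_tendsto[of "\<lambda>n. F"])
         (auto simp: F locally_uniform_limit_const law_in_P2 W2_refl_law intro: tendsto_fst tendsto_snd)
  qed
  then have [measurable]: "(\<lambda>p. F (fst p, law M X, snd p)) \<in> borel_measurable borel"
    by (rule borel_measurable_continuous_onI)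
  have "(\<lambda>w. (\<lambda>p. F (fst p, law M X, snd p)) (X w, Z w)) \<in> borel_measurable M" by measurable
  then show ?thesis unfolding lift_coef_def by simp
qed

lemma lift_sol_growth:
  fixes U :: "'b::euclidean_space sol"
  assumes "linear_growth T C U" "t \<in> {0..T}" "X \<in> Lspace M 2"
  shows "norm (lift_sol M U t X w) \<le> C * (1 + norm (X w) + l2_norm M X)"
proof -
  have "norm (U (t, X w, law M X)) \<le> C * (1 + norm (X w) + sqrt (enn2real (E_law 2 (law M X))))"
    using assms law_in_P2 unfolding linear_growth_def by blast
  then show ?thesis using sqrt_E_law[OF assms(3)] by (simp add: lift_sol_def l2_norm_def)
qed

lemma affine_norm_L2:
  assumes "X \<in> Lspace M 2"
  shows "(\<lambda>w. C * (k + norm (X w))) \<in> Lspace M 2"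
proof -
  have "(\<lambda>w. norm (X w)) \<in> Lspace M 2" using assms by (auto simp: Lspace_iff)
  from L2_scale[OF L2_add[OF L2_const this], of C] show ?thesis by simp
qed

lemma lift_sol_L2:
  fixes U :: "'b::euclidean_space sol"
  assumes "continuous_map (sol_space T) euclidean U" "linear_growth T C U" "t \<in> {0..T}" "X \<in> Lspace M 2"
  shows "lift_sol M U t X \<in> Lspace M 2"
proof (rule Lspace_mono[OF lift_sol_measurable[OF assms(1,3,4)] affine_norm_L2[OF assms(4)]])
  show "norm (lift_sol M U t X w) \<le> norm (C * (1 + l2_norm M X + norm (X w)))" for w
    using lift_sol_growth[OF assms(2-4), of w] by (simp add: algebra_simps)
qed

text \<open>The free weight \<open>\<eta>\<close> lets terms of second order be absorbed by an
  arbitrarily small part of the quartic term.\<close>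

lemma second_moment_le:
  fixes X :: "'a \<Rightarrow> 'b::euclidean_space"
  assumes X: "X \<in> Lspace M 4" and \<eta>: "\<eta> > 0"
  shows "(\<integral>w. norm (X w) ^ 2 \<partial>M) \<le> 1 / \<eta> + \<eta> * (\<integral>w. norm (X w) ^ 4 \<partial>M)"
proof -
  have *: "norm x ^ 2 \<le> 1 / \<eta> + \<eta> * norm x ^ 4" for x :: 'b
  proof -
    have "\<eta> * norm x ^ 2 \<le> 1 + (\<eta> * norm x ^ 2)\<^sup>2" using \<eta> by (intro le_one_plus_square) auto
    then have "norm x ^ 2 \<le> (1 + (\<eta> * norm x ^ 2)\<^sup>2) / \<eta>" using \<eta> by (simp add: field_simps)
    also have "\<dots> = 1 / \<eta> + \<eta> * norm x ^ 4"
      using \<eta> by (simp add: field_simps power2_eq_square power4_eq_xxxx)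
    finally show ?thesis .
  qed
  have "(\<integral>w. norm (X w) ^ 2 \<partial>M) \<le> (\<integral>w. 1 / \<eta> + \<eta> * norm (X w) ^ 4 \<partial>M)"
    using X L4_imp_L2[OF X] by (intro integral_mono *) (auto simp: Lspace_iff)
  also have "\<dots> = 1 / \<eta> + \<eta> * (\<integral>w. norm (X w) ^ 4 \<partial>M)"
    using X by (subst Bochner_Integration.integral_add) (auto simp: Lspace_iff prob_space)
  finally show ?thesis .
qed

lemma l2_norm_square_integral: "(l2_norm M X)\<^sup>2 = (\<integral>w. norm (X w) ^ 2 \<partial>M)"
  by (simp add: l2_norm_def Bochner_Integration.integral_nonneg)

lemma l2_norm_le_L4:
  fixes X :: "'a \<Rightarrow> 'b::euclidean_space"
  assumes X: "X \<in> Lspace M 4" and R: "(\<integral>w. norm (X w) ^ 4 \<partial>M) \<le> R"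
  shows "l2_norm M X \<le> 1 + R"
proof -
  have R0: "R \<ge> 0" using R by (rule order_trans[rotated]) simp
  have "(l2_norm M X)\<^sup>2 \<le> 1 + R"
    using second_moment_le[OF X, of 1] R by (simp add: l2_norm_square_integral)
  also have "\<dots> \<le> (1 + R)\<^sup>2" using R0 by (simp add: power2_eq_square algebra_simps)
  finally show ?thesis by (rule power2_le_imp_le) (use R0 in \<open>auto\<close>)
qed

text \<open>At points that violate the bound along a subsequence, \<open>Us n\<close> and
  \<open>U\<close> both tend to the same value \<open>U (t, l, \<mu>)\<close>.\<close>

lemma lift_sol_uniform_on_balls:
  fixes U :: "'b::euclidean_space sol"
  assumes cont: "\<And>n. continuous_map (sol_space T) euclidean (Us n)"
    and lim: "locally_uniform_limit (sol_space T) Us U"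
    and mem: "t \<in> {0..T}" "\<And>n. tn n \<in> {0..T}" "\<mu> \<in> P2" "\<And>n. \<mu>n n \<in> P2"
    and conv: "tn \<longlonglongrightarrow> t" "(\<lambda>n. W2 \<mu> (\<mu>n n)) \<longlonglongrightarrow> 0" and \<delta>: "\<delta> > 0"
  shows "\<forall>\<^sub>F n in sequentially. \<forall>x. norm x \<le> \<rho> \<longrightarrow>
    norm (Us n (tn n, x, \<mu>n n) - U (tn n, x, \<mu>n n)) \<le> \<delta>"
proof (rule ccontr)
  assume "\<not> ?thesis"
  then obtain r :: "nat \<Rightarrow> nat" where r: "strict_mono r"
    and "\<forall>n. \<not> (\<forall>x. norm x \<le> \<rho> \<longrightarrow>
      norm (Us (r n) (tn (r n), x, \<mu>n (r n)) - U (tn (r n), x, \<mu>n (r n))) \<le> \<delta>)"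
    using not_eventually_sequentiallyD by blast
  then have "\<forall>n. \<exists>x. norm x \<le> \<rho> \<and>
      norm (Us (r n) (tn (r n), x, \<mu>n (r n)) - U (tn (r n), x, \<mu>n (r n))) > \<delta>" by (simp add: not_le)
  then obtain x where x: "\<And>n. norm (x n) \<le> \<rho>"
      "\<And>n. norm (Us (r n) (tn (r n), x n, \<mu>n (r n)) - U (tn (r n), x n, \<mu>n (r n))) > \<delta>"
    by metis
  have "seq_compact (cball 0 \<rho> :: 'b set)" using compact_cball compact_imp_seq_compact by blast
  then obtain l q where q: "strict_mono (q :: nat \<Rightarrow> nat)" "(x \<circ> q) \<longlonglongrightarrow> l"
    unfolding seq_compact_def using x(1) by (metis mem_cball_0)
  define s where "s n = r (q n)" for n
  have s: "strict_mono s" using r q(1) by (simp add: s_def strict_mono_def)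
  have sub: "(\<lambda>n. f (s n)) \<longlonglongrightarrow> c" if "f \<longlonglongrightarrow> c" for f :: "nat \<Rightarrow> real" and c
    using LIMSEQ_subseq_LIMSEQ[OF that s] by (simp add: o_def)
  have "(\<lambda>n. Us (s n) (tn (s n), (x \<circ> q) n, \<mu>n (s n))) \<longlonglongrightarrow> U (t, l, \<mu>)"
    using mem cont by (intro sol_space_tendsto[of T "\<lambda>n. Us (s n)"] sub conv q
        locally_uniform_limit_subseq[OF lim] filterlim_subseq s) auto
  moreover have "(\<lambda>n. U (tn (s n), (x \<circ> q) n, \<mu>n (s n))) \<longlonglongrightarrow> U (t, l, \<mu>)"
    using mem by (intro sol_space_tendsto_const[of T] sub conv q sol_space_limit_continuous[OF cont lim]) auto
  ultimately have "(\<lambda>n. norm (Us (s n) (tn (s n), (x \<circ> q) n, \<mu>n (s n)) - U (tn (s n), (x \<circ> q) n, \<mu>n (s n))))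
      \<longlonglongrightarrow> norm (U (t, l, \<mu>) - U (t, l, \<mu>))"
    by (intro tendsto_intros)
  then have "\<forall>\<^sub>F n in sequentially. norm (Us (s n) (tn (s n), (x \<circ> q) n, \<mu>n (s n)) - U (tn (s n), (x \<circ> q) n, \<mu>n (s n))) < \<delta>"
    using \<delta> by (intro order_tendstoD(2)) auto
  then obtain n where "norm (Us (s n) (tn (s n), (x \<circ> q) n, \<mu>n (s n)) - U (tn (s n), (x \<circ> q) n, \<mu>n (s n))) < \<delta>"
    by (auto simp: eventually_sequentially)
  then show False using x(2)[of "q n"] by (simp add: s_def)
qed

text \<open>A failure would produce times and random vectors whose laws converge along a subsequence
  (\<open>law_compact\<close>). Where |X| \<le> \<rho> the difference is uniformly small, because
  times and laws converge and the ball is compact; elsewhere linear growth bounds its square by a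
  quartic divided by \<rho>^2.\<close>

theorem lift_sol_uniform:
  fixes U :: "'b::euclidean_space sol"
  assumes cont: "\<And>n. continuous_map (sol_space T) euclidean (Us n)"
    and lim: "locally_uniform_limit (sol_space T) Us U"
    and gr: "\<And>n. linear_growth T C (Us n)" and C: "C \<ge> 0" and \<epsilon>: "\<epsilon> > 0"
  shows "\<forall>\<^sub>F n in sequentially. \<forall>t\<in>{0..T}. \<forall>X\<in>Lspace M 4. (\<integral>w. norm (X w) ^ 4 \<partial>M) \<le> R \<longrightarrow>
    l2_norm M (\<lambda>w. lift_sol M (Us n) t X w - lift_sol M U t X w) \<le> \<epsilon>"
proof (rule ccontr)
  assume "\<not> ?thesis"
  then obtain r :: "nat \<Rightarrow> nat" where r: "strict_mono r"
    and nu: "\<forall>n. \<not> (\<forall>t\<in>{0..T}. \<forall>X\<in>Lspace M 4. (\<integral>w. norm (X w) ^ 4 \<partial>M) \<le> R \<longrightarrow>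
      l2_norm M (\<lambda>w. lift_sol M (Us (r n)) t X w - lift_sol M U t X w) \<le> \<epsilon>)"
    using not_eventually_sequentiallyD by blast
  define bad where "bad n t X \<longleftrightarrow> t \<in> {0..T} \<and> X \<in> Lspace M 4 \<and> (\<integral>w. norm (X w) ^ 4 \<partial>M) \<le> R \<and>
      \<not> l2_norm M (\<lambda>w. lift_sol M (Us (r n)) t X w - lift_sol M U t X w) \<le> \<epsilon>" for n t X
  have "\<forall>n. \<exists>t X. bad n t X" unfolding bad_def using nu by blast
  then obtain tn Xn where "\<And>n. bad n (tn n) (Xn n)" by metis
  then have t: "\<And>n. tn n \<in> {0..T}" and X: "\<And>n. Xn n \<in> Lspace M 4"
    and R: "\<And>n. (\<integral>w. norm (Xn n w) ^ 4 \<partial>M) \<le> R"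
    and far: "\<And>n. l2_norm M (\<lambda>w. lift_sol M (Us (r n)) (tn n) (Xn n) w - lift_sol M U (tn n) (Xn n) w) > \<epsilon>"
    unfolding bad_def not_le by blast+
  obtain q \<mu> where q: "strict_mono q" "\<mu> \<in> P2" "(\<lambda>n. W2 \<mu> (law M (Xn (q n)))) \<longlonglongrightarrow> 0"
    by (rule law_compact[OF X R])
  have "seq_compact {0..T}" by (intro compact_imp_seq_compact compact_Icc)
  moreover have "\<forall>n. tn (q n) \<in> {0..T}" using t by blast
  ultimately obtain tl p where p: "tl \<in> {0..T}" "strict_mono p" "((\<lambda>n. tn (q n)) \<circ> p) \<longlonglongrightarrow> tl"
    by (rule seq_compactE)
  define s where "s n = q (p n)" for n
  have s: "strict_mono s" using q(1) p(2) by (simp add: s_def strict_mono_def)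
  have rs: "strict_mono (\<lambda>n. r (s n))" using r s by (simp add: strict_mono_def)
  have tl: "(\<lambda>n. tn (s n)) \<longlonglongrightarrow> tl" using p(3) by (simp add: o_def s_def)
  have \<mu>l: "(\<lambda>n. W2 \<mu> (law M (Xn (s n)))) \<longlonglongrightarrow> 0"
    using LIMSEQ_subseq_LIMSEQ[OF q(3) p(2)] by (simp add: o_def s_def)
  define c where "c = 1 + R"
  have R0: "R \<ge> 0" using R[of 0] by (rule order_trans[rotated]) simp
  have c: "l2_norm M (Xn n) \<le> c" for n unfolding c_def by (rule l2_norm_le_L4[OF X R])
  \<comment> \<open>\<open>K\<close> bounds \<open>4 * C\<^sup>2\<close> times the expectation of
    the fourth power of 1 + c + |X|, and \<open>\<rho>\<close> is chosen so that
    \<open>K / \<rho>\<^sup>2 \<le> \<epsilon>\<^sup>2 / 4\<close>.\<close>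
  define K where "K = 4 * C\<^sup>2 * (8 * (1 + c) ^ 4 + 8 * R)"
  define \<rho> where "\<rho> = 1 + 4 * K / \<epsilon>\<^sup>2"
  have c0: "c \<ge> 1" using R0 by (simp add: c_def)
  have K: "K \<ge> 0" unfolding K_def using R0 c0 by (intro mult_nonneg_nonneg add_nonneg_nonneg) auto
  have \<rho>: "\<rho> \<ge> 1" using K \<epsilon> by (simp add: \<rho>_def)
  have K\<rho>: "K / \<rho>\<^sup>2 \<le> \<epsilon>\<^sup>2 / 4"
  proof -
    have "4 * K \<le> \<epsilon>\<^sup>2 * \<rho>" using \<epsilon> by (simp add: \<rho>_def algebra_simps)
    also have "\<dots> \<le> \<epsilon>\<^sup>2 * \<rho>\<^sup>2" using \<rho> by (intro mult_left_mono) (auto simp: power2_eq_square)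
    finally show ?thesis using \<rho> by (simp add: field_simps)
  qed
  have lawP: "law M (Xn n) \<in> P2" for n by (intro law_in_P2 L4_imp_L2 X)
  have "\<forall>\<^sub>F n in sequentially. \<forall>x. norm x \<le> \<rho> \<longrightarrow>
      norm (Us (r (s n)) (tn (s n), x, law M (Xn (s n))) - U (tn (s n), x, law M (Xn (s n)))) \<le> \<epsilon> / 2"
    using t p(1) q(2) tl \<mu>l \<epsilon> cont lawP
    by (intro lift_sol_uniform_on_balls[where t = tl and \<mu> = \<mu> and T = T]
        locally_uniform_limit_subseq[OF lim] filterlim_subseq rs)
       auto
  then obtain n where n: "\<And>x. norm x \<le> \<rho> \<Longrightarrow>
      norm (Us (r (s n)) (tn (s n), x, law M (Xn (s n))) - U (tn (s n), x, law M (Xn (s n)))) \<le> \<epsilon> / 2"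
    by (auto simp: eventually_sequentially)
  define D where "D w = lift_sol M (Us (r (s n))) (tn (s n)) (Xn (s n)) w - lift_sol M U (tn (s n)) (Xn (s n)) w" for w
  note X2 = L4_imp_L2[OF X[of "s n"]]
  have gU: "linear_growth T C U" by (rule linear_growth_limit[OF gr lim])
  have contU: "continuous_map (sol_space T) euclidean U" by (rule sol_space_limit_continuous[OF cont lim])
  have DL: "D \<in> Lspace M 2"
    unfolding D_def by (intro L2_diff lift_sol_L2[OF cont gr t X2] lift_sol_L2[OF contU gU t X2])
  have pt: "norm (D w) ^ 2 \<le> \<epsilon>\<^sup>2 / 4 + 4 * C\<^sup>2 * (1 + c + norm (Xn (s n) w)) ^ 4 / \<rho>\<^sup>2" for w
  proof (cases "norm (Xn (s n) w) \<le> \<rho>")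
    case True
    have "norm (D w) ^ 2 \<le> (\<epsilon> / 2) ^ 2"
      using n[OF True] by (intro power_mono) (auto simp: D_def lift_sol_def)
    moreover have "0 \<le> 4 * C\<^sup>2 * (1 + c + norm (Xn (s n) w)) ^ 4 / \<rho>\<^sup>2" by simp
    moreover have "(\<epsilon> / 2) ^ 2 = \<epsilon>\<^sup>2 / 4" by (simp add: power_divide)
    ultimately show ?thesis by linarith
  next
    case False
    let ?s = "1 + c + norm (Xn (s n) w)"
    have s: "?s \<ge> \<rho>" using False c0 by linarith
    have "norm (D w) \<le> C * (1 + norm (Xn (s n) w) + l2_norm M (Xn (s n))) + C * (1 + norm (Xn (s n) w) + l2_norm M (Xn (s n)))"
      unfolding D_def
      by (rule order_trans[OF norm_triangle_ineq4 add_mono[OF lift_sol_growth[OF gr t X2] lift_sol_growth[OF gU t X2]]])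
    also have "\<dots> \<le> C * ?s + C * ?s"
    proof -
      have "1 + norm (Xn (s n) w) + l2_norm M (Xn (s n)) \<le> ?s" using c[of "s n"] by simp
      from mult_left_mono[OF this C] show ?thesis by linarith
    qed
    finally have "norm (D w) ^ 2 \<le> (2 * C * ?s) ^ 2" by (intro power_mono) auto
    also have "\<dots> = 4 * C\<^sup>2 * ?s\<^sup>2" by (simp add: power_mult_distrib)
    also have "\<dots> \<le> 4 * C\<^sup>2 * (?s ^ 4 / \<rho>\<^sup>2)"
    proof (intro mult_left_mono)
      have "?s\<^sup>2 * \<rho>\<^sup>2 \<le> ?s\<^sup>2 * ?s\<^sup>2" using s \<rho> by (intro mult_left_mono power_mono) auto
      also have "\<dots> = ?s ^ 4" by (simp flip: power_add)
      finally show "?s\<^sup>2 \<le> ?s ^ 4 / \<rho>\<^sup>2" using \<rho> by (simp add: pos_le_divide_eq)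
    qed simp
    finally have "norm (D w) ^ 2 \<le> 4 * C\<^sup>2 * ?s ^ 4 / \<rho>\<^sup>2" by simp
    moreover have "0 \<le> \<epsilon>\<^sup>2 / 4" by simp
    ultimately show ?thesis by linarith
  qed
  have pt2: "(1 + c + norm (Xn (s n) w)) ^ 4 \<le> 8 * (1 + c) ^ 4 + 8 * norm (Xn (s n) w) ^ 4" for w
    using norm_add_power_4[of "1 + c" "norm (Xn (s n) w)"] c0 by simp
  have "norm (D w) ^ 2 \<le> \<epsilon>\<^sup>2 / 4 + (4 * C\<^sup>2 / \<rho>\<^sup>2) * (8 * (1 + c) ^ 4 + 8 * norm (Xn (s n) w) ^ 4)" for w
  proof -
    have "4 * C\<^sup>2 * (1 + c + norm (Xn (s n) w)) ^ 4 / \<rho>\<^sup>2 = (4 * C\<^sup>2 / \<rho>\<^sup>2) * (1 + c + norm (Xn (s n) w)) ^ 4" by simp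
    also have "\<dots> \<le> (4 * C\<^sup>2 / \<rho>\<^sup>2) * (8 * (1 + c) ^ 4 + 8 * norm (Xn (s n) w) ^ 4)"
      by (intro mult_left_mono pt2) simp
    finally show ?thesis using pt[of w] by linarith
  qed
  then have "(\<integral>w. norm (D w) ^ 2 \<partial>M) \<le> (\<integral>w. \<epsilon>\<^sup>2 / 4 + (4 * C\<^sup>2 / \<rho>\<^sup>2) * (8 * (1 + c) ^ 4 + 8 * norm (Xn (s n) w) ^ 4) \<partial>M)"
    using Lspace_integrable[OF DL] Lspace_integrable[OF X[of "s n"]] by (intro integral_mono) auto
  also have "\<dots> = \<epsilon>\<^sup>2 / 4 + (4 * C\<^sup>2 / \<rho>\<^sup>2) * (8 * (1 + c) ^ 4 + 8 * (\<integral>w. norm (Xn (s n) w) ^ 4 \<partial>M))"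
    using Lspace_integrable[OF X[of "s n"]] by (simp add: prob_space)
  also have "\<dots> \<le> \<epsilon>\<^sup>2 / 4 + (4 * C\<^sup>2 / \<rho>\<^sup>2) * (8 * (1 + c) ^ 4 + 8 * R)"
    using R by (intro add_left_mono mult_left_mono) auto
  also have "\<dots> = \<epsilon>\<^sup>2 / 4 + K / \<rho>\<^sup>2" by (simp add: K_def)
  also have "\<dots> \<le> \<epsilon>\<^sup>2" using K\<rho> zero_le_power2[of \<epsilon>] by linarith
  finally have "l2_norm M D \<le> \<epsilon>" unfolding l2_norm_def using \<epsilon> by (intro real_le_lsqrt) auto
  then show False using far[of "s n"] by (simp add: D_def[abs_def])
qed

section \<open>Perturbed minimisation problems\<close>

definition pair_sol :: "'b::euclidean_space sol \<Rightarrow> ('a \<Rightarrow> 'b) \<Rightarrow> ('a \<Rightarrow> 'b) \<Rightarrow> real \<Rightarrow> ('a \<Rightarrow> 'b) \<Rightarrow> real" where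
  "pair_sol U V Y t X = pairing M (\<lambda>w. lift_sol M U t X w - V w) (\<lambda>w. X w - Y w)"

lemma square_sum3_le: "(a + b + c)\<^sup>2 \<le> 3 * (a\<^sup>2 + b\<^sup>2 + c\<^sup>2)" for a b c :: real
proof -
  have "0 \<le> (a - b)\<^sup>2 + (b - c)\<^sup>2 + (a - c)\<^sup>2" by simp
  then show ?thesis by (simp add: power2_eq_square algebra_simps)
qed

lemma pair_sol_integrand_bound:
  fixes U :: "'b::euclidean_space sol"
  assumes gr: "linear_growth T C U" and C: "C \<ge> 0" and t: "t \<in> {0..T}" and X: "X \<in> Lspace M 2"
  shows "\<bar>(lift_sol M U t X w - V w) \<bullet> (X w - Y w)\<bar> \<le>
    (6 * C\<^sup>2 + 2) * norm (X w) ^ 2 + 6 * C\<^sup>2 * (1 + (l2_norm M X)\<^sup>2) + 2 * norm (V w) ^ 2 + 2 * norm (Y w) ^ 2"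
proof -
  have "norm (lift_sol M U t X w) ^ 2 \<le> (C * (1 + norm (X w) + l2_norm M X)) ^ 2"
    by (intro power_mono lift_sol_growth[OF gr t X]) auto
  also have "\<dots> \<le> C\<^sup>2 * (3 * (1\<^sup>2 + (norm (X w))\<^sup>2 + (l2_norm M X)\<^sup>2))"
    unfolding power_mult_distrib by (intro mult_left_mono square_sum3_le) auto
  finally have l: "norm (lift_sol M U t X w) ^ 2 \<le> C\<^sup>2 * (3 * (1 + (norm (X w))\<^sup>2 + (l2_norm M X)\<^sup>2))"
    by simp
  have "\<bar>(lift_sol M U t X w - V w) \<bullet> (X w - Y w)\<bar>
      \<le> norm (lift_sol M U t X w + - V w) ^ 2 + norm (X w + - Y w) ^ 2"
    using abs_inner_le[of "lift_sol M U t X w - V w" "X w - Y w"] by simp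
  also have "\<dots> \<le> (2 * norm (lift_sol M U t X w) ^ 2 + 2 * norm (- V w) ^ 2) + (2 * norm (X w) ^ 2 + 2 * norm (- Y w) ^ 2)"
    by (intro add_mono norm_add_power_2)
  also have "\<dots> \<le> (2 * (C\<^sup>2 * (3 * (1 + (norm (X w))\<^sup>2 + (l2_norm M X)\<^sup>2))) + 2 * norm (V w) ^ 2) + (2 * norm (X w) ^ 2 + 2 * norm (Y w) ^ 2)"
    using l by simp
  finally show ?thesis by (simp add: algebra_simps)
qed

lemma pair_sol_bound:
  fixes U :: "'b::euclidean_space sol"
  assumes U: "continuous_map (sol_space T) euclidean U" and gr: "linear_growth T C U" and C: "C \<ge> 0" and t: "t \<in> {0..T}" and X: "X \<in> Lspace M 2"
    and V: "V \<in> Lspace M 2" and Y: "Y \<in> Lspace M 2"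
  shows "\<bar>pair_sol U V Y t X\<bar> \<le>
    (12 * C\<^sup>2 + 2) * (\<integral>w. norm (X w) ^ 2 \<partial>M) + (6 * C\<^sup>2 + 2 * (l2_norm M V)\<^sup>2 + 2 * (l2_norm M Y)\<^sup>2)"
proof -
  note ints = Lspace_integrable[OF X] Lspace_integrable[OF V] Lspace_integrable[OF Y]
  let ?B = "\<lambda>w. (6 * C\<^sup>2 + 2) * norm (X w) ^ 2 + 6 * C\<^sup>2 * (1 + (l2_norm M X)\<^sup>2) + 2 * norm (V w) ^ 2 + 2 * norm (Y w) ^ 2"
  have "\<bar>pair_sol U V Y t X\<bar> \<le> (\<integral>w. \<bar>(lift_sol M U t X w - V w) \<bullet> (X w - Y w)\<bar> \<partial>M)"
    unfolding pair_sol_def pairing_def by (rule integral_abs_bound)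
  also have "\<dots> \<le> (\<integral>w. ?B w \<partial>M)"
  proof (rule integral_mono)
    have "integrable M (\<lambda>w. (lift_sol M U t X w - V w) \<bullet> (X w - Y w))"
      by (intro pairing_integrable L2_diff lift_sol_L2[OF U gr t X] V X Y)
    then show "integrable M (\<lambda>w. \<bar>(lift_sol M U t X w - V w) \<bullet> (X w - Y w)\<bar>)"
      by (rule integrable_abs)
  qed (use ints pair_sol_integrand_bound[OF gr C t X] in auto)
  also have "\<dots> = (6 * C\<^sup>2 + 2) * (\<integral>w. norm (X w) ^ 2 \<partial>M) + 6 * C\<^sup>2 * (1 + (l2_norm M X)\<^sup>2)
      + 2 * (\<integral>w. norm (V w) ^ 2 \<partial>M) + 2 * (\<integral>w. norm (Y w) ^ 2 \<partial>M)"
    using ints by (simp add: prob_space)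
  finally show ?thesis by (simp add: l2_norm_square_integral algebra_simps)
qed

text \<open>Fatou's lemma gives lower semicontinuity only; the limit \<open>e\<close> of the moments
  can be strictly larger than the moment of the limit.\<close>

lemma fourth_moment_lower_limit:
  fixes X :: "nat \<Rightarrow> 'a \<Rightarrow> 'b::euclidean_space"
  assumes X: "\<And>n. X n \<in> Lspace M 4" and Xl: "Xl \<in> borel_measurable M"
    and e: "(\<lambda>n. \<integral>w. norm (X n w) ^ 4 \<partial>M) \<longlonglongrightarrow> e"
    and lim: "AE w in M. (\<lambda>n. X n w) \<longlonglongrightarrow> Xl w"
  shows "Xl \<in> Lspace M 4" "(\<integral>w. norm (Xl w) ^ 4 \<partial>M) \<le> e"
proof -
  have *: "E_rv M 4 Xl \<le> ennreal c" if c: "c > e" for c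
  proof -
    obtain N where N: "\<And>n. n \<ge> N \<Longrightarrow> (\<integral>w. norm (X n w) ^ 4 \<partial>M) < c"
      using order_tendstoD(2)[OF e c] by (auto simp: eventually_sequentially)
    show ?thesis
    proof (rule E_rv_le_of_AE_limit[of "\<lambda>n. X (n + N)"])
      show "E_rv M 4 (X (n + N)) \<le> ennreal c" for n
        using E_rv_eq_integral[OF Lspace_integrable[OF X[of "n + N"]]] N[of "n + N"]
        by (auto intro!: ennreal_leI)
      show "AE w in M. (\<lambda>n. X (n + N) w) \<longlonglongrightarrow> Xl w"
        using lim by eventually_elim (rule LIMSEQ_ignore_initial_segment)
    qed (use Xl X Lspace_measurable in auto)
  qed
  show L: "Xl \<in> Lspace M 4"
    using *[of "e + 1"] Xl by (auto simp: Lspace_def intro: le_less_trans)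
  show "(\<integral>w. norm (Xl w) ^ 4 \<partial>M) \<le> e"
  proof (rule field_le_epsilon)
    fix d :: real assume d: "d > 0"
    have "e \<ge> 0" by (rule tendsto_lowerbound[OF e]) (auto intro!: always_eventually Bochner_Integration.integral_nonneg)
    then show "(\<integral>w. norm (Xl w) ^ 4 \<partial>M) \<le> e + d"
      using *[of "e + d"] d E_rv_eq_integral[OF Lspace_integrable[OF L]] by (simp add: ennreal_le_iff del: ennreal_plus)
  qed
qed

lemma pairing_tendsto:
  fixes X :: "nat \<Rightarrow> 'a \<Rightarrow> 'b::euclidean_space"
  assumes h: "h \<in> Lspace M 2" and X: "\<And>n. X n \<in> Lspace M 2" "Xl \<in> Lspace M 2"
    and lim: "(\<lambda>n. l2_norm M (\<lambda>w. X n w - Xl w)) \<longlonglongrightarrow> 0"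
  shows "(\<lambda>n. pairing M h (X n)) \<longlonglongrightarrow> pairing M h Xl"
proof (rule LIM_zero_cancel, rule Lim_null_comparison)
  show "(\<lambda>n. l2_norm M h * l2_norm M (\<lambda>w. X n w - Xl w)) \<longlonglongrightarrow> 0"
    by (rule tendsto_mult_right_zero[OF lim])
  show "\<forall>\<^sub>F n in sequentially. norm (pairing M h (X n) - pairing M h Xl)
      \<le> l2_norm M h * l2_norm M (\<lambda>w. X n w - Xl w)"
    using pairing_le_l2_norm[OF h L2_diff[OF X(1) X(2)]] pairing_diff_right[OF X(1) X(2) h] by simp
qed

lemma l2_norm_tendsto_imp_integral:
  assumes "(\<lambda>n. l2_norm M (\<lambda>w. X n w - Xl w)) \<longlonglongrightarrow> 0"
  shows "(\<lambda>n. \<integral>w. norm (X n w - Xl w) ^ 2 \<partial>M) \<longlonglongrightarrow> 0"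
  using tendsto_power[OF assms, of 2] by (simp add: l2_norm_square_integral)

lemma W2_law_tendsto:
  fixes X :: "nat \<Rightarrow> 'a \<Rightarrow> 'b::euclidean_space"
  assumes X: "\<And>n. X n \<in> Lspace M 2" "Xl \<in> Lspace M 2"
    and lim: "(\<lambda>n. l2_norm M (\<lambda>w. X n w - Xl w)) \<longlonglongrightarrow> 0"
  shows "(\<lambda>n. W2 (law M Xl) (law M (X n))) \<longlonglongrightarrow> 0"
proof (rule tendsto_sandwich[OF _ _ tendsto_const lim])
  show "\<forall>\<^sub>F n in sequentially. W2 (law M Xl) (law M (X n)) \<le> l2_norm M (\<lambda>w. X n w - Xl w)"
    using W2_law_le[OF Lspace_measurable[OF X(2)] Lspace_measurable[OF X(1)]
        Lspace_integrable[OF L2_diff[OF X(2) X(1)]]]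
    by (simp add: l2_norm_def norm_minus_commute)
qed (simp add: W2_nonneg)

text \<open>The integrand grows quadratically, so it converges dominatedly along a subsequence that
  converges almost surely with dominated squares. A subsequence suffices, since the values of a
  minimising sequence have a known limit.\<close>

lemma pair_sol_tendsto_subseq:
  fixes U :: "'b::euclidean_space sol"
  assumes U: "continuous_map (sol_space T) euclidean U" and gr: "linear_growth T C U" and C: "C \<ge> 0"
    and V: "V \<in> Lspace M 2" and Y: "Y \<in> Lspace M 2"
    and t: "\<And>n. tn n \<in> {0..T}" "t \<in> {0..T}" "tn \<longlonglongrightarrow> t"
    and X: "\<And>n. X n \<in> Lspace M 2" "Xl \<in> Lspace M 2"
    and lim: "(\<lambda>n. l2_norm M (\<lambda>w. X n w - Xl w)) \<longlonglongrightarrow> 0"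
    and c: "\<And>n. l2_norm M (X n) \<le> c"
  obtains r where "strict_mono r" "AE w in M. (\<lambda>n. X (r n) w) \<longlonglongrightarrow> Xl w"
    "(\<lambda>n. pair_sol U V Y (tn (r n)) (X (r n))) \<longlonglongrightarrow> pair_sol U V Y t Xl"
proof -
  have Xint: "integrable M (\<lambda>w. norm (X n w - Xl w) ^ 2)" for n
    by (intro Lspace_integrable L2_diff X)
  obtain r S where r: "strict_mono r" "integrable M S"
    "AE w in M. (\<lambda>k. X (r k) w) \<longlonglongrightarrow> Xl w" "AE w in M. \<forall>k. norm (X (r k) w - Xl w) ^ 2 \<le> S w"
    using Lp_subseq_dominated[OF _ Xint l2_norm_tendsto_imp_integral[OF lim]] by auto
  have Wl: "(\<lambda>k. W2 (law M Xl) (law M (X (r k)))) \<longlonglongrightarrow> 0"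
    using LIMSEQ_subseq_LIMSEQ[OF W2_law_tendsto[OF X lim] r(1)] by (simp add: o_def)
  have tl: "(\<lambda>k. tn (r k)) \<longlonglongrightarrow> t"
    using LIMSEQ_subseq_LIMSEQ[OF t(3) r(1)] by (simp add: o_def)
  have meas: "(\<lambda>w. (lift_sol M U s Z w - V w) \<bullet> (Z w - Y w)) \<in> borel_measurable M"
    if "s \<in> {0..T}" "Z \<in> Lspace M 2" for s Z
    by (intro borel_measurable_inner borel_measurable_diff lift_sol_measurable[OF U] Lspace_measurable[OF V]
        Lspace_measurable[OF Y] Lspace_measurable[OF that(2)] that)
  let ?B = "\<lambda>w. (6 * C\<^sup>2 + 2) * (2 * S w + 2 * norm (Xl w) ^ 2) + 6 * C\<^sup>2 * (1 + c\<^sup>2) + 2 * norm (V w) ^ 2 + 2 * norm (Y w) ^ 2"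
  have "(\<lambda>n. pair_sol U V Y (tn (r n)) (X (r n))) \<longlonglongrightarrow> pair_sol U V Y t Xl"
    unfolding pair_sol_def pairing_def
  proof (rule integral_dominated_convergence[where w = ?B])
    show "integrable M ?B"
      using r(2) Lspace_integrable[OF X(2)] Lspace_integrable[OF V] Lspace_integrable[OF Y] by auto
    show "AE w in M. (\<lambda>n. (lift_sol M U (tn (r n)) (X (r n)) w - V w) \<bullet> (X (r n) w - Y w))
        \<longlonglongrightarrow> (lift_sol M U t Xl w - V w) \<bullet> (Xl w - Y w)"
      using r(3)
    proof eventually_elim
      case (elim w)
      have "(\<lambda>n. lift_sol M U (tn (r n)) (X (r n)) w) \<longlonglongrightarrow> lift_sol M U t Xl w"
        unfolding lift_sol_def using t X
        by (intro sol_space_tendsto_const[OF U] tl elim Wl law_in_P2) auto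
      then show ?case by (intro tendsto_intros elim)
    qed
    show "AE w in M. norm ((lift_sol M U (tn (r n)) (X (r n)) w - V w) \<bullet> (X (r n) w - Y w)) \<le> ?B w" for n
      using r(4)
    proof eventually_elim
      case (elim w)
      have "norm (X (r n) w) ^ 2 \<le> 2 * norm (X (r n) w - Xl w) ^ 2 + 2 * norm (Xl w) ^ 2"
        using norm_add_power_2[of "X (r n) w - Xl w" "Xl w"] by simp
      also have "\<dots> \<le> 2 * S w + 2 * norm (Xl w) ^ 2" using elim by simp
      finally have 1: "(6 * C\<^sup>2 + 2) * norm (X (r n) w) ^ 2 \<le> (6 * C\<^sup>2 + 2) * (2 * S w + 2 * norm (Xl w) ^ 2)"
        by (intro mult_left_mono) auto
      have "(l2_norm M (X (r n)))\<^sup>2 \<le> c\<^sup>2" by (intro power_mono c) auto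
      then have 2: "6 * C\<^sup>2 * (1 + (l2_norm M (X (r n)))\<^sup>2) \<le> 6 * C\<^sup>2 * (1 + c\<^sup>2)"
        by (intro mult_left_mono) auto
      show ?case
        using pair_sol_integrand_bound[OF gr C t(1)[of "r n"] X(1)[of "r n"], of w V Y] 1 2
        unfolding real_norm_def by linarith
    qed
  qed (intro meas t X)+
  with r show thesis by (intro that) auto
qed

definition moment_ball :: "real \<Rightarrow> ('a \<Rightarrow> 'b::euclidean_space) set" where
  "moment_ball R = {X \<in> Lspace M 4. (\<integral>w. norm (X w) ^ 4 \<partial>M) \<le> R}"

text \<open>The finite value of \<open>penalized\<close> on L^4. The time part
  \<open>\<theta>\<close> and the quartic coefficient \<open>a\<close> are parameters because both
  change when the test function is modified.\<close>

definition cost :: "'b::euclidean_space sol \<Rightarrow> ('a \<Rightarrow> 'b) \<Rightarrow> ('a \<Rightarrow> 'b) \<Rightarrow> (real \<Rightarrow> real) \<Rightarrow> ('a \<Rightarrow> 'b)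
    \<Rightarrow> real \<Rightarrow> real \<Rightarrow> real \<Rightarrow> ('a \<Rightarrow> 'b) \<Rightarrow> real" where
  "cost U V Y \<theta> h a l t X =
    pair_sol U V Y t X - (\<theta> t + pairing M h X) + a * exp (l * t) * (\<integral>w. norm (X w) ^ 4 \<partial>M)"

text \<open>Stegall's principle makes the X-components of a minimising sequence converge in L^2; the
  pairs of time and fourth moment lie in a compact rectangle and converge along a subsequence. The
  limit point attains the minimum because its fourth moment is at most the limit of the moments and
  \<open>a \<ge> 0\<close>.\<close>

theorem perturbed_minimum:
  fixes U :: "'b::euclidean_space sol"
  assumes U: "continuous_map (sol_space T) euclidean U" and gr: "linear_growth T C U" and C: "C \<ge> 0"
    and V: "V \<in> Lspace M 2" and Y: "Y \<in> Lspace M 2" and h: "h \<in> Lspace M 2"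
    and \<tau>: "0 \<le> \<tau>" "\<tau> \<le> T" and \<theta>: "continuous_on {0..\<tau>} \<theta>" and a: "a \<ge> 0" and R: "R \<ge> 0"
    and \<epsilon>: "\<epsilon> > 0"
  obtains k t X where "k \<in> Lspace M 2" "l2_norm M k \<le> \<epsilon>" "t \<in> {0..\<tau>}" "X \<in> moment_ball R"
    "\<And>s Z. s \<in> {0..\<tau>} \<Longrightarrow> Z \<in> moment_ball R \<Longrightarrow>
      cost U V Y \<theta> h a l t X + pairing M k X \<le> cost U V Y \<theta> h a l s Z + pairing M k Z"
proof -
  define D :: "(real \<times> ('a \<Rightarrow> 'b)) set" where "D = {0..\<tau>} \<times> moment_ball R"
  define f where "f p = cost U V Y \<theta> h a l (fst p) (snd p)" for p
  have lvl: "X \<in> Lspace M 4" "X \<in> Lspace M 2" "(\<integral>w. norm (X w) ^ 4 \<partial>M) \<le> R" "l2_norm M X \<le> 1 + R"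
    if "X \<in> moment_ball R" for X :: "'a \<Rightarrow> 'b"
    using that L4_imp_L2 l2_norm_le_L4 by (auto simp: moment_ball_def)
  have "(\<lambda>w. 0) \<in> (moment_ball R :: ('a \<Rightarrow> 'b) set)" using R by (simp add: moment_ball_def Lspace_iff)
  then have D0: "D \<noteq> {}" using \<tau> by (auto simp: D_def)
  have "bounded (\<theta> ` {0..\<tau>})"
    by (intro compact_imp_bounded compact_continuous_image \<theta> compact_Icc)
  then obtain b where "\<forall>t\<in>{0..\<tau>}. \<bar>\<theta> t\<bar> \<le> b" by (auto simp: bounded_iff simp del: atLeastAtMost_iff)
  then have b: "\<And>t. t \<in> {0..\<tau>} \<Longrightarrow> \<bar>\<theta> t\<bar> \<le> b" by blast
  define B where "B = - ((12 * C\<^sup>2 + 2) * (1 + R)\<^sup>2 + (6 * C\<^sup>2 + 2 * (l2_norm M V)\<^sup>2 + 2 * (l2_norm M Y)\<^sup>2))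
      - b - l2_norm M h * (1 + R)"
  have B: "f p \<ge> B" if pD: "p \<in> D" for p
  proof -
    obtain t X where p: "p = (t, X)" "t \<in> {0..\<tau>}" "X \<in> moment_ball R"
      using pD unfolding D_def by blast
    have t: "t \<in> {0..T}" using p \<tau> by auto
    have "(\<integral>w. norm (X w) ^ 2 \<partial>M) \<le> (1 + R)\<^sup>2"
      using lvl(4)[OF p(3)] unfolding l2_norm_square_integral[symmetric] by (intro power_mono) auto
    then have "(12 * C\<^sup>2 + 2) * (\<integral>w. norm (X w) ^ 2 \<partial>M) \<le> (12 * C\<^sup>2 + 2) * (1 + R)\<^sup>2"
      by (intro mult_left_mono) auto
    moreover have "\<bar>pairing M h X\<bar> \<le> l2_norm M h * (1 + R)"
      using pairing_le_l2_norm[OF h lvl(2)[OF p(3)]] mult_left_mono[OF lvl(4)[OF p(3)], of "l2_norm M h"] by simp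
    moreover have "0 \<le> a * exp (l * t) * (\<integral>w. norm (X w) ^ 4 \<partial>M)"
      using a by (intro mult_nonneg_nonneg Bochner_Integration.integral_nonneg) auto
    ultimately show ?thesis
      using pair_sol_bound[OF U gr C t lvl(2)[OF p(3)] V Y] b[OF p(2)]
      unfolding f_def cost_def p(1) fst_conv snd_conv B_def by linarith
  qed
  have xi: "p \<in> D \<Longrightarrow> snd p \<in> Lspace M 2" and xiR: "p \<in> D \<Longrightarrow> l2_norm M (snd p) \<le> 1 + R" for p
    using lvl by (auto simp: D_def)
  have R1: "1 + R > 0" using R by simp
  obtain k Xl p v where k: "k \<in> Lspace M 2" "l2_norm M k \<le> \<epsilon>" and Xl: "Xl \<in> Lspace M 2"
    and p: "\<And>n::nat. p n \<in> D" "(\<lambda>n. l2_norm M (\<lambda>w. snd (p n) w - Xl w)) \<longlonglongrightarrow> 0"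
      "(\<lambda>n. f (p n) + pairing M k (snd (p n))) \<longlonglongrightarrow> v"
      "\<And>q. q \<in> D \<Longrightarrow> v \<le> f q + pairing M k (snd q)"
    using stegall_L2[where D = D and f = f and \<xi> = snd, OF D0 xi R1 xiR B \<epsilon>] by blast
  have pt: "fst (p n) \<in> {0..\<tau>}" and pX: "snd (p n) \<in> moment_ball R" for n
    using p(1)[of n] by (auto simp: D_def)
  define m where "m n = (fst (p n), \<integral>w. norm (snd (p n) w) ^ 4 \<partial>M)" for n
  have "seq_compact ({0..\<tau>} \<times> {0..R})"
    by (intro compact_imp_seq_compact compact_Times compact_Icc)
  moreover have "\<forall>n. m n \<in> {0..\<tau>} \<times> {0..R}"
    using pt lvl(3)[OF pX] by (auto simp: m_def intro!: Bochner_Integration.integral_nonneg)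
  ultimately obtain te q where te: "te \<in> {0..\<tau>} \<times> {0..R}" and q: "strict_mono q" "(m \<circ> q) \<longlonglongrightarrow> te"
    by (rule seq_compactE)
  define t where "t = fst te"
  have t: "t \<in> {0..\<tau>}" "(\<lambda>n. fst (p (q n))) \<longlonglongrightarrow> t"
    using te tendsto_fst[OF q(2)] by (auto simp: t_def m_def o_def)
  have e: "(\<lambda>n. \<integral>w. norm (snd (p (q n)) w) ^ 4 \<partial>M) \<longlonglongrightarrow> snd te"
    using tendsto_snd[OF q(2)] by (simp add: m_def o_def)
  have lim1: "(\<lambda>n. l2_norm M (\<lambda>w. snd (p (q n)) w - Xl w)) \<longlonglongrightarrow> 0"
    using LIMSEQ_subseq_LIMSEQ[OF p(2) q(1)] by (simp add: o_def)
  have ptT: "fst (p (q n)) \<in> {0..T}" "t \<in> {0..T}" for n using pt[of "q n"] t(1) \<tau> by auto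
  obtain r where r: "strict_mono r" "AE w in M. (\<lambda>n. snd (p (q (r n))) w) \<longlonglongrightarrow> Xl w"
    "(\<lambda>n. pair_sol U V Y (fst (p (q (r n)))) (snd (p (q (r n))))) \<longlonglongrightarrow> pair_sol U V Y t Xl"
    using pair_sol_tendsto_subseq[OF U gr C V Y ptT t(2) lvl(2)[OF pX] Xl lim1 lvl(4)[OF pX]] .
  define s where "s n = q (r n)" for n
  have sub: "(\<lambda>n. g (r n)) \<longlonglongrightarrow> c" if "g \<longlonglongrightarrow> c" for g :: "nat \<Rightarrow> real" and c
    using LIMSEQ_subseq_LIMSEQ[OF that r(1)] by (simp add: o_def)
  have es: "(\<lambda>n. \<integral>w. norm (snd (p (s n)) w) ^ 4 \<partial>M) \<longlonglongrightarrow> snd te"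
    using sub[OF e] by (simp add: s_def)
  have Xl4: "Xl \<in> Lspace M 4" "(\<integral>w. norm (Xl w) ^ 4 \<partial>M) \<le> snd te"
    using fourth_moment_lower_limit[of "\<lambda>n. snd (p (s n))", OF lvl(1)[OF pX] Lspace_measurable[OF Xl] es] r(2)
    by (auto simp: s_def)
  have ts: "(\<lambda>n. fst (p (s n))) \<longlonglongrightarrow> t" using sub[OF t(2)] by (simp add: s_def)
  have th: "(\<lambda>n. \<theta> (fst (p (s n)))) \<longlonglongrightarrow> \<theta> t"
    using \<theta> t(1) pt ts unfolding continuous_on_sequentially by (auto simp: o_def)
  have lims: "(\<lambda>n. l2_norm M (\<lambda>w. snd (p (s n)) w - Xl w)) \<longlonglongrightarrow> 0"
    using sub[OF lim1] by (simp add: s_def)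
  have prs: "(\<lambda>n. pair_sol U V Y (fst (p (s n))) (snd (p (s n)))) \<longlonglongrightarrow> pair_sol U V Y t Xl"
    using r(3) by (simp add: s_def)
  have "(\<lambda>n. f (p (s n)) + pairing M k (snd (p (s n)))) \<longlonglongrightarrow>
      (pair_sol U V Y t Xl - (\<theta> t + pairing M h Xl) + a * exp (l * t) * snd te) + pairing M k Xl"
    unfolding f_def cost_def
    by (intro tendsto_intros prs th ts es pairing_tendsto[OF h lvl(2)[OF pX] Xl lims]
        pairing_tendsto[OF k(1) lvl(2)[OF pX] Xl lims])
  moreover have "(\<lambda>n. f (p (s n)) + pairing M k (snd (p (s n)))) \<longlonglongrightarrow> v"
  proof -
    have "strict_mono s" using q r by (simp add: s_def strict_mono_def)
    from LIMSEQ_subseq_LIMSEQ[OF p(3) this] show ?thesis by (simp add: o_def)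
  qed
  ultimately have v: "v = (pair_sol U V Y t Xl - (\<theta> t + pairing M h Xl) + a * exp (l * t) * snd te) + pairing M k Xl"
    using LIMSEQ_unique by blast
  have "a * exp (l * t) * (\<integral>w. norm (Xl w) ^ 4 \<partial>M) \<le> a * exp (l * t) * snd te"
    using Xl4(2) a by (intro mult_left_mono) auto
  then have "cost U V Y \<theta> h a l t Xl + pairing M k Xl \<le> v" unfolding v cost_def by simp
  moreover have "Xl \<in> moment_ball R" using Xl4 te by (auto simp: moment_ball_def)
  ultimately show thesis
    using p(4)[of "(_, _)"] by (intro that[OF k t(1)]) (auto simp: f_def D_def intro: order_trans)
qed

end

section \<open>The penalty\<close>

lemma abs_exp_minus_one_le: "\<bar>exp u - 1\<bar> \<le> \<bar>u\<bar> * exp \<bar>u\<bar>" for u :: real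
proof (cases "u \<ge> 0")
  case True
  have "1 - u \<le> exp (- u)" using exp_ge_add_one_self[of "- u"] by simp
  then have "(1 - u) * exp u \<le> exp (- u) * exp u" by (intro mult_right_mono) auto
  then have "(1 - u) * exp u \<le> 1" by (simp flip: exp_add)
  then show ?thesis using True by (simp add: algebra_simps)
next
  case False
  then have "\<bar>u\<bar> * 1 \<le> \<bar>u\<bar> * exp \<bar>u\<bar>" by (intro mult_left_mono) auto
  moreover have "\<bar>exp u - 1\<bar> = 1 - exp u" using False by simp
  ultimately show ?thesis using exp_ge_add_one_self[of u] False by linarith
qed

text \<open>The exact second-order remainder is
  \<open>(|x|\<^sup>2 - |y|\<^sup>2)\<^sup>2 + 2 |y|\<^sup>2 |x - y|\<^sup>2\<close>.\<close>

lemma fourth_power_convex: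
  fixes x y :: "'a::real_inner"
  shows "norm x ^ 4 \<ge> norm y ^ 4 + 4 * ((norm y)\<^sup>2 * (y \<bullet> (x - y)))
    + (norm (x - y) ^ 4 / 6 + (norm y)\<^sup>2 * (norm (x - y))\<^sup>2)"
proof -
  define z s where "z = x - y" and "s = y \<bullet> z"
  define n where "n = (norm z)\<^sup>2"
  define p where "p = (norm y)\<^sup>2"
  have x: "(norm x)\<^sup>2 = p + 2 * s + n"
    unfolding p_def n_def s_def z_def power2_norm_eq_inner
    by (simp add: inner_diff_left inner_diff_right inner_commute algebra_simps)
  have cs: "s\<^sup>2 \<le> p * n"
  proof -
    have "\<bar>s\<bar> \<le> norm y * norm z" unfolding s_def by (rule Cauchy_Schwarz_ineq2)
    then have "\<bar>s\<bar>\<^sup>2 \<le> (norm y * norm z)\<^sup>2" by (intro power_mono) auto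
    then show ?thesis by (simp add: p_def n_def power_mult_distrib)
  qed
  have 4: "norm v ^ 4 = ((norm v)\<^sup>2)\<^sup>2" for v :: 'a by simp
  have "norm x ^ 4 - norm y ^ 4 - 4 * (p * s) = (n + 2 * s)\<^sup>2 + 2 * p * n"
    unfolding 4 x p_def[symmetric] by (simp add: power2_eq_square algebra_simps)
  \<comment> \<open>One of the two copies of \<open>p * n\<close> pays for \<open>s\<^sup>2\<close>
    by Cauchy-Schwarz. The least value of \<open>(n + 2 * s)\<^sup>2 + s\<^sup>2\<close> over
    \<open>s\<close> is \<open>n\<^sup>2 / 5\<close>, of which \<open>n\<^sup>2 / 6\<close> is
    kept.\<close>
  moreover have "(n + 2 * s)\<^sup>2 + 2 * p * n \<ge> n\<^sup>2 / 6 + p * n"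
  proof -
    have "(n + 2 * s)\<^sup>2 + s\<^sup>2 \<ge> n\<^sup>2 / 6"
    proof -
      have "(n + 2 * s)\<^sup>2 + s\<^sup>2 - n\<^sup>2 / 6 = 5 * (s + 2 * n / 5)\<^sup>2 + n\<^sup>2 / 30"
        by (simp add: power2_eq_square field_simps)
      moreover have "\<dots> \<ge> 0" by simp
      ultimately show ?thesis by linarith
    qed
    then show ?thesis using cs by linarith
  qed
  moreover have "norm z ^ 4 = n\<^sup>2" by (simp add: n_def)
  ultimately show ?thesis
    unfolding z_def[symmetric] n_def[symmetric] p_def[symmetric] s_def[symmetric] by linarith
qed

text \<open>For \<open>b = 1\<close> the left side is the remainder of the first-order expansion of
  e^(lt) |x|^4 at (t0, y); for \<open>b = 0\<close> the gradient in \<open>x\<close> has been cut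
  off. Since the exponential factor moves with \<open>t\<close>, a cross term
  \<open>(m - b) * S\<close> survives. The part |y|^2 |x - y|^2 of the convexity remainder absorbs
  it and leaves \<open>(m - b)\<^sup>2\<close> times |y|^4, which is of order (t - t0)^2 for
  \<open>b = 1\<close> and merely bounded by a multiple of |y|^4 for \<open>b = 0\<close>.\<close>

lemma penalty_pointwise:
  fixes x y :: "'a::real_inner" and b :: real
  assumes t: "0 \<le> t" "t \<le> T" "0 \<le> t0" "t0 \<le> T" and l: "l \<ge> 0" and b: "b = 0 \<or> b = 1"
  defines "q \<equiv> exp (- (l * T))"
  shows "exp (l * t) * norm x ^ 4 - exp (l * t0) * norm y ^ 4 * (1 + l * (t - t0))
      - 4 * exp (l * t0) * (b * (norm y)\<^sup>2 * (y \<bullet> (x - y)))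
    \<ge> q / 6 * norm (x - y) ^ 4 - 4 * l\<^sup>2 * exp (l * T) ^ 3 / q * ((t - t0)\<^sup>2 * norm y ^ 4)
      - 4 * exp (l * T) ^ 3 / q * ((1 - b) * norm y ^ 4)"
proof -
  define E m a where "E = exp (l * t0)" and "m = exp (l * (t - t0))" and "a = t - t0"
  define H where "H = exp (l * T)"
  have aT: "\<bar>a\<bar> \<le> T" using t by (auto simp: a_def)
  have laT: "\<bar>l * a\<bar> \<le> l * T" using mult_left_mono[OF aT l] l by (simp add: abs_mult)
  have E: "1 \<le> E" "E \<le> H" using t l by (auto simp: E_def H_def intro: mult_left_mono)
  have H: "H \<ge> 1" using E by linarith
  have m: "q \<le> m" "m \<le> H" "1 + l * a \<le> m"
    using laT exp_ge_add_one_self[of "l * a"] by (auto simp: q_def m_def H_def a_def)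
  have q: "q > 0" by (simp add: q_def)
  define d where "d = norm (x - y) ^ 4 / 6 + (norm y)\<^sup>2 * (norm (x - y))\<^sup>2"
  define S where "S = (norm y)\<^sup>2 * (y \<bullet> (x - y))"
  have d0: "d \<ge> 0" unfolding d_def by (intro add_nonneg_nonneg mult_nonneg_nonneg) auto
  have cv: "norm x ^ 4 \<ge> norm y ^ 4 + 4 * S + d"
    using fourth_power_convex[of y x] by (simp add: d_def S_def)
  have Em: "exp (l * t) = E * m" by (simp add: E_def m_def algebra_simps flip: exp_add)
  \<comment> \<open>Young's inequality, weighted so that its first term is exactly the second part
    of \<open>q * d\<close>.\<close>
  have mb: "4 * \<bar>(m - b) * S\<bar> \<le> q * ((norm y)\<^sup>2 * (norm (x - y))\<^sup>2) + 4 * (m - b)\<^sup>2 / q * norm y ^ 4"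
  proof -
    define u v where "u = norm y * norm (x - y)" and "v = 2 * \<bar>m - b\<bar> * (norm y)\<^sup>2"
    have "\<bar>S\<bar> \<le> (norm y)\<^sup>2 * (norm y * norm (x - y))"
      unfolding S_def abs_mult by (intro mult_mono Cauchy_Schwarz_ineq2) auto
    then have "4 * (\<bar>m - b\<bar> * \<bar>S\<bar>) \<le> 4 * (\<bar>m - b\<bar> * ((norm y)\<^sup>2 * u))"
      unfolding u_def by (intro mult_left_mono) auto
    also have "\<dots> = 2 * (u * v)" by (simp add: v_def)
    also have "\<dots> \<le> q * u\<^sup>2 + v\<^sup>2 / q"
    proof -
      have "0 \<le> (q * u - v)\<^sup>2 / q" using q by simp
      also have "\<dots> = q * u\<^sup>2 + v\<^sup>2 / q - 2 * (u * v)"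
        using q by (simp add: power2_eq_square field_simps)
      finally show ?thesis by simp
    qed
    also have "\<dots> = q * ((norm y)\<^sup>2 * (norm (x - y))\<^sup>2) + 4 * (m - b)\<^sup>2 / q * norm y ^ 4"
      by (simp add: u_def v_def power_mult_distrib flip: power_mult)
    finally show ?thesis by (simp add: abs_mult)
  qed
  have "m * norm x ^ 4 - norm y ^ 4 * (1 + l * a) - 4 * (b * S)
      \<ge> q / 6 * norm (x - y) ^ 4 - 4 * (m - b)\<^sup>2 / q * norm y ^ 4"
  proof -
    have "m * norm x ^ 4 \<ge> m * (norm y ^ 4 + 4 * S + d)" using cv m(1) q by (intro mult_left_mono) auto
    moreover have "m * (norm y ^ 4 + 4 * S + d) = m * norm y ^ 4 + 4 * (m * S) + m * d" by (simp add: algebra_simps)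
    moreover have "m * norm y ^ 4 \<ge> norm y ^ 4 * (1 + l * a)"
      using mult_right_mono[OF m(3), of "norm y ^ 4"] by (simp add: mult.commute)
    moreover have "m * d \<ge> q * d" using m(1) d0 by (intro mult_right_mono) auto
    moreover have "q * d = q / 6 * norm (x - y) ^ 4 + q * ((norm y)\<^sup>2 * (norm (x - y))\<^sup>2)"
      by (simp add: d_def algebra_simps)
    moreover have "(m - b) * S = m * S - b * S" by (simp add: algebra_simps)
    moreover have "- (4 * ((m - b) * S)) \<le> q * ((norm y)\<^sup>2 * (norm (x - y))\<^sup>2) + 4 * (m - b)\<^sup>2 / q * norm y ^ 4"
      using mb by linarith
    ultimately show ?thesis by linarith
  qed
  then have "E * (m * norm x ^ 4 - norm y ^ 4 * (1 + l * a) - 4 * (b * S))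
      \<ge> E * (q / 6 * norm (x - y) ^ 4 - 4 * (m - b)\<^sup>2 / q * norm y ^ 4)"
    using E by (intro mult_left_mono) auto
  moreover have "E * (q / 6 * norm (x - y) ^ 4 - 4 * (m - b)\<^sup>2 / q * norm y ^ 4)
      \<ge> q / 6 * norm (x - y) ^ 4 - H * (4 * (m - b)\<^sup>2 / q * norm y ^ 4)"
  proof -
    have "1 * (q / 6 * norm (x - y) ^ 4) \<le> E * (q / 6 * norm (x - y) ^ 4)"
      using E q by (intro mult_right_mono) auto
    moreover have "E * (4 * (m - b)\<^sup>2 / q * norm y ^ 4) \<le> H * (4 * (m - b)\<^sup>2 / q * norm y ^ 4)"
      using E q by (intro mult_right_mono) auto
    ultimately show ?thesis by (simp add: right_diff_distrib)
  qed
  moreover have "H * (4 * (m - b)\<^sup>2 / q * norm y ^ 4)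
      \<le> 4 * l\<^sup>2 * H ^ 3 / q * (a\<^sup>2 * norm y ^ 4) + 4 * H ^ 3 / q * ((1 - b) * norm y ^ 4)"
  proof -
    have "(m - b)\<^sup>2 \<le> l\<^sup>2 * H\<^sup>2 * a\<^sup>2 + H\<^sup>2 * (1 - b)"
      using b
    proof
      assume b: "b = 1"
      have "\<bar>m - 1\<bar> \<le> \<bar>l * a\<bar> * exp \<bar>l * a\<bar>"
        using abs_exp_minus_one_le[of "l * a"] by (simp add: m_def a_def)
      also have "\<dots> \<le> \<bar>l * a\<bar> * H" unfolding H_def using laT by (intro mult_left_mono) auto
      finally have "\<bar>m - 1\<bar>\<^sup>2 \<le> (\<bar>l * a\<bar> * H)\<^sup>2" by (intro power_mono) auto
      then show ?thesis using b by (simp add: power_mult_distrib algebra_simps)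
    next
      assume b: "b = 0"
      have "m\<^sup>2 \<le> H\<^sup>2" using m q by (intro power_mono) auto
      then show ?thesis using b by (simp add: add_increasing)
    qed
    then have "4 * H / q * norm y ^ 4 * (m - b)\<^sup>2 \<le> 4 * H / q * norm y ^ 4 * (l\<^sup>2 * H\<^sup>2 * a\<^sup>2 + H\<^sup>2 * (1 - b))"
      using H q by (intro mult_left_mono) auto
    then show ?thesis
      by (simp add: power2_eq_square power3_eq_cube algebra_simps add_divide_distrib diff_divide_distrib)
  qed
  moreover have "E * (m * norm x ^ 4 - norm y ^ 4 * (1 + l * a) - 4 * (b * S))
      = exp (l * t) * norm x ^ 4 - exp (l * t0) * norm y ^ 4 * (1 + l * (t - t0))
      - 4 * exp (l * t0) * (b * (norm y)\<^sup>2 * (y \<bullet> (x - y)))"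
    unfolding Em S_def a_def by (simp add: E_def algebra_simps)
  ultimately show ?thesis
    unfolding a_def H_def by linarith
qed

context prob_space
begin

text \<open>For X in L^4 the field |X|^2 X is in general only in L^(4/3), whereas the linear part of
  a test function must be in L^2. Large values are switched off rather than clipped, so the gradient
  is either exact or absent at each sample point.\<close>

definition trunc_cube :: "('a \<Rightarrow> 'b::euclidean_space) \<Rightarrow> nat \<Rightarrow> 'a \<Rightarrow> 'b" where
  "trunc_cube X j w = ((if norm (X w) \<le> real j then 1 else 0) * (norm (X w))\<^sup>2) *\<^sub>R X w"

lemma trunc_cube_L2:
  assumes X: "X \<in> borel_measurable M"
  shows "trunc_cube X j \<in> Lspace M 2"
proof (rule Lspace_mono)
  show "trunc_cube X j \<in> borel_measurable M"
    unfolding trunc_cube_def[abs_def] using X by measurable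
  show "(\<lambda>w. real j ^ 3) \<in> Lspace M 2" by (rule L2_const)
  show "norm (trunc_cube X j w) \<le> norm (real j ^ 3)" for w
  proof (cases "norm (X w) \<le> real j")
    case True
    have "norm (X w) ^ 3 \<le> real j ^ 3" using True by (intro power_mono) auto
    then show ?thesis using True by (simp add: trunc_cube_def power2_eq_square power3_eq_cube)
  qed (simp add: trunc_cube_def)
qed

definition tail4 :: "('a \<Rightarrow> 'b::euclidean_space) \<Rightarrow> nat \<Rightarrow> real" where
  "tail4 X j = (\<integral>w. (if norm (X w) \<le> real j then 0 else 1) * norm (X w) ^ 4 \<partial>M)"

lemma tail4_integrable:
  fixes X :: "'a \<Rightarrow> 'b::euclidean_space"
  assumes X: "X \<in> Lspace M 4"
  shows "integrable M (\<lambda>w. (if norm (X w) \<le> real j then 0 else 1) * norm (X w) ^ 4)"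
proof -
  have [measurable]: "X \<in> borel_measurable M" using X by (rule Lspace_measurable)
  show ?thesis
  proof (rule Bochner_Integration.integrable_bound[OF Lspace_integrable[OF X]])
    show "(\<lambda>w. (if norm (X w) \<le> real j then 0 else 1) * norm (X w) ^ 4) \<in> borel_measurable M"
      by measurable
  qed auto
qed

lemma tail4_le:
  fixes X :: "'a \<Rightarrow> 'b::euclidean_space"
  assumes X: "X \<in> Lspace M 4"
  shows "0 \<le> tail4 X j" "tail4 X j \<le> (\<integral>w. norm (X w) ^ 4 \<partial>M)"
  unfolding tail4_def
  by (auto intro!: integral_mono tail4_integrable Lspace_integrable Bochner_Integration.integral_nonneg X)

lemma tail4_tendsto:
  fixes X :: "'a \<Rightarrow> 'b::euclidean_space"
  assumes X: "X \<in> Lspace M 4"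
  shows "tail4 X \<longlonglongrightarrow> 0"
proof -
  have [measurable]: "X \<in> borel_measurable M" using X by (rule Lspace_measurable)
  have "(\<lambda>j. tail4 X j) \<longlonglongrightarrow> (\<integral>w. 0 \<partial>M)"
    unfolding tail4_def
  proof (rule integral_dominated_convergence[OF _ _ Lspace_integrable[OF X]])
    show "AE w in M. (\<lambda>j. (if norm (X w) \<le> real j then 0 else 1) * norm (X w) ^ 4) \<longlonglongrightarrow> 0"
    proof (rule AE_I2)
      fix w
      obtain N where N: "norm (X w) \<le> real N" using real_arch_simple by blast
      have "\<forall>\<^sub>F j in sequentially. (if norm (X w) \<le> real j then 0 else 1) * norm (X w) ^ 4 = 0"
        using eventually_ge_at_top[of N]
      proof eventually_elim
        case (elim j)
        then have "real N \<le> real j" by simp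
        then show ?case using N by simp
      qed
      then show "(\<lambda>j. (if norm (X w) \<le> real j then 0 else 1) * norm (X w) ^ 4) \<longlonglongrightarrow> 0"
        by (rule tendsto_eventually)
    qed
    show "(\<lambda>w. (if norm (X w) \<le> real j then 0 else 1) * norm (X w) ^ 4) \<in> borel_measurable M" for j
      by measurable
  qed auto
  then show ?thesis by simp
qed

text \<open>Up to the truncation, this is the remainder of the first-order expansion at
  \<open>(t0, X0)\<close> of the term added to the functional.\<close>

definition penalty :: "real \<Rightarrow> real \<Rightarrow> ('a \<Rightarrow> 'b::euclidean_space) \<Rightarrow> nat \<Rightarrow> real \<Rightarrow> ('a \<Rightarrow> 'b) \<Rightarrow> real" where
  "penalty l t0 X0 j t X = exp (l * t) * (\<integral>w. norm (X w) ^ 4 \<partial>M)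
    - exp (l * t0) * (\<integral>w. norm (X0 w) ^ 4 \<partial>M) * (1 + l * (t - t0))
    - 4 * exp (l * t0) * pairing M (trunc_cube X0 j) (\<lambda>w. X w - X0 w)"

text \<open>\<open>penalty_pointwise\<close> is integrated with \<open>b\<close> depending on the
  sample point, as the indicator of the set where the gradient is kept; the terms with
  \<open>1 - b\<close> add up to the tail.\<close>

lemma penalty_lower_bound:
  fixes X X0 :: "'a \<Rightarrow> 'b::euclidean_space"
  assumes X: "X \<in> Lspace M 4" and X0: "X0 \<in> Lspace M 4"
    and t: "0 \<le> t" "t \<le> T" "0 \<le> t0" "t0 \<le> T" and l: "l \<ge> 0"
  shows "penalty l t0 X0 j t X \<ge> exp (- (l * T)) / 6 * (\<integral>w. norm (X w - X0 w) ^ 4 \<partial>M)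
    - 4 * l\<^sup>2 * exp (l * T) ^ 3 / exp (- (l * T)) * ((t - t0)\<^sup>2 * (\<integral>w. norm (X0 w) ^ 4 \<partial>M))
    - 4 * exp (l * T) ^ 3 / exp (- (l * T)) * tail4 X0 j" (is "_ \<ge> ?c1 * _ - ?c2 * _ - ?c3 * _")
proof -
  let ?b = "\<lambda>w. if norm (X0 w) \<le> real j then 1 else 0 :: real"
  have i: "integrable M (\<lambda>w. norm (X w) ^ 4)" "integrable M (\<lambda>w. norm (X0 w) ^ 4)"
    "integrable M (\<lambda>w. norm (X w - X0 w) ^ 4)"
    by (intro Lspace_integrable X X0 L4_diff)+
  have ip: "integrable M (\<lambda>w. trunc_cube X0 j w \<bullet> (X w - X0 w))"
    by (intro pairing_integrable trunc_cube_L2 Lspace_measurable[OF X0] L4_imp_L2 L4_diff X X0)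
  have it: "integrable M (\<lambda>w. (1 - ?b w) * norm (X0 w) ^ 4)"
    using tail4_integrable[OF X0, of j] by (rule back_subst) (auto intro!: arg_cong[where f = "integrable M"])
  have "(\<integral>w. ?c1 * norm (X w - X0 w) ^ 4 - ?c2 * ((t - t0)\<^sup>2 * norm (X0 w) ^ 4) - ?c3 * ((1 - ?b w) * norm (X0 w) ^ 4) \<partial>M)
    \<le> (\<integral>w. exp (l * t) * norm (X w) ^ 4 - exp (l * t0) * norm (X0 w) ^ 4 * (1 + l * (t - t0))
      - 4 * exp (l * t0) * (trunc_cube X0 j w \<bullet> (X w - X0 w)) \<partial>M)"
  proof (rule integral_mono)
    fix w
    show "?c1 * norm (X w - X0 w) ^ 4 - ?c2 * ((t - t0)\<^sup>2 * norm (X0 w) ^ 4) - ?c3 * ((1 - ?b w) * norm (X0 w) ^ 4)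
      \<le> exp (l * t) * norm (X w) ^ 4 - exp (l * t0) * norm (X0 w) ^ 4 * (1 + l * (t - t0))
      - 4 * exp (l * t0) * (trunc_cube X0 j w \<bullet> (X w - X0 w))"
      using penalty_pointwise[OF t l, of "?b w" "X w" "X0 w"] by (simp add: trunc_cube_def)
  qed (use i ip it in auto)
  also have "\<dots> = penalty l t0 X0 j t X"
    using i ip by (simp add: penalty_def pairing_def)
  finally have "(\<integral>w. ?c1 * norm (X w - X0 w) ^ 4 - ?c2 * ((t - t0)\<^sup>2 * norm (X0 w) ^ 4) - ?c3 * ((1 - ?b w) * norm (X0 w) ^ 4) \<partial>M)
    \<le> penalty l t0 X0 j t X" .
  moreover have "(\<integral>w. ?c1 * norm (X w - X0 w) ^ 4 - ?c2 * ((t - t0)\<^sup>2 * norm (X0 w) ^ 4) - ?c3 * ((1 - ?b w) * norm (X0 w) ^ 4) \<partial>M)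
    = ?c1 * (\<integral>w. norm (X w - X0 w) ^ 4 \<partial>M) - ?c2 * ((t - t0)\<^sup>2 * (\<integral>w. norm (X0 w) ^ 4 \<partial>M))
      - ?c3 * (\<integral>w. (1 - ?b w) * norm (X0 w) ^ 4 \<partial>M)"
    using i it by simp
  moreover have "(\<integral>w. (1 - ?b w) * norm (X0 w) ^ 4 \<partial>M) = tail4 X0 j"
    unfolding tail4_def by (intro Bochner_Integration.integral_cong) auto
  ultimately show ?thesis by simp
qed

end

section \<open>Minimisers of the approximating problems\<close>

text \<open>The modified test function: \<open>c\<close> and \<open>h_mod\<close> carry the derivatives in \<open>t\<close> and in \<open>X\<close> at
  \<open>(t0, X0)\<close> of the extra term \<open>e\<^sup>\<lambda>\<^sup>t E|X|\<^sup>4\<close>.\<close>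

definition phi_mod :: "(real \<Rightarrow> real) \<Rightarrow> real \<Rightarrow> real \<Rightarrow> real \<Rightarrow> real \<Rightarrow> real" where
  "phi_mod \<phi> c t0 K s = \<phi> s + c * (s - t0) - K * (s - t0)\<^sup>2"

context prob_space
begin

definition h_mod :: "('a \<Rightarrow> 'b::euclidean_space) \<Rightarrow> real \<Rightarrow> real \<Rightarrow> ('a \<Rightarrow> 'b) \<Rightarrow> nat \<Rightarrow> 'a \<Rightarrow> 'b" where
  "h_mod h l t0 X0 j w = h w + (4 * exp (l * t0)) *\<^sub>R trunc_cube X0 j w"

lemma h_mod_L2: "h \<in> Lspace M 2 \<Longrightarrow> X0 \<in> Lspace M 4 \<Longrightarrow> h_mod h l t0 X0 j \<in> Lspace M 2"
  unfolding h_mod_def[abs_def] by (intro L2_add L2_scale trunc_cube_L2 Lspace_measurable)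

lemma cost_tilt:
  assumes "h \<in> Lspace M 2" "k \<in> Lspace M 2" "X \<in> Lspace M 2"
  shows "cost U V Y \<theta> (\<lambda>w. h w - k w) a l t X = cost U V Y \<theta> h a l t X + pairing M k X"
  using assms by (simp add: cost_def pairing_diff_left)

text \<open>The bookkeeping behind the modified test function: apart from the last summand, which
  does not depend on \<open>(t, X)\<close> and so leaves minimisers alone, exactly the penalty and
  the square in time are added.\<close>

lemma cost_mod:
  fixes X X0 :: "'a \<Rightarrow> 'b::euclidean_space"
  assumes h: "h \<in> Lspace M 2" and X: "X \<in> Lspace M 2" and X0: "X0 \<in> Lspace M 4"
  shows "cost U V Y (phi_mod \<phi> (l * exp (l * t0) * (\<integral>w. norm (X0 w) ^ 4 \<partial>M)) t0 K) (h_mod h l t0 X0 j) (a + 1) l t X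
    = cost U V Y \<phi> h a l t X + penalty l t0 X0 j t X + K * (t - t0)\<^sup>2
      + exp (l * t0) * ((\<integral>w. norm (X0 w) ^ 4 \<partial>M) - 4 * pairing M (trunc_cube X0 j) X0)"
proof -
  have g: "trunc_cube X0 j \<in> Lspace M 2" using X0 by (intro trunc_cube_L2 Lspace_measurable)
  have 1: "pairing M (h_mod h l t0 X0 j) X = pairing M h X + 4 * exp (l * t0) * pairing M (trunc_cube X0 j) X"
    unfolding h_mod_def[abs_def] using h X g by (simp add: pairing_add_left L2_scale pairing_scale_left)
  have 2: "pairing M (trunc_cube X0 j) (\<lambda>w. X w - X0 w) = pairing M (trunc_cube X0 j) X - pairing M (trunc_cube X0 j) X0"
    by (rule pairing_diff_right[OF X L4_imp_L2[OF X0] g])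
  show ?thesis unfolding cost_def penalty_def phi_mod_def 1 2 by (simp add: algebra_simps)
qed

lemma penalty_self: "penalty l t0 X0 j t0 X0 = 0"
  by (simp add: penalty_def pairing_def)

lemma pair_sol_diff_le:
  fixes U U' :: "'b::euclidean_space sol"
  assumes U: "continuous_map (sol_space T) euclidean U" "linear_growth T C U"
    and U': "continuous_map (sol_space T) euclidean U'" "linear_growth T C U'"
    and V: "V \<in> Lspace M 2" and Y: "Y \<in> Lspace M 2" and t: "t \<in> {0..T}" and X: "X \<in> Lspace M 2"
  shows "\<bar>pair_sol U V Y t X - pair_sol U' V Y t X\<bar>
    \<le> l2_norm M (\<lambda>w. lift_sol M U t X w - lift_sol M U' t X w) * (l2_norm M X + l2_norm M Y)"
proof -
  note L = lift_sol_L2[OF U t X] lift_sol_L2[OF U' t X]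
  have XY: "(\<lambda>w. X w - Y w) \<in> Lspace M 2" using X Y by (rule L2_diff)
  have "pair_sol U V Y t X - pair_sol U' V Y t X
      = pairing M (\<lambda>w. lift_sol M U t X w - lift_sol M U' t X w) (\<lambda>w. X w - Y w)"
    unfolding pair_sol_def using L V XY by (simp add: pairing_diff_left)
  then have "\<bar>pair_sol U V Y t X - pair_sol U' V Y t X\<bar>
      \<le> l2_norm M (\<lambda>w. lift_sol M U t X w - lift_sol M U' t X w) * l2_norm M (\<lambda>w. X w - Y w)"
    using pairing_le_l2_norm[OF L2_diff[OF L] XY] by simp
  also have "\<dots> \<le> l2_norm M (\<lambda>w. lift_sol M U t X w - lift_sol M U' t X w) * (l2_norm M X + l2_norm M Y)"
    using l2_norm_triangle_diff[OF X L2_const[of 0] Y] l2_norm_minus_commute[of "\<lambda>w. 0" Y]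
    by (intro mult_left_mono) auto
  finally show ?thesis .
qed

text \<open>Coercivity, uniform over solutions with the same growth constant and over tilts of norm
  at most 1. \<open>K2\<close> collects the coefficients of the second moment, coming from the
  pairing with the solution, from \<open>h\<close> and from \<open>k\<close>; half of the quartic
  term absorbs them.\<close>

lemma cost_lower_bound:
  fixes U :: "'b::euclidean_space sol"
  assumes U: "continuous_map (sol_space T) euclidean U" and gr: "linear_growth T C U" and C: "C \<ge> 0"
    and V: "V \<in> Lspace M 2" and Y: "Y \<in> Lspace M 2" and h: "h \<in> Lspace M 2"
    and a: "a > 0" and l: "l \<ge> 0" and s: "s \<in> {0..T}" and Z: "Z \<in> Lspace M 4"
    and \<phi>: "\<phi> s \<le> b" and k: "k \<in> Lspace M 2" "l2_norm M k \<le> 1"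
  defines "K2 \<equiv> 12 * C\<^sup>2 + 3 + l2_norm M h"
  shows "cost U V Y \<phi> h a l s Z + pairing M k Z \<ge> a / 2 * (\<integral>w. norm (Z w) ^ 4 \<partial>M)
    - (6 * C\<^sup>2 + 2 * (l2_norm M V)\<^sup>2 + 2 * (l2_norm M Y)\<^sup>2 + b + l2_norm M h + 1 + 2 * K2\<^sup>2 / a)"
proof -
  note Z2 = L4_imp_L2[OF Z]
  define m2 m4 where "m2 = (\<integral>w. norm (Z w) ^ 2 \<partial>M)" and "m4 = (\<integral>w. norm (Z w) ^ 4 \<partial>M)"
  have nn: "m4 \<ge> 0" "m2 \<ge> 0" by (simp_all add: m4_def m2_def Bochner_Integration.integral_nonneg)
  have K2: "K2 > 0" unfolding K2_def by (intro add_nonneg_pos add_pos_nonneg) (auto intro: add_nonneg_pos)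
  have Zn: "l2_norm M Z \<le> 1 + m2"
    using le_one_plus_square[of "l2_norm M Z"] by (simp add: m2_def l2_norm_square_integral)
  have hZ: "\<bar>pairing M h Z\<bar> \<le> l2_norm M h + l2_norm M h * m2"
    using pairing_le_l2_norm[OF h Z2] mult_left_mono[OF Zn, of "l2_norm M h"] by (simp add: algebra_simps)
  have kZ: "\<bar>pairing M k Z\<bar> \<le> 1 + m2"
    using pairing_le_l2_norm[OF k(1) Z2] mult_right_mono[OF k(2), of "l2_norm M Z"] Zn by simp
  \<comment> \<open>With this weight, multiplication by \<open>K2\<close> leaves exactly
    \<open>a / 2\<close> in front of the fourth moment.\<close>
  have "m2 \<le> 1 / (a / (2 * K2)) + a / (2 * K2) * m4"
    unfolding m2_def m4_def using a K2 by (intro second_moment_le Z) simp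
  then have "K2 * m2 \<le> K2 * (1 / (a / (2 * K2)) + a / (2 * K2) * m4)" using K2 by (intro mult_left_mono) auto
  also have "\<dots> = 2 * K2\<^sup>2 / a + a / 2 * m4" using K2 a by (simp add: field_simps power2_eq_square)
  finally have K2m: "K2 * m2 \<le> 2 * K2\<^sup>2 / a + a / 2 * m4" .
  have "1 * m4 \<le> exp (l * s) * m4" using nn l s by (intro mult_right_mono) auto
  then have "a * m4 \<le> a * exp (l * s) * m4" using a by simp
  moreover have "K2 * m2 = (12 * C\<^sup>2 + 2) * m2 + l2_norm M h * m2 + m2" by (simp add: K2_def algebra_simps)
  ultimately show ?thesis
    using pair_sol_bound[OF U gr C s Z2 V Y] hZ kZ K2m \<phi>
    unfolding cost_def m2_def[symmetric] m4_def[symmetric] by linarith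
qed

text \<open>The value at the new minimum is compared with that at \<open>(t0, X0)\<close>, where the
  penalty vanishes. Minimality of \<open>(t0, X0)\<close> for \<open>W\<close> then bounds E|X -
  X0|^4 and (t - t0)^2 by the truncation tail, the distance of \<open>Ws n\<close> from
  \<open>W\<close>, and the tilt. \<open>K\<close> and the moment ball are fixed before the
  truncation index, so one ball serves for all \<open>j\<close>.\<close>

lemma approximate_minima:
  fixes W :: "'b::euclidean_space sol"
  assumes cont: "\<And>n. continuous_map (sol_space T) euclidean (Ws n)"
    and lim: "locally_uniform_limit (sol_space T) Ws W"
    and gr: "\<And>n. linear_growth T C (Ws n)" and C: "C \<ge> 0"
    and V: "V \<in> Lspace M 2" and Y: "Y \<in> Lspace M 2" and h: "h \<in> Lspace M 2"
    and \<phi>: "\<And>\<tau>. 0 < \<tau> \<Longrightarrow> \<tau> < T \<Longrightarrow> continuous_on {0..\<tau>} \<phi>" and a: "a > 0" and l: "l > 0"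
    and t0: "t0 \<in> {0<..<T}" and X0: "X0 \<in> Lspace M 4"
    and min: "\<And>s Z. s \<in> {0..<T} \<Longrightarrow> Z \<in> Lspace M 4 \<Longrightarrow> cost W V Y \<phi> h a l t0 X0 \<le> cost W V Y \<phi> h a l s Z"
  defines "c \<equiv> l * exp (l * t0) * (\<integral>w. norm (X0 w) ^ 4 \<partial>M)"
  obtains K n k t X where "\<And>j. n j \<ge> j" "\<And>j. k j \<in> Lspace M 2" "(\<lambda>j. l2_norm M (k j)) \<longlonglongrightarrow> 0"
    "\<And>j. t j \<in> {0..<T}" "t \<longlonglongrightarrow> t0" "\<And>j. X j \<in> Lspace M 4"
    "(\<lambda>j. \<integral>w. norm (X j w - X0 w) ^ 4 \<partial>M) \<longlonglongrightarrow> 0"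
    "\<And>j s Z. s \<in> {0..<T} \<Longrightarrow> Z \<in> Lspace M 4 \<Longrightarrow>
      cost (Ws (n j)) V Y (phi_mod \<phi> c t0 K) (\<lambda>w. h_mod h l t0 X0 j w - k j w) (a + 1) l (t j) (X j)
      \<le> cost (Ws (n j)) V Y (phi_mod \<phi> c t0 K) (\<lambda>w. h_mod h l t0 X0 j w - k j w) (a + 1) l s Z"
proof -
  have contW: "continuous_map (sol_space T) euclidean W" by (rule sol_space_limit_continuous[OF cont lim])
  have grW: "linear_growth T C W" by (rule linear_growth_limit[OF gr lim])
  note X02 = L4_imp_L2[OF X0]
  define E where "E = (\<integral>w. norm (X0 w) ^ 4 \<partial>M)"
  have E0: "E \<ge> 0" by (simp add: E_def Bochner_Integration.integral_nonneg)
  have t0T: "t0 \<in> {0..T}" "t0 \<in> {0..<T}" "0 \<le> t0" "t0 \<le> T" using t0 by auto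
  define P where "P = 6 * C\<^sup>2 + 2 * (l2_norm M V)\<^sup>2 + 2 * (l2_norm M Y)\<^sup>2"
  \<comment> \<open>An upper bound for \<open>\<phi>\<close> on all of [0, T) is not part of the
    test data, which allow bad behaviour near \<open>T\<close>. It follows from minimality, by
    comparison with the random vector 0.\<close>
  define b where "b = P - cost W V Y \<phi> h a l t0 X0"
  have b: "\<phi> s \<le> b" if s: "s \<in> {0..<T}" for s
  proof -
    have 0: "(\<lambda>w. 0) \<in> (Lspace M 4 :: ('a \<Rightarrow> 'b) set)" by (simp add: Lspace_iff)
    have "s \<in> {0..T}" using s by auto
    then have "\<bar>pair_sol W V Y s (\<lambda>w. 0)\<bar> \<le> P"
      using pair_sol_bound[OF contW grW C _ L2_const V Y, of s 0] by (simp add: P_def)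
    then show ?thesis using min[OF s 0] by (simp add: b_def cost_def pairing_def)
  qed
  define K2 where "K2 = 12 * C\<^sup>2 + 3 + l2_norm M h"
  define B0 where "B0 = P + b + l2_norm M h + 1 + 2 * K2\<^sup>2 / a"
  have low: "cost (Ws n) V Y \<phi> h a l s Z + pairing M k Z \<ge> a / 2 * (\<integral>w. norm (Z w) ^ 4 \<partial>M) - B0"
    if "s \<in> {0..<T}" "Z \<in> Lspace M 4" "k \<in> Lspace M 2" "l2_norm M k \<le> 1" for n s Z k
    using cost_lower_bound[where \<phi> = \<phi>, OF cont gr C V Y h a less_imp_le[OF l] _ that(2) b[OF that(1)] that(3,4)] that(1)
    unfolding B0_def P_def K2_def by auto
  define B1 where "B1 = (12 * C\<^sup>2 + 2) * (\<integral>w. norm (X0 w) ^ 2 \<partial>M) + P - (\<phi> t0 + pairing M h X0)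
      + a * exp (l * t0) * E + l2_norm M X0"
  have up: "cost (Ws n) V Y \<phi> h a l t0 X0 + pairing M k X0 \<le> B1"
    if "k \<in> Lspace M 2" "l2_norm M k \<le> 1" for n k
    using pair_sol_bound[OF cont gr C t0T(1) X02 V Y, of n] pairing_le_l2_norm[OF that(1) X02]
      mult_right_mono[OF that(2), of "l2_norm M X0"]
    unfolding B1_def P_def cost_def E_def by simp
  define c1 c2 c3 where "c1 = exp (- (l * T)) / 6"
    and "c2 = 4 * l\<^sup>2 * exp (l * T) ^ 3 / exp (- (l * T))" and "c3 = 4 * exp (l * T) ^ 3 / exp (- (l * T))"
  have c13: "c1 > 0" "c3 \<ge> 0" by (simp_all add: c1_def c3_def)
  define \<tau> where "\<tau> = (t0 + T) / 2"
  have \<tau>: "t0 < \<tau>" "\<tau> < T" "0 < \<tau>" using t0 by (auto simp: \<tau>_def)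
  \<comment> \<open>\<open>G\<close> is the excess needed to outweigh \<open>B0\<close>, the tail
    and \<open>B1\<close>. \<open>Kp\<close> provides it for times beyond \<open>\<tau>\<close>, and
    \<open>R\<close> for fourth moments beyond the ball; the part \<open>c2 * E\<close> of
    \<open>K\<close> cancels the time error in the lower bound of the penalty.\<close>
  define G where "G = \<bar>B0\<bar> + c3 * E + \<bar>B1\<bar> + 1"
  have G: "G \<ge> 1" using c13 E0 by (simp add: G_def)
  define Kp where "Kp = 1 + G / (\<tau> - t0)\<^sup>2"
  have Kp: "Kp \<ge> 1" using G by (simp add: Kp_def)
  define K where "K = c2 * E + Kp"
  define R where "R = E + 2 / a * G"
  have R: "R \<ge> 0" "E \<le> R" using E0 G a by (auto simp: R_def)
  have X0R: "X0 \<in> moment_ball R" using X0 R by (simp add: moment_ball_def E_def)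
  define \<kappa> where "\<kappa> j = exp (l * t0) * (E - 4 * pairing M (trunc_cube X0 j) X0)" for j
  define \<Psi> where "\<Psi> n j s Z = cost (Ws n) V Y (phi_mod \<phi> c t0 K) (h_mod h l t0 X0 j) (a + 1) l s Z" for n j s Z
  have \<Psi>eq: "\<Psi> n j s Z = cost (Ws n) V Y \<phi> h a l s Z + penalty l t0 X0 j s Z + K * (s - t0)\<^sup>2 + \<kappa> j"
    if "Z \<in> Lspace M 4" for n j s Z
    using cost_mod[OF h L4_imp_L2[OF that] X0] unfolding \<Psi>_def c_def \<kappa>_def E_def by blast
  have \<Psi>0: "\<Psi> n j t0 X0 = cost (Ws n) V Y \<phi> h a l t0 X0 + \<kappa> j" for n j
    using \<Psi>eq[OF X0] by (simp add: penalty_self)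
  have star: "\<Psi> n j s Z \<ge> cost (Ws n) V Y \<phi> h a l s Z + c1 * (\<integral>w. norm (Z w - X0 w) ^ 4 \<partial>M)
      + Kp * (s - t0)\<^sup>2 - c3 * tail4 X0 j + \<kappa> j" if "s \<in> {0..<T}" "Z \<in> Lspace M 4" for n j s Z
  proof -
    have s: "0 \<le> s" "s \<le> T" using that by auto
    have "K * (s - t0)\<^sup>2 = c2 * ((s - t0)\<^sup>2 * E) + Kp * (s - t0)\<^sup>2" by (simp add: K_def algebra_simps)
    then show ?thesis
      using penalty_lower_bound[OF that(2) X0 s t0T(3,4) less_imp_le[OF l], of j] \<Psi>eq[OF that(2), of n j s]
      unfolding c1_def c2_def c3_def E_def by linarith
  qed
  define \<epsilon> where "\<epsilon> j = 1 / real (Suc j)" for j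
  have \<epsilon>: "0 < \<epsilon> j" "\<epsilon> j \<le> 1" for j by (auto simp: \<epsilon>_def)
  \<comment> \<open>Per unit of \<open>\<epsilon> j\<close>: the error of replacing
    \<open>Ws n\<close> by \<open>W\<close> and the size of the tilt, each counted at the minimum
    and at \<open>(t0, X0)\<close>.\<close>
  define cc where "cc = 2 * (1 + R + l2_norm M Y) + 2 * (1 + R)"
  have cc: "cc \<ge> 0" using R by (simp add: cc_def)
  define good where "good j n k t X \<longleftrightarrow> n \<ge> j \<and> k \<in> Lspace M 2 \<and> l2_norm M k \<le> \<epsilon> j \<and> t \<in> {0..<T} \<and> X \<in> Lspace M 4
      \<and> c1 * (\<integral>w. norm (X w - X0 w) ^ 4 \<partial>M) + Kp * (t - t0)\<^sup>2 \<le> c3 * tail4 X0 j + \<epsilon> j * cc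
      \<and> (\<forall>s\<in>{0..<T}. \<forall>Z\<in>Lspace M 4. \<Psi> n j t X + pairing M k X \<le> \<Psi> n j s Z + pairing M k Z)"
    for j n k t X
  have "\<exists>n k t X. good j n k t X" for j
  proof -
    have "\<forall>\<^sub>F n in sequentially. (\<forall>t\<in>{0..T}. \<forall>X\<in>Lspace M 4. (\<integral>w. norm (X w) ^ 4 \<partial>M) \<le> R \<longrightarrow>
        l2_norm M (\<lambda>w. lift_sol M (Ws n) t X w - lift_sol M W t X w) \<le> \<epsilon> j) \<and> n \<ge> j"
      by (intro eventually_conj lift_sol_uniform[OF cont lim gr C \<epsilon>(1)] eventually_ge_at_top)
    then obtain n where n: "n \<ge> j" and close: "\<And>t X. t \<in> {0..T} \<Longrightarrow> X \<in> moment_ball R \<Longrightarrow>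
        l2_norm M (\<lambda>w. lift_sol M (Ws n) t X w - lift_sol M W t X w) \<le> \<epsilon> j"
      unfolding moment_ball_def by (auto simp: eventually_sequentially)
    have lvl: "X \<in> Lspace M 4" "X \<in> Lspace M 2" "l2_norm M X \<le> 1 + R" if "X \<in> moment_ball R" for X :: "'a \<Rightarrow> 'b"
      using that L4_imp_L2 l2_norm_le_L4 by (auto simp: moment_ball_def)
    have cl: "\<bar>cost (Ws n) V Y \<phi> h a l t X - cost W V Y \<phi> h a l t X\<bar> \<le> \<epsilon> j * (1 + R + l2_norm M Y)"
      if tX: "t \<in> {0..T}" "X \<in> moment_ball R" for t X
    proof -
      have "cost (Ws n) V Y \<phi> h a l t X - cost W V Y \<phi> h a l t X = pair_sol (Ws n) V Y t X - pair_sol W V Y t X"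
        by (simp add: cost_def)
      then have "\<bar>cost (Ws n) V Y \<phi> h a l t X - cost W V Y \<phi> h a l t X\<bar>
          \<le> l2_norm M (\<lambda>w. lift_sol M (Ws n) t X w - lift_sol M W t X w) * (l2_norm M X + l2_norm M Y)"
        using pair_sol_diff_le[OF cont gr contW grW V Y tX(1) lvl(2)[OF tX(2)]] by simp
      also have "\<dots> \<le> \<epsilon> j * (1 + R + l2_norm M Y)"
        using close[OF tX] lvl(3)[OF tX(2)] \<epsilon>(1)[of j] by (intro mult_mono) auto
      finally show ?thesis .
    qed
    have cont_mod: "continuous_on {0..\<tau>} (phi_mod \<phi> c t0 K)"
      unfolding phi_mod_def[abs_def] by (intro continuous_intros \<phi> \<tau>)
    have a1: "a + 1 \<ge> 0" using a by simp
    obtain k t X where k: "k \<in> Lspace M 2" "l2_norm M k \<le> \<epsilon> j" and tX: "t \<in> {0..\<tau>}" "X \<in> moment_ball R"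
      and m: "\<And>s Z. s \<in> {0..\<tau>} \<Longrightarrow> Z \<in> moment_ball R \<Longrightarrow> \<Psi> n j t X + pairing M k X \<le> \<Psi> n j s Z + pairing M k Z"
      unfolding \<Psi>_def
      by (rule perturbed_minimum[OF cont[of n] gr[of n] C V Y h_mod_L2[OF h X0, of l t0 j] less_imp_le[OF \<tau>(3)]
            less_imp_le[OF \<tau>(2)] cont_mod a1 R(1) \<epsilon>(1)[of j], where l = l]) blast
    have k1: "l2_norm M k \<le> 1" using k(2) \<epsilon>(2)[of j] by linarith
    have tT: "t \<in> {0..<T}" "t \<in> {0..T}" using tX(1) \<tau> by auto
    have X4: "X \<in> Lspace M 4" by (rule lvl(1)[OF tX(2)])
    have t0\<tau>: "t0 \<in> {0..\<tau>}" using t0 \<tau> by auto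
    have tail: "c3 * tail4 X0 j \<le> c3 * E"
      using tail4_le(2)[OF X0, of j] c13 unfolding E_def by (intro mult_left_mono) auto
    \<comment> \<open>Outside the compact time interval or the moment ball the value is at least
      \<open>B1 + \<kappa> j\<close>, which already bounds the value at \<open>(t0, X0)\<close> from
      above. Hence the minimum is global.\<close>
    have glob: "\<Psi> n j t X + pairing M k X \<le> \<Psi> n j s Z + pairing M k Z"
      if sZ: "s \<in> {0..<T}" "Z \<in> Lspace M 4" for s Z
    proof (cases "s \<in> {0..\<tau>} \<and> Z \<in> moment_ball R")
      case True
      then show ?thesis using m by blast
    next
      case False
      have Z4: "0 \<le> a / 2 * (\<integral>w. norm (Z w) ^ 4 \<partial>M)" "0 \<le> c1 * (\<integral>w. norm (Z w - X0 w) ^ 4 \<partial>M)" "0 \<le> Kp * (s - t0)\<^sup>2"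
        using a c13 Kp by (auto intro!: mult_nonneg_nonneg Bochner_Integration.integral_nonneg)
      have "a / 2 * (\<integral>w. norm (Z w) ^ 4 \<partial>M) + Kp * (s - t0)\<^sup>2 \<ge> G"
      proof (cases "s \<in> {0..\<tau>}")
        case True
        then have "(\<integral>w. norm (Z w) ^ 4 \<partial>M) \<ge> 2 / a * G"
          using False sZ E0 unfolding moment_ball_def R_def by auto
        then have "a / 2 * (\<integral>w. norm (Z w) ^ 4 \<partial>M) \<ge> a / 2 * (2 / a * G)" using a by (intro mult_left_mono) auto
        then show ?thesis using Z4(3) a by simp
      next
        case False
        then have "s - t0 \<ge> \<tau> - t0" using sZ by auto
        then have "(s - t0)\<^sup>2 \<ge> (\<tau> - t0)\<^sup>2" using \<tau> by (intro power_mono) auto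
        then have "G / (\<tau> - t0)\<^sup>2 * (s - t0)\<^sup>2 \<ge> G / (\<tau> - t0)\<^sup>2 * (\<tau> - t0)\<^sup>2" using G by (intro mult_left_mono) auto
        moreover have "G / (\<tau> - t0)\<^sup>2 * (\<tau> - t0)\<^sup>2 = G" using \<tau> by simp
        moreover have "Kp * (s - t0)\<^sup>2 = (s - t0)\<^sup>2 + G / (\<tau> - t0)\<^sup>2 * (s - t0)\<^sup>2" by (simp add: Kp_def algebra_simps)
        ultimately show ?thesis using Z4(1) zero_le_power2[of "s - t0"] by linarith
      qed
      then have "\<Psi> n j s Z + pairing M k Z \<ge> B1 + \<kappa> j"
        using star[OF sZ, of n j] low[OF sZ k(1) k1, of n] Z4(2) tail unfolding G_def by linarith
      moreover have "\<Psi> n j t X + pairing M k X \<le> B1 + \<kappa> j"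
        using m[OF t0\<tau> X0R] \<Psi>0[of n j] up[OF k(1) k1, of n] by linarith
      ultimately show ?thesis by linarith
    qed
    have "c1 * (\<integral>w. norm (X w - X0 w) ^ 4 \<partial>M) + Kp * (t - t0)\<^sup>2 \<le> c3 * tail4 X0 j + \<epsilon> j * cc"
    proof -
      have kb: "\<bar>pairing M k Z\<bar> \<le> \<epsilon> j * (1 + R)" if "Z \<in> moment_ball R" for Z
      proof -
        have "\<bar>pairing M k Z\<bar> \<le> l2_norm M k * l2_norm M Z" by (intro pairing_le_l2_norm k lvl that)
        also have "\<dots> \<le> \<epsilon> j * (1 + R)" using k(2) lvl(3)[OF that] \<epsilon>(1)[of j] by (intro mult_mono) auto
        finally show ?thesis .
      qed
      have "\<Psi> n j t X + pairing M k X \<le> cost (Ws n) V Y \<phi> h a l t0 X0 + \<kappa> j + pairing M k X0"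
        using m[OF t0\<tau> X0R] \<Psi>0[of n j] by linarith
      then have "c1 * (\<integral>w. norm (X w - X0 w) ^ 4 \<partial>M) + Kp * (t - t0)\<^sup>2
          \<le> c3 * tail4 X0 j + 2 * (\<epsilon> j * (1 + R + l2_norm M Y)) + 2 * (\<epsilon> j * (1 + R))"
        using star[OF tT(1) X4, of n j] cl[OF tT(2) tX(2)] cl[OF t0T(1) X0R] min[OF tT(1) X4] kb[OF tX(2)] kb[OF X0R]
        by linarith
      then show ?thesis by (simp add: cc_def algebra_simps)
    qed
    then have "good j n k t X" unfolding good_def using n k tT(1) X4 glob by blast
    then show ?thesis by blast
  qed
  then obtain n k t X where good: "\<And>j. good j (n j) (k j) (t j) (X j)" by metis
  have \<epsilon>lim: "\<epsilon> \<longlonglongrightarrow> 0" unfolding \<epsilon>_def using LIMSEQ_inverse_real_of_nat by (simp add: inverse_eq_divide)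
  have "(\<lambda>j. c3 * tail4 X0 j + \<epsilon> j * cc) \<longlonglongrightarrow> c3 * 0 + 0 * cc"
    by (intro tendsto_intros tail4_tendsto X0 \<epsilon>lim)
  then have e: "(\<lambda>j. c3 * tail4 X0 j + \<epsilon> j * cc) \<longlonglongrightarrow> 0" by simp
  have D0: "0 \<le> (\<integral>w. norm (X j w - X0 w) ^ 4 \<partial>M)" for j by (simp add: Bochner_Integration.integral_nonneg)
  have gb: "c1 * (\<integral>w. norm (X j w - X0 w) ^ 4 \<partial>M) \<le> c3 * tail4 X0 j + \<epsilon> j * cc"
    "(t j - t0)\<^sup>2 \<le> c3 * tail4 X0 j + \<epsilon> j * cc" for j
  proof -
    have "1 * (t j - t0)\<^sup>2 \<le> Kp * (t j - t0)\<^sup>2" using Kp by (intro mult_right_mono) auto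
    moreover have "0 \<le> c1 * (\<integral>w. norm (X j w - X0 w) ^ 4 \<partial>M)" using c13 D0 by simp
    ultimately show "c1 * (\<integral>w. norm (X j w - X0 w) ^ 4 \<partial>M) \<le> c3 * tail4 X0 j + \<epsilon> j * cc"
      "(t j - t0)\<^sup>2 \<le> c3 * tail4 X0 j + \<epsilon> j * cc"
      using good[of j] zero_le_power2[of "t j - t0"] unfolding good_def by linarith+
  qed
  show thesis
  proof (rule that[of n k t X K])
    show "(\<lambda>j. l2_norm M (k j)) \<longlonglongrightarrow> 0"
      by (rule tendsto_sandwich[OF _ _ tendsto_const \<epsilon>lim]) (use good in \<open>auto simp: good_def\<close>)
    have "(\<lambda>j. (t j - t0)\<^sup>2) \<longlonglongrightarrow> 0"
      by (rule tendsto_sandwich[OF _ _ tendsto_const e]) (use gb(2) in auto)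
    then have "(\<lambda>j. sqrt ((t j - t0)\<^sup>2)) \<longlonglongrightarrow> sqrt 0" by (rule tendsto_real_sqrt)
    then show "t \<longlonglongrightarrow> t0" using tendsto_rabs_zero_cancel LIM_zero_cancel by force
    have "(\<lambda>j. c1 * (\<integral>w. norm (X j w - X0 w) ^ 4 \<partial>M)) \<longlonglongrightarrow> 0"
      by (rule tendsto_sandwich[OF _ _ tendsto_const e]) (use gb(1) c13 D0 in auto)
    then have "(\<lambda>j. (c1 * (\<integral>w. norm (X j w - X0 w) ^ 4 \<partial>M)) / c1) \<longlonglongrightarrow> 0 / c1"
      using c13 by (intro tendsto_divide tendsto_const) auto
    then show "(\<lambda>j. \<integral>w. norm (X j w - X0 w) ^ 4 \<partial>M) \<longlonglongrightarrow> 0" using c13 by simp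
    fix j
    show "n j \<ge> j" "k j \<in> Lspace M 2" "t j \<in> {0..<T}" "X j \<in> Lspace M 4"
      using good[of j] by (auto simp: good_def)
    then have kj: "k j \<in> Lspace M 2" and Xj: "X j \<in> Lspace M 4" by blast+
    fix s :: real and Z :: "'a \<Rightarrow> 'b" assume sZ: "s \<in> {0..<T}" "Z \<in> Lspace M 4"
    have "\<Psi> (n j) j (t j) (X j) + pairing M (k j) (X j) \<le> \<Psi> (n j) j s Z + pairing M (k j) Z"
      using good[of j] sZ unfolding good_def by blast
    then show "cost (Ws (n j)) V Y (phi_mod \<phi> c t0 K) (\<lambda>w. h_mod h l t0 X0 j w - k j w) (a + 1) l (t j) (X j)
      \<le> cost (Ws (n j)) V Y (phi_mod \<phi> c t0 K) (\<lambda>w. h_mod h l t0 X0 j w - k j w) (a + 1) l s Z"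
      unfolding \<Psi>_def cost_tilt[OF h_mod_L2[OF h X0] kj L4_imp_L2[OF Xj]]
        cost_tilt[OF h_mod_L2[OF h X0] kj L4_imp_L2[OF sZ(2)]] .
  qed
qed

section \<open>Passage to the limit\<close>

lemma test_fun_eq:
  assumes "X \<in> Lspace M 4"
  shows "test_fun M \<phi> h a l t X = ereal (\<phi> t + pairing M h X - a * exp (l * t) * (\<integral>w. norm (X w) ^ 4 \<partial>M))"
  using E_rv_eq_integral[OF Lspace_integrable[OF assms]]
  by (simp add: test_fun_def enn2ereal_ennreal Bochner_Integration.integral_nonneg)

lemma penalized_eq:
  assumes "X \<in> Lspace M 4"
  shows "penalized M U V Y (test_fun M \<phi> h a l) t X = ereal (cost U V Y \<phi> h a l t X)"
  using test_fun_eq[OF assms] by (simp add: penalized_def cost_def pair_sol_def algebra_simps)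

lemma penalized_eq_infinity:
  assumes X: "X \<in> Lspace M 2" "X \<notin> Lspace M 4" and a: "a > 0"
  shows "penalized M U V Y (test_fun M \<phi> h a l) t X = \<infinity>"
proof -
  have "E_rv M 4 X = \<infinity>" using X by (auto simp: Lspace_def less_top[symmetric])
  then have "test_fun M \<phi> h a l t X = - \<infinity>"
    using a by (simp add: test_fun_def)
  then show ?thesis by (simp add: penalized_def)
qed

text \<open>On L^4 the extended real values are finite and agree with the cost; at other points of
  L^2 the value is \<infinity> and imposes nothing.\<close>

lemma penalized_minimum_iff:
  assumes X: "X \<in> Lspace M 4" and a: "a > 0"
  shows "(\<forall>s\<in>{0..<T}. \<forall>Z\<in>Lspace M 2. penalized M U V Y (test_fun M \<phi> h a l) t X
      \<le> penalized M U V Y (test_fun M \<phi> h a l) s Z)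
    \<longleftrightarrow> (\<forall>s\<in>{0..<T}. \<forall>Z\<in>Lspace M 4. cost U V Y \<phi> h a l t X \<le> cost U V Y \<phi> h a l s Z)"
    (is "?L \<longleftrightarrow> ?R")
proof
  assume L: ?L
  show ?R
  proof (intro ballI)
    fix s and Z :: "'a \<Rightarrow> 'b" assume s: "s \<in> {0..<T}" and Z: "Z \<in> Lspace M 4"
    have "penalized M U V Y (test_fun M \<phi> h a l) t X \<le> penalized M U V Y (test_fun M \<phi> h a l) s Z"
      using L s L4_imp_L2[OF Z] by blast
    then show "cost U V Y \<phi> h a l t X \<le> cost U V Y \<phi> h a l s Z"
      by (simp add: penalized_eq X Z)
  qed
next
  assume R: ?R
  show ?L
  proof (intro ballI)
    fix s and Z :: "'a \<Rightarrow> 'b" assume s: "s \<in> {0..<T}" and Z: "Z \<in> Lspace M 2"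
    show "penalized M U V Y (test_fun M \<phi> h a l) t X \<le> penalized M U V Y (test_fun M \<phi> h a l) s Z"
    proof (cases "Z \<in> Lspace M 4")
      case True
      then show ?thesis using R s by (simp add: penalized_eq X)
    next
      case False
      then show ?thesis using penalized_eq_infinity[OF Z False a] by simp
    qed
  qed
qed

lemma test_dt_eq:
  assumes X: "X \<in> Lspace M 4" and \<phi>: "(\<phi> has_real_derivative d) (at t)"
  shows "test_dt M \<phi> h a l t X = d - a * l * exp (l * t) * (\<integral>w. norm (X w) ^ 4 \<partial>M)"
proof -
  have "((\<lambda>s. \<phi> s + pairing M h X - a * exp (l * s) * (\<integral>w. norm (X w) ^ 4 \<partial>M)) has_real_derivative
      d + 0 - a * (exp (l * t) * l) * (\<integral>w. norm (X w) ^ 4 \<partial>M)) (at t)"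
    by (rule derivative_eq_intros \<phi> refl | simp)+
  then show ?thesis unfolding test_dt_def test_fun_eq[OF X] real_of_ereal.simps
    by (simp add: DERIV_imp_deriv mult_ac)
qed

text \<open>The difference of the two sides of the inequality required of a monotone solution. The
  time derivative of the test function enters through the parameter \<open>d\<close>, so a limit of
  derivatives can be taken as a limit of numbers.\<close>

definition viscosity_gap ::
  "'b::euclidean_space coef \<Rightarrow> 'b coef \<Rightarrow> 'b sol \<Rightarrow> ('a \<Rightarrow> 'b) \<Rightarrow> ('a \<Rightarrow> 'b) \<Rightarrow> real \<Rightarrow> ('a \<Rightarrow> 'b)
    \<Rightarrow> real \<Rightarrow> real \<Rightarrow> real \<Rightarrow> ('a \<Rightarrow> 'b) \<Rightarrow> real" where
  "viscosity_gap F G U V Y d h a l t X =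
    (let u = lift_sol M U t X; A = lift_coef M F X u; B = lift_coef M G X u in
     d - a * l * exp (l * t) * (\<integral>w. norm (X w) ^ 4 \<partial>M) + test_grad M h a l t X A
     - (pairing M A (\<lambda>w. u w - V w) + pairing M B (\<lambda>w. X w - Y w)))"

lemma monotone_solutionD:
  fixes U :: "'b::euclidean_space sol"
  assumes mono: "monotone_solution M T F G U" and VY: "V \<in> Lspace M 2" "Y \<in> Lspace M 2"
    and td: "test_data M T \<phi> h a l" and t: "t \<in> {0<..<T}" and X: "X \<in> Lspace M 4"
    and min: "\<And>s Z. s \<in> {0..<T} \<Longrightarrow> Z \<in> Lspace M 4 \<Longrightarrow> cost U V Y \<phi> h a l t X \<le> cost U V Y \<phi> h a l s Z"
    and \<phi>: "(\<phi> has_real_derivative d) (at t)"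
  shows "viscosity_gap F G U V Y d h a l t X \<ge> 0"
proof -
  have a: "a > 0" using td by (simp add: test_data_def)
  have "\<forall>s\<in>{0..<T}. \<forall>Z\<in>Lspace M 2. penalized M U V Y (test_fun M \<phi> h a l) t X
      \<le> penalized M U V Y (test_fun M \<phi> h a l) s Z"
    unfolding penalized_minimum_iff[OF X a] using min by blast
  then have "pairing M (lift_coef M F X (lift_sol M U t X)) (\<lambda>w. lift_sol M U t X w - V w)
      + pairing M (lift_coef M G X (lift_sol M U t X)) (\<lambda>w. X w - Y w)
      \<le> test_dt M \<phi> h a l t X + test_grad M h a l t X (lift_coef M F X (lift_sol M U t X))"
    using mono[unfolded monotone_solution_def Let_def] VY td t X by blast
  then show ?thesis
    by (simp add: viscosity_gap_def Let_def test_dt_eq[OF X \<phi>])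
qed

section \<open>Regularity of test functions, growth of the coefficients and elementary power
  inequalities\<close>

lemma C1_derivative:
  assumes "C1_on_interval \<tau> \<phi>"
  obtains \<phi>' where "\<And>t. t \<in> {0<..<\<tau>} \<Longrightarrow> (\<phi> has_real_derivative \<phi>' t) (at t)"
    "continuous_on {0..\<tau>} \<phi>'"
proof -
  obtain \<phi>' where \<phi>': "\<And>t. t \<in> {0..\<tau>} \<Longrightarrow> (\<phi> has_real_derivative \<phi>' t) (at t within {0..\<tau>})"
    "continuous_on {0..\<tau>} \<phi>'"
    using assms unfolding C1_on_interval_def by blast
  have "(\<phi> has_real_derivative \<phi>' t) (at t)" if "t \<in> {0<..<\<tau>}" for t
    using \<phi>'(1)[of t] that by (simp add: at_within_Icc_at)
  with \<phi>'(2) show thesis by (intro that) auto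
qed

lemma C1_continuous: "C1_on_interval \<tau> \<phi> \<Longrightarrow> continuous_on {0..\<tau>} \<phi>"
  unfolding C1_on_interval_def by (blast intro: DERIV_continuous_on)

lemma C1_phi_mod:
  assumes "C1_on_interval \<tau> \<phi>"
  shows "C1_on_interval \<tau> (phi_mod \<phi> c t0 K)"
proof -
  obtain \<phi>' where \<phi>': "\<And>t. t \<in> {0..\<tau>} \<Longrightarrow> (\<phi> has_real_derivative \<phi>' t) (at t within {0..\<tau>})"
    "continuous_on {0..\<tau>} \<phi>'"
    using assms unfolding C1_on_interval_def by blast
  have "(phi_mod \<phi> c t0 K has_real_derivative \<phi>' t + c - 2 * K * (t - t0)) (at t within {0..\<tau>})"
    if "t \<in> {0..\<tau>}" for t
    unfolding phi_mod_def[abs_def] by (rule derivative_eq_intros \<phi>'(1)[OF that] refl | simp)+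
  moreover have "continuous_on {0..\<tau>} (\<lambda>t. \<phi>' t + c - 2 * K * (t - t0))"
    by (intro continuous_intros \<phi>')
  ultimately show ?thesis unfolding C1_on_interval_def
    by (intro exI[of _ "\<lambda>t. \<phi>' t + c - 2 * K * (t - t0)"] conjI ballI)
qed

lemma phi_mod_derivative:
  "(\<phi> has_real_derivative d) (at t) \<Longrightarrow>
    (phi_mod \<phi> c t0 K has_real_derivative d + c - 2 * K * (t - t0)) (at t)"
  unfolding phi_mod_def[abs_def] by (rule derivative_eq_intros refl | assumption | simp)+

lemma lift_coef_growth:
  assumes "\<And>x \<mu> u. \<mu> \<in> P2 \<Longrightarrow> norm (F (x, \<mu>, u)) \<le> C * (1 + norm x + norm u + sqrt (enn2real (E_law 2 \<mu>)))"
    and "X \<in> Lspace M 2"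
  shows "norm (lift_coef M F X Z w) \<le> C * (1 + norm (X w) + norm (Z w) + l2_norm M X)"
  using assms(1)[OF law_in_P2[OF assms(2)], of "X w" "Z w"] sqrt_E_law[OF assms(2)]
  by (simp add: lift_coef_def l2_norm_def)

lemma trunc_cube_eventually:
  assumes "filterlim m at_top sequentially"
  shows "\<forall>\<^sub>F j in sequentially. trunc_cube X (m j) w = (norm (X w))\<^sup>2 *\<^sub>R X w"
proof -
  obtain N where N: "norm (X w) \<le> real N" using real_arch_simple by blast
  have "\<forall>\<^sub>F j in sequentially. m j \<ge> N" using assms by (simp add: filterlim_at_top)
  then show ?thesis
  proof eventually_elim
    case (elim j)
    then have "real N \<le> real (m j)" by simp
    then show ?case using N by (simp add: trunc_cube_def)
  qed
qed

lemma norm_trunc_cube_le: "norm (trunc_cube X j w) \<le> norm (X w) ^ 3"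
  by (simp add: trunc_cube_def power2_eq_square power3_eq_cube)

lemma cube_le: "0 \<le> y \<Longrightarrow> y ^ 3 \<le> 1 + y ^ 4" for y :: real
proof (cases "y \<le> 1")
  case True
  assume "0 \<le> y"
  then have "y ^ 3 \<le> 1" using True by (intro power_le_one) auto
  then show ?thesis by (simp add: add_increasing2)
next
  case False
  then have "y ^ 3 \<le> y ^ 4" by (intro power_increasing) auto
  then show ?thesis by simp
qed

lemma cube_mult_le: "0 \<le> y \<Longrightarrow> 0 \<le> z \<Longrightarrow> y ^ 3 * z \<le> y ^ 4 + z ^ 4" for y z :: real
proof (cases "y \<le> z")
  case True
  assume y: "0 \<le> y" "0 \<le> z"
  then have "y ^ 3 * z \<le> z ^ 3 * z" using True by (intro mult_right_mono power_mono) auto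
  then show ?thesis using y by (simp add: power_eq_if add_increasing)
next
  case False
  assume y: "0 \<le> y" "0 \<le> z"
  then have "y ^ 3 * z \<le> y ^ 3 * y" using False by (intro mult_left_mono) auto
  then show ?thesis using y by (simp add: power_eq_if add_increasing2)
qed

text \<open>In the limit the modification disappears: the number added to \<open>d j\<close> cancels
  the extra time derivative caused by \<open>a + 1\<close>, and the limit of the pairing with the
  truncated gradient cancels the extra gradient term. All the integrands without the tilt are
  dominated through the bound of the fourth powers by \<open>N\<close>.\<close>

theorem viscosity_gap_tendsto:
  fixes W :: "'b::euclidean_space sol" and F G :: "'b coef"
  assumes cont: "\<And>n. continuous_map (sol_space T) euclidean (Ws n)"
    and lim: "locally_uniform_limit (sol_space T) Ws W"
    and gr: "\<And>n. linear_growth T C' (Ws n)" and C': "C' \<ge> 0"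
    and contF: "\<And>n. continuous_map coef_space euclidean (Fn n)" and limF: "locally_uniform_limit coef_space Fn F"
    and contG: "\<And>n. continuous_map coef_space euclidean (Gn n)" and limG: "locally_uniform_limit coef_space Gn G"
    and grF: "\<And>n x \<mu> u. \<mu> \<in> P2 \<Longrightarrow> norm (Fn n (x, \<mu>, u)) \<le> C * (1 + norm x + norm u + sqrt (enn2real (E_law 2 \<mu>)))"
    and grG: "\<And>n x \<mu> u. \<mu> \<in> P2 \<Longrightarrow> norm (Gn n (x, \<mu>, u)) \<le> C * (1 + norm x + norm u + sqrt (enn2real (E_law 2 \<mu>)))"
    and C: "C \<ge> 0"
    and V: "V \<in> Lspace M 2" and Y: "Y \<in> Lspace M 2" and h: "h \<in> Lspace M 2"
    and t: "\<And>j. t j \<in> {0..T}" "t0 \<in> {0..T}" "t \<longlonglongrightarrow> t0"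
    and X: "\<And>j. X j \<in> Lspace M 4" "X0 \<in> Lspace M 4"
    and AEX: "AE w in M. (\<lambda>j. X j w) \<longlonglongrightarrow> X0 w"
    and N: "integrable M N" "AE w in M. \<forall>j. norm (X j w) ^ 4 \<le> N w"
    and k: "\<And>j. k j \<in> Lspace M 2" "(\<lambda>j. l2_norm M (k j)) \<longlonglongrightarrow> 0"
    and m: "filterlim m at_top sequentially" and d: "d \<longlonglongrightarrow> d0"
  shows "(\<lambda>j. viscosity_gap (Fn j) (Gn j) (Ws j) V Y (d j + l * exp (l * t0) * (\<integral>w. norm (X0 w) ^ 4 \<partial>M))
      (\<lambda>w. h_mod h l t0 X0 (m j) w - k j w) (a + 1) l (t j) (X j)) \<longlonglongrightarrow> viscosity_gap F G W V Y d0 h a l t0 X0"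
proof -
  note X2 = L4_imp_L2[OF X(1)] L4_imp_L2[OF X(2)]
  have [measurable]: "X j \<in> borel_measurable M" "X0 \<in> borel_measurable M" "V \<in> borel_measurable M"
    "Y \<in> borel_measurable M" "h \<in> borel_measurable M" for j
    using X V Y h by (auto intro: Lspace_measurable)
  have contW: "continuous_map (sol_space T) euclidean W" by (rule sol_space_limit_continuous[OF cont lim])
  have grW: "linear_growth T C' W" by (rule linear_growth_limit[OF gr lim])
  have cF: "continuous_map coef_space euclidean F" by (rule coef_space_limit_continuous[OF contF limF])
  have cG: "continuous_map coef_space euclidean G" by (rule coef_space_limit_continuous[OF contG limG])
  define u u0 where "u j = lift_sol M (Ws j) (t j) (X j)" and "u0 = lift_sol M W t0 X0" for j
  define A A0 where "A j = lift_coef M (Fn j) (X j) (u j)" and "A0 = lift_coef M F X0 u0" for j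
  define B B0 where "B j = lift_coef M (Gn j) (X j) (u j)" and "B0 = lift_coef M G X0 u0" for j
  have um [measurable]: "u j \<in> borel_measurable M" "u0 \<in> borel_measurable M" for j
    unfolding u_def u0_def
    by (rule lift_sol_measurable[OF cont t(1) X2(1)], rule lift_sol_measurable[OF contW t(2) X2(2)])
  have ABm [measurable]: "A j \<in> borel_measurable M" "A0 \<in> borel_measurable M"
      "B j \<in> borel_measurable M" "B0 \<in> borel_measurable M" for j
    unfolding A_def A0_def B_def B0_def by (intro lift_coef_measurable contF cF contG cG X2 um)+
  define R where "R = (\<integral>w. N w \<partial>M)"
  have E4: "(\<integral>w. norm (X j w) ^ 4 \<partial>M) \<le> R" for j
    unfolding R_def by (intro integral_mono_AE Lspace_integrable X N(1)) (use N(2) in auto)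
  have R0: "R \<ge> 0" using E4[of 0] by (rule order_trans[rotated]) simp
  define c where "c = 1 + R"
  have c: "l2_norm M (X j) \<le> c" for j unfolding c_def by (rule l2_norm_le_L4[OF X(1) E4])
  have c1: "c \<ge> 1" using R0 by (simp add: c_def)
  define CU where "CU = C' * (1 + c)"
  define CA where "CA = C * (1 + c + CU)"
  have CU0: "CU \<ge> 0" using C' c1 by (simp add: CU_def)
  have CA0: "CA \<ge> 0" using C CU0 c1 by (simp add: CA_def)
  have u_le: "norm (u j w) \<le> CU * (1 + norm (X j w))" for j w
  proof -
    have "norm (u j w) \<le> C' * (1 + norm (X j w) + l2_norm M (X j))"
      unfolding u_def by (rule lift_sol_growth[OF gr t(1) X2(1)])
    also have "\<dots> \<le> C' * ((1 + c) * (1 + norm (X j w)))"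
    proof (rule mult_left_mono[OF _ C'])
      show "1 + norm (X j w) + l2_norm M (X j) \<le> (1 + c) * (1 + norm (X j w))"
      proof -
        have "(1 + c) * (1 + norm (X j w)) = 1 + norm (X j w) + c + c * norm (X j w)"
          by (simp add: algebra_simps)
        moreover have "0 \<le> c * norm (X j w)" using c1 by (intro mult_nonneg_nonneg) auto
        ultimately show ?thesis using c[of j] by linarith
      qed
    qed
    finally show ?thesis by (simp add: CU_def)
  qed
  have fin: "C * (1 + norm (X j w) + norm (u j w) + l2_norm M (X j)) \<le> CA * (1 + norm (X j w))" for j w
  proof -
    have "1 + norm (X j w) + norm (u j w) + l2_norm M (X j) \<le> 1 + norm (X j w) + CU * (1 + norm (X j w)) + c * (1 + norm (X j w))"
    proof -
      have "c * 1 \<le> c * (1 + norm (X j w))" using c1 by (intro mult_left_mono) auto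
      then show ?thesis using u_le[of j w] c[of j] by linarith
    qed
    also have "\<dots> = (1 + c + CU) * (1 + norm (X j w))" by (simp add: algebra_simps)
    finally have "C * (1 + norm (X j w) + norm (u j w) + l2_norm M (X j)) \<le> C * ((1 + c + CU) * (1 + norm (X j w)))"
      using C by (intro mult_left_mono)
    then show ?thesis by (simp add: CA_def mult.assoc)
  qed
  have A_le: "norm (A j w) \<le> CA * (1 + norm (X j w))" for j w
    unfolding A_def by (rule order_trans[OF lift_coef_growth[OF grF X2(1)] fin])
  have B_le: "norm (B j w) \<le> CA * (1 + norm (X j w))" for j w
    unfolding B_def by (rule order_trans[OF lift_coef_growth[OF grG X2(1)] fin])
  \<comment> \<open>One integrable function that, up to constants, bounds the squares of
    \<open>X j\<close>, \<open>u j\<close>, \<open>A j\<close> and \<open>B j\<close>; the factor 4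
    comes from (1 + |x|)^2 \<le> 4 (1 + |x|^4).\<close>
  define Q where "Q w = 4 * (1 + N w)" for w
  have Qi: "integrable M Q" using N(1) by (simp add: Q_def[abs_def])
  have sq: "(D * (1 + norm x))\<^sup>2 \<le> D\<^sup>2 * (4 * (1 + norm x ^ 4))" for D and x :: 'b
  proof -
    have "(1 + norm x)\<^sup>2 \<le> 2 + 2 * (norm x)\<^sup>2"
      using sum_squares_bound[of 1 "norm x"] by (simp add: power2_sum)
    also have "\<dots> \<le> 4 * (1 + norm x ^ 4)"
    proof -
      have "(norm x)\<^sup>2 \<le> 1 + norm x ^ 4" using le_one_plus_square[of "(norm x)\<^sup>2"] by simp
      moreover have "0 \<le> norm x ^ 4" by simp
      ultimately show ?thesis unfolding distrib_left by linarith
    qed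
    finally show ?thesis unfolding power_mult_distrib by (intro mult_left_mono) auto
  qed
  have sqQ: "AE w in M. \<forall>j. (D * (1 + norm (X j w)))\<^sup>2 \<le> D\<^sup>2 * Q w" for D
    using N(2)
  proof eventually_elim
    case (elim w)
    have "D\<^sup>2 * (4 * (1 + norm (X j w) ^ 4)) \<le> D\<^sup>2 * Q w" for j
      unfolding Q_def using elim by (intro mult_left_mono) auto
    then show ?case using sq order_trans by blast
  qed
  have A2: "AE w in M. \<forall>j. norm (A j w) ^ 2 \<le> CA\<^sup>2 * Q w"
    using sqQ[of CA] by eventually_elim (blast intro: order_trans power_mono[OF A_le norm_ge_zero])
  have B2: "AE w in M. \<forall>j. norm (B j w) ^ 2 \<le> CA\<^sup>2 * Q w"
    using sqQ[of CA] by eventually_elim (blast intro: order_trans power_mono[OF B_le norm_ge_zero])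
  have u2: "AE w in M. \<forall>j. norm (u j w) ^ 2 \<le> CU\<^sup>2 * Q w"
    using sqQ[of CU] by eventually_elim (blast intro: order_trans power_mono[OF u_le norm_ge_zero])
  have x2: "AE w in M. \<forall>j. norm (X j w) ^ 2 \<le> Q w"
    using N(2)
  proof eventually_elim
    case (elim w)
    have "norm (X j w) ^ 2 \<le> Q w" for j
    proof -
      have "(norm (X j w))\<^sup>2 \<le> 1 + norm (X j w) ^ 4" using le_one_plus_square[of "(norm (X j w))\<^sup>2"] by simp
      moreover have "0 \<le> norm (X j w) ^ 4" by simp
      ultimately show ?thesis unfolding Q_def distrib_left using elim[rule_format, of j] by linarith
    qed
    then show ?case by blast
  qed
  have "(\<lambda>j. \<integral>w. norm (X0 w - X j w) ^ 2 \<partial>M) \<longlonglongrightarrow> 0"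
    by (rule L2_tendsto_of_AE[OF X(1) X(2) E4 AEX])
  then have "(\<lambda>j. l2_norm M (\<lambda>w. X j w - X0 w)) \<longlonglongrightarrow> 0"
    using tendsto_real_sqrt by (fastforce simp: l2_norm_def norm_minus_commute)
  then have Wl: "(\<lambda>j. W2 (law M X0) (law M (X j))) \<longlonglongrightarrow> 0"
    by (rule W2_law_tendsto[OF X2(1) X2(2)])
  have u_lim: "AE w in M. (\<lambda>j. u j w) \<longlonglongrightarrow> u0 w"
    using AEX
  proof eventually_elim
    case (elim w)
    show ?case unfolding u_def u0_def lift_sol_def
      by (rule sol_space_tendsto[OF cont lim t(2,1) law_in_P2[OF X2(2)] law_in_P2[OF X2(1)] t(3) elim Wl])
  qed
  have A_lim: "AE w in M. (\<lambda>j. A j w) \<longlonglongrightarrow> A0 w"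
    using AEX u_lim
  proof eventually_elim
    case (elim w)
    show ?case unfolding A_def A0_def lift_coef_def
      by (rule coef_space_tendsto[OF contF limF law_in_P2[OF X2(2)] law_in_P2[OF X2(1)] elim(1) Wl elim(2)])
  qed
  have B_lim: "AE w in M. (\<lambda>j. B j w) \<longlonglongrightarrow> B0 w"
    using AEX u_lim
  proof eventually_elim
    case (elim w)
    show ?case unfolding B_def B0_def lift_coef_def
      by (rule coef_space_tendsto[OF contG limG law_in_P2[OF X2(2)] law_in_P2[OF X2(1)] elim(1) Wl elim(2)])
  qed
  have AL2: "A j \<in> Lspace M 2" for j
    by (rule Lspace_mono[OF ABm(1) affine_norm_L2[OF X2(1)[of j], of CA 1]])
       (use A_le[of j] order_trans[OF A_le abs_ge_self] in auto)
  have lim_E4: "(\<lambda>j. \<integral>w. norm (X j w) ^ 4 \<partial>M) \<longlonglongrightarrow> (\<integral>w. norm (X0 w) ^ 4 \<partial>M)"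
  proof (rule integral_dominated_convergence[where w = N])
    show "AE w in M. (\<lambda>j. norm (X j w) ^ 4) \<longlonglongrightarrow> norm (X0 w) ^ 4"
      using AEX by eventually_elim (intro tendsto_intros)
    show "AE w in M. norm (norm (X j w) ^ 4) \<le> N w" for j using N(2) by eventually_elim simp
  qed (use N in auto)
  have lim_h: "(\<lambda>j. pairing M h (A j)) \<longlonglongrightarrow> pairing M h A0"
    unfolding pairing_def
  proof (rule integral_dominated_convergence[where w = "\<lambda>w. norm (h w) ^ 2 + CA\<^sup>2 * Q w"])
    show "AE w in M. (\<lambda>j. h w \<bullet> A j w) \<longlonglongrightarrow> h w \<bullet> A0 w"
      using A_lim by eventually_elim (intro tendsto_intros)
    show "AE w in M. norm (h w \<bullet> A j w) \<le> norm (h w) ^ 2 + CA\<^sup>2 * Q w" for j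
      using A2
    proof eventually_elim
      case (elim w)
      then show ?case using abs_inner_le[of "h w" "A j w"] elim[rule_format, of j] unfolding real_norm_def by linarith
    qed
  qed (use Lspace_integrable[OF h] Qi in auto)
  \<comment> \<open>A cubic factor times the linear growth of \<open>A j\<close> stays within fourth
    powers. \<open>y\<close> stands for \<open>norm (X0 w)\<close> in the truncated term and for
    \<open>norm (X j w)\<close> in the other one.\<close>
  have cubeA: "y ^ 3 * norm (A j w) \<le> CA * (1 + 2 * y ^ 4 + norm (X j w) ^ 4)" if "y \<ge> 0" for y j w
  proof -
    have "y ^ 3 * norm (A j w) \<le> y ^ 3 * (CA * (1 + norm (X j w)))"
      using A_le that by (intro mult_left_mono) auto
    also have "\<dots> = CA * (y ^ 3 + y ^ 3 * norm (X j w))" by (simp add: algebra_simps)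
    also have "\<dots> \<le> CA * (1 + 2 * y ^ 4 + norm (X j w) ^ 4)"
    proof (rule mult_left_mono[OF _ CA0])
      show "y ^ 3 + y ^ 3 * norm (X j w) \<le> 1 + 2 * y ^ 4 + norm (X j w) ^ 4"
        using cube_le[OF that] cube_mult_le[OF that, of "norm (X j w)"] by simp
    qed
    finally show ?thesis .
  qed
  have lim_g: "(\<lambda>j. pairing M (trunc_cube X0 (m j)) (A j)) \<longlonglongrightarrow> (\<integral>w. (norm (X0 w))\<^sup>2 * (X0 w \<bullet> A0 w) \<partial>M)"
    unfolding pairing_def
  proof (rule integral_dominated_convergence[where w = "\<lambda>w. CA * (1 + 2 * norm (X0 w) ^ 4 + N w)"])
    show "(\<lambda>w. trunc_cube X0 (m j) w \<bullet> A j w) \<in> borel_measurable M" for j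
      using Lspace_measurable[OF trunc_cube_L2[of X0 "m j"]] by (intro borel_measurable_inner) auto
    show "AE w in M. (\<lambda>j. trunc_cube X0 (m j) w \<bullet> A j w) \<longlonglongrightarrow> (norm (X0 w))\<^sup>2 * (X0 w \<bullet> A0 w)"
      using A_lim
    proof eventually_elim
      case (elim w)
      have "(\<lambda>j. trunc_cube X0 (m j) w) \<longlonglongrightarrow> (norm (X0 w))\<^sup>2 *\<^sub>R X0 w"
        by (rule tendsto_eventually[OF trunc_cube_eventually[OF m]])
      then have "(\<lambda>j. trunc_cube X0 (m j) w \<bullet> A j w) \<longlonglongrightarrow> ((norm (X0 w))\<^sup>2 *\<^sub>R X0 w) \<bullet> A0 w"
        by (intro tendsto_inner elim)
      then show ?case by simp
    qed
    show "AE w in M. norm (trunc_cube X0 (m j) w \<bullet> A j w) \<le> CA * (1 + 2 * norm (X0 w) ^ 4 + N w)" for j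
      using N(2)
    proof eventually_elim
      case (elim w)
      have "\<bar>trunc_cube X0 (m j) w \<bullet> A j w\<bar> \<le> norm (trunc_cube X0 (m j) w) * norm (A j w)"
        by (rule Cauchy_Schwarz_ineq2)
      also have "\<dots> \<le> norm (X0 w) ^ 3 * norm (A j w)"
        by (intro mult_right_mono norm_trunc_cube_le) auto
      also have "\<dots> \<le> CA * (1 + 2 * norm (X0 w) ^ 4 + norm (X j w) ^ 4)" by (rule cubeA) simp
      also have "\<dots> \<le> CA * (1 + 2 * norm (X0 w) ^ 4 + N w)"
        using elim CA0 by (intro mult_left_mono) auto
      finally show ?case by simp
    qed
  qed (use N Lspace_integrable[OF X(2)] in auto)
  have lim_x: "(\<lambda>j. \<integral>w. (norm (X j w))\<^sup>2 * (X j w \<bullet> A j w) \<partial>M) \<longlonglongrightarrow> (\<integral>w. (norm (X0 w))\<^sup>2 * (X0 w \<bullet> A0 w) \<partial>M)"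
  proof (rule integral_dominated_convergence[where w = "\<lambda>w. CA * (1 + 3 * N w)"])
    show "AE w in M. (\<lambda>j. (norm (X j w))\<^sup>2 * (X j w \<bullet> A j w)) \<longlonglongrightarrow> (norm (X0 w))\<^sup>2 * (X0 w \<bullet> A0 w)"
      using A_lim AEX by eventually_elim (intro tendsto_intros)
    show "AE w in M. norm ((norm (X j w))\<^sup>2 * (X j w \<bullet> A j w)) \<le> CA * (1 + 3 * N w)" for j
      using N(2)
    proof eventually_elim
      case (elim w)
      have "\<bar>(norm (X j w))\<^sup>2 * (X j w \<bullet> A j w)\<bar> \<le> (norm (X j w))\<^sup>2 * (norm (X j w) * norm (A j w))"
        unfolding abs_mult by (intro mult_mono Cauchy_Schwarz_ineq2) auto
      also have "\<dots> = norm (X j w) ^ 3 * norm (A j w)" by (simp add: power2_eq_square power3_eq_cube)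
      also have "\<dots> \<le> CA * (1 + 2 * norm (X j w) ^ 4 + norm (X j w) ^ 4)" by (rule cubeA) simp
      also have "\<dots> \<le> CA * (1 + 3 * N w)"
        using elim[rule_format, of j] CA0 by (intro mult_left_mono) auto
      finally show ?case by simp
    qed
  qed (use N in auto)
  have lim_A: "(\<lambda>j. pairing M (A j) (\<lambda>w. u j w - V w)) \<longlonglongrightarrow> pairing M A0 (\<lambda>w. u0 w - V w)"
    unfolding pairing_def
  proof (rule integral_dominated_convergence[where w = "\<lambda>w. CA\<^sup>2 * Q w + (2 * (CU\<^sup>2 * Q w) + 2 * norm (V w) ^ 2)"])
    show "AE w in M. (\<lambda>j. A j w \<bullet> (u j w - V w)) \<longlonglongrightarrow> A0 w \<bullet> (u0 w - V w)"
      using A_lim u_lim by eventually_elim (intro tendsto_intros)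
    show "AE w in M. norm (A j w \<bullet> (u j w - V w)) \<le> CA\<^sup>2 * Q w + (2 * (CU\<^sup>2 * Q w) + 2 * norm (V w) ^ 2)" for j
      using A2 u2
    proof eventually_elim
      case (elim w)
      then show ?case
        using abs_inner_le[of "A j w" "u j w - V w"] norm_diff_power_2[of "u j w" "V w"]
          elim(1)[rule_format, of j] elim(2)[rule_format, of j]
        unfolding real_norm_def by linarith
    qed
  qed (use Lspace_integrable[OF V] Qi in auto)
  have lim_B: "(\<lambda>j. pairing M (B j) (\<lambda>w. X j w - Y w)) \<longlonglongrightarrow> pairing M B0 (\<lambda>w. X0 w - Y w)"
    unfolding pairing_def
  proof (rule integral_dominated_convergence[where w = "\<lambda>w. CA\<^sup>2 * Q w + (2 * Q w + 2 * norm (Y w) ^ 2)"])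
    show "AE w in M. (\<lambda>j. B j w \<bullet> (X j w - Y w)) \<longlonglongrightarrow> B0 w \<bullet> (X0 w - Y w)"
      using B_lim AEX by eventually_elim (intro tendsto_intros)
    show "AE w in M. norm (B j w \<bullet> (X j w - Y w)) \<le> CA\<^sup>2 * Q w + (2 * Q w + 2 * norm (Y w) ^ 2)" for j
      using B2 x2
    proof eventually_elim
      case (elim w)
      then show ?case
        using abs_inner_le[of "B j w" "X j w - Y w"] norm_diff_power_2[of "X j w" "Y w"]
          elim(1)[rule_format, of j] elim(2)[rule_format, of j]
        unfolding real_norm_def by linarith
    qed
  qed (use Lspace_integrable[OF Y] Qi in auto)
  \<comment> \<open>The tilts vanish in L^2 while the \<open>A j\<close> stay bounded there.\<close>
  have lim_k: "(\<lambda>j. pairing M (k j) (A j)) \<longlonglongrightarrow> 0"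
  proof (rule Lim_null_comparison)
    define D where "D = sqrt (\<integral>w. CA\<^sup>2 * Q w \<partial>M)"
    have "l2_norm M (A j) \<le> D" for j
      unfolding D_def l2_norm_def
      by (intro real_sqrt_le_mono integral_mono_AE Lspace_integrable AL2) (use A2 Qi in auto)
    then show "\<forall>\<^sub>F j in sequentially. norm (pairing M (k j) (A j)) \<le> l2_norm M (k j) * D"
      using order_trans[OF pairing_le_l2_norm[OF k(1) AL2] mult_left_mono] by (auto intro!: always_eventually)
    show "(\<lambda>j. l2_norm M (k j) * D) \<longlonglongrightarrow> 0" by (rule tendsto_mult_left_zero[OF k(2)])
  qed
  have split: "pairing M (\<lambda>w. h_mod h l t0 X0 (m j) w - k j w) (A j)
      = pairing M h (A j) + 4 * exp (l * t0) * pairing M (trunc_cube X0 (m j)) (A j) - pairing M (k j) (A j)" for j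
  proof -
    have g: "trunc_cube X0 (m j) \<in> Lspace M 2" by (rule trunc_cube_L2) measurable
    have "pairing M (h_mod h l t0 X0 (m j)) (A j) = pairing M h (A j) + 4 * exp (l * t0) * pairing M (trunc_cube X0 (m j)) (A j)"
      unfolding h_mod_def[abs_def] using h g AL2 by (simp add: pairing_add_left L2_scale pairing_scale_left)
    then show ?thesis using h_mod_L2[OF h X(2)] k(1) AL2 by (simp add: pairing_diff_left)
  qed
  have "(\<lambda>j. viscosity_gap (Fn j) (Gn j) (Ws j) V Y (d j + l * exp (l * t0) * (\<integral>w. norm (X0 w) ^ 4 \<partial>M))
      (\<lambda>w. h_mod h l t0 X0 (m j) w - k j w) (a + 1) l (t j) (X j)) \<longlonglongrightarrow>
    (d0 + l * exp (l * t0) * (\<integral>w. norm (X0 w) ^ 4 \<partial>M)) - (a + 1) * l * exp (l * t0) * (\<integral>w. norm (X0 w) ^ 4 \<partial>M)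
    + ((pairing M h A0 + 4 * exp (l * t0) * (\<integral>w. (norm (X0 w))\<^sup>2 * (X0 w \<bullet> A0 w) \<partial>M) - 0)
      - 4 * (a + 1) * exp (l * t0) * (\<integral>w. (norm (X0 w))\<^sup>2 * (X0 w \<bullet> A0 w) \<partial>M))
    - (pairing M A0 (\<lambda>w. u0 w - V w) + pairing M B0 (\<lambda>w. X0 w - Y w))"
    unfolding viscosity_gap_def Let_def test_grad_def
    unfolding u_def[symmetric] A_def[symmetric] B_def[symmetric] split
    by (intro tendsto_intros d t lim_E4 lim_h lim_g lim_x lim_k lim_A lim_B)
  \<comment> \<open>The compensating terms turn both occurrences of \<open>a + 1\<close> back into
    \<open>a\<close>.\<close>
  also have "(d0 + l * exp (l * t0) * (\<integral>w. norm (X0 w) ^ 4 \<partial>M)) - (a + 1) * l * exp (l * t0) * (\<integral>w. norm (X0 w) ^ 4 \<partial>M)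
    + ((pairing M h A0 + 4 * exp (l * t0) * (\<integral>w. (norm (X0 w))\<^sup>2 * (X0 w \<bullet> A0 w) \<partial>M) - 0)
      - 4 * (a + 1) * exp (l * t0) * (\<integral>w. (norm (X0 w))\<^sup>2 * (X0 w \<bullet> A0 w) \<partial>M))
    - (pairing M A0 (\<lambda>w. u0 w - V w) + pairing M B0 (\<lambda>w. X0 w - Y w)) = viscosity_gap F G W V Y d0 h a l t0 X0"
    unfolding viscosity_gap_def Let_def test_grad_def
    unfolding u0_def[symmetric] A0_def[symmetric] B0_def[symmetric] by (simp add: algebra_simps)
  finally show ?thesis .
qed


text \<open>A subsequence of the approximate minima, chosen for almost sure and dominated
  convergence, is shifted to interior times. Since \<open>n j \<ge> j\<close>, the index of the
  solutions still tends to infinity along it, and so does the truncation level.\<close>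

lemma stability_inequality:
  fixes W :: "'b::euclidean_space sol" and F G :: "'b coef"
  assumes contF: "\<And>n. continuous_map coef_space euclidean (Fn n)" and limF: "locally_uniform_limit coef_space Fn F"
    and contG: "\<And>n. continuous_map coef_space euclidean (Gn n)" and limG: "locally_uniform_limit coef_space Gn G"
    and grF: "\<And>n x \<mu> u. \<mu> \<in> P2 \<Longrightarrow> norm (Fn n (x, \<mu>, u)) \<le> C * (1 + norm x + norm u + sqrt (enn2real (E_law 2 \<mu>)))"
    and grG: "\<And>n x \<mu> u. \<mu> \<in> P2 \<Longrightarrow> norm (Gn n (x, \<mu>, u)) \<le> C * (1 + norm x + norm u + sqrt (enn2real (E_law 2 \<mu>)))"
    and C: "C \<ge> 0"
    and mono: "\<And>n. monotone_solution M T (Fn n) (Gn n) (Ws n)"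
    and gr: "\<And>n. linear_growth T C' (Ws n)" and C': "C' \<ge> 0"
    and lim: "locally_uniform_limit (sol_space T) Ws W"
    and V: "V \<in> Lspace M 2" and Y: "Y \<in> Lspace M 2" and td: "test_data M T \<phi> h a l"
    and t0: "t0 \<in> {0<..<T}" and X0: "X0 \<in> Lspace M 4"
    and min: "\<And>s Z. s \<in> {0..<T} \<Longrightarrow> Z \<in> Lspace M 4 \<Longrightarrow> cost W V Y \<phi> h a l t0 X0 \<le> cost W V Y \<phi> h a l s Z"
    and \<phi>0: "(\<phi> has_real_derivative d0) (at t0)"
  shows "viscosity_gap F G W V Y d0 h a l t0 X0 \<ge> 0"
proof -
  have h: "h \<in> Lspace M 2" and a: "a > 0" and l: "l > 0"
    and C1: "\<And>\<tau>. 0 < \<tau> \<Longrightarrow> \<tau> < T \<Longrightarrow> C1_on_interval \<tau> \<phi>"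
    using td by (auto simp: test_data_def)
  have cont: "continuous_map (sol_space T) euclidean (Ws n)" for n
    using mono[of n] by (simp add: monotone_solution_def)
  define \<tau> where "\<tau> = (t0 + T) / 2"
  have \<tau>: "t0 < \<tau>" "\<tau> < T" "0 < \<tau>" using t0 by (auto simp: \<tau>_def)
  obtain \<phi>' where \<phi>': "\<And>t. t \<in> {0<..<\<tau>} \<Longrightarrow> (\<phi> has_real_derivative \<phi>' t) (at t)" "continuous_on {0..\<tau>} \<phi>'"
    using C1_derivative[OF C1[OF \<tau>(3,2)]] by blast
  have d0: "d0 = \<phi>' t0" using DERIV_unique[OF \<phi>0 \<phi>'(1)] t0 \<tau> by auto
  define c where "c = l * exp (l * t0) * (\<integral>w. norm (X0 w) ^ 4 \<partial>M)"
  obtain K n k t X where n: "\<And>j. n j \<ge> j" and k: "\<And>j. k j \<in> Lspace M 2" "(\<lambda>j. l2_norm M (k j)) \<longlonglongrightarrow> 0"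
    and t: "\<And>j. t j \<in> {0..<T}" "t \<longlonglongrightarrow> t0" and X: "\<And>j. X j \<in> Lspace M 4"
    and XX: "(\<lambda>j. \<integral>w. norm (X j w - X0 w) ^ 4 \<partial>M) \<longlonglongrightarrow> 0"
    and m: "\<And>j s Z. s \<in> {0..<T} \<Longrightarrow> Z \<in> Lspace M 4 \<Longrightarrow>
      cost (Ws (n j)) V Y (phi_mod \<phi> c t0 K) (\<lambda>w. h_mod h l t0 X0 j w - k j w) (a + 1) l (t j) (X j)
      \<le> cost (Ws (n j)) V Y (phi_mod \<phi> c t0 K) (\<lambda>w. h_mod h l t0 X0 j w - k j w) (a + 1) l s Z"
    unfolding c_def
    by (rule approximate_minima[OF cont lim gr C' V Y h C1_continuous[OF C1] a l t0 X0 min]) blast+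
  have int: "integrable M (\<lambda>w. norm (X j w - X0 w) ^ 4)" for j
    by (intro Lspace_integrable L4_diff X X0)
  obtain r S where r: "strict_mono r" and S: "integrable M S"
    and AEX: "AE w in M. (\<lambda>j. X (r j) w) \<longlonglongrightarrow> X0 w"
    and AES: "AE w in M. \<forall>j. norm (X (r j) w - X0 w) ^ 4 \<le> S w"
    using Lp_subseq_dominated[OF _ int XX] by auto
  have tr: "(\<lambda>j. t (r j)) \<longlonglongrightarrow> t0" using LIMSEQ_subseq_LIMSEQ[OF t(2) r] by (simp add: o_def)
  \<comment> \<open>A minimum time may be 0, where no inequality is required, or lie beyond the
    interval on which \<open>\<phi>'\<close> is known to be the derivative. Convergence to
    \<open>t0\<close> leaves only finitely many such indices to discard.\<close>
  have "\<forall>\<^sub>F j in sequentially. t (r j) > 0 \<and> t (r j) < \<tau>"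
    using t0 \<tau> by (intro eventually_conj order_tendstoD[OF tr]) auto
  then obtain J where J: "\<And>j. j \<ge> J \<Longrightarrow> 0 < t (r j) \<and> t (r j) < \<tau>"
    by (auto simp: eventually_sequentially)
  define s where "s j = r (j + J)" for j
  have s: "strict_mono s" using r by (simp add: s_def strict_mono_def)
  have ts: "t (s j) \<in> {0<..<\<tau>}" for j using J[of "j + J"] by (simp add: s_def)
  have tsT: "t (s j) \<in> {0<..<T}" for j using ts[of j] \<tau> by auto
  have tsl: "(\<lambda>j. t (s j)) \<longlonglongrightarrow> t0" using LIMSEQ_subseq_LIMSEQ[OF t(2) s] by (simp add: o_def)
  have ns: "filterlim (\<lambda>j. n (s j)) at_top sequentially"
  proof (rule filterlim_at_top_mono)
    show "filterlim s at_top sequentially" by (rule filterlim_subseq[OF s])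
    show "\<forall>\<^sub>F j in sequentially. s j \<le> n (s j)" using n by simp
  qed
  define N where "N w = 8 * S w + 8 * norm (X0 w) ^ 4" for w
  have N: "integrable M N" unfolding N_def[abs_def] using S Lspace_integrable[OF X0] by auto
  have AEN: "AE w in M. \<forall>j. norm (X (s j) w) ^ 4 \<le> N w"
    using AES
  proof eventually_elim
    case (elim w)
    have "norm (X (s j) w) ^ 4 \<le> N w" for j
      using norm_add_power_4[of "X (s j) w - X0 w" "X0 w"] elim[rule_format, of "j + J"]
      by (simp add: N_def s_def)
    then show ?case by blast
  qed
  have AEs: "AE w in M. (\<lambda>j. X (s j) w) \<longlonglongrightarrow> X0 w"
    using AEX unfolding s_def by eventually_elim (rule LIMSEQ_ignore_initial_segment)
  define d where "d j = \<phi>' (t (s j)) - 2 * K * (t (s j) - t0)" for j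
  have "(\<lambda>j. \<phi>' (t (s j))) \<longlonglongrightarrow> \<phi>' t0"
  proof (rule continuous_on_tendsto_compose[OF \<phi>'(2) tsl])
    show "t0 \<in> {0..\<tau>}" using t0 \<tau> by auto
    show "\<forall>\<^sub>F j in sequentially. t (s j) \<in> {0..\<tau>}"
      using ts by (intro always_eventually) (auto intro: less_imp_le)
  qed
  then have "d \<longlonglongrightarrow> \<phi>' t0 - 2 * K * (t0 - t0)"
    unfolding d_def by (intro tendsto_intros tsl)
  then have dl: "d \<longlonglongrightarrow> d0" by (simp add: d0)
  have ks: "(\<lambda>j. l2_norm M (k (s j))) \<longlonglongrightarrow> 0"
    using LIMSEQ_subseq_LIMSEQ[OF k(2) s] by (simp add: o_def)
  have "(\<lambda>j. viscosity_gap (Fn (n (s j))) (Gn (n (s j))) (Ws (n (s j))) V Y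
      (d j + l * exp (l * t0) * (\<integral>w. norm (X0 w) ^ 4 \<partial>M))
      (\<lambda>w. h_mod h l t0 X0 (s j) w - k (s j) w) (a + 1) l (t (s j)) (X (s j))) \<longlonglongrightarrow> viscosity_gap F G W V Y d0 h a l t0 X0"
  proof (rule viscosity_gap_tendsto[OF cont locally_uniform_limit_subseq[OF lim ns] gr C'
        contF locally_uniform_limit_subseq[OF limF ns] contG locally_uniform_limit_subseq[OF limG ns]
        grF grG C V Y h])
    show "t (s j) \<in> {0..T}" for j using tsT[of j] by auto
    show "t0 \<in> {0..T}" using t0 by auto
  qed (use tsl X X0 AEs N AEN k ks dl filterlim_subseq[OF s] in auto)
  moreover have "viscosity_gap (Fn (n (s j))) (Gn (n (s j))) (Ws (n (s j))) V Y
      (d j + l * exp (l * t0) * (\<integral>w. norm (X0 w) ^ 4 \<partial>M))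
      (\<lambda>w. h_mod h l t0 X0 (s j) w - k (s j) w) (a + 1) l (t (s j)) (X (s j)) \<ge> 0" for j
  proof (rule monotone_solutionD[OF mono V Y _ tsT X m])
    show "test_data M T (phi_mod \<phi> c t0 K) (\<lambda>w. h_mod h l t0 X0 (s j) w - k (s j) w) (a + 1) l"
      using C1 a l h_mod_L2[OF h X0] k(1)
      by (auto simp: test_data_def intro!: C1_phi_mod L2_diff)
    show "(phi_mod \<phi> c t0 K has_real_derivative d j + l * exp (l * t0) * (\<integral>w. norm (X0 w) ^ 4 \<partial>M)) (at (t (s j)))"
      using phi_mod_derivative[where c = c and K = K and ?t0.0 = t0, OF \<phi>'(1)[OF ts[of j]]] by (simp add: d_def c_def algebra_simps)
  qed
  ultimately show ?thesis by (intro tendsto_lowerbound[OF _ _ trivial_limit_sequentially]) auto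
qed

theorem monotone_solution_stable:
  fixes W :: "'b::euclidean_space sol" and F G :: "'b coef"
  assumes contF: "\<And>n. continuous_map coef_space euclidean (Fn n)" and limF: "locally_uniform_limit coef_space Fn F"
    and contG: "\<And>n. continuous_map coef_space euclidean (Gn n)" and limG: "locally_uniform_limit coef_space Gn G"
    and grFG: "\<And>n x \<mu> u. \<mu> \<in> P2 \<Longrightarrow> norm (Fn n (x, \<mu>, u)) + norm (Gn n (x, \<mu>, u))
      \<le> C * (1 + norm x + norm u + sqrt (enn2real (E_law 2 \<mu>)))"
    and mono: "\<And>n. monotone_solution M T (Fn n) (Gn n) (Ws n)"
    and C': "C' > 0" and gr: "\<And>n. linear_growth T C' (Ws n)"
    and lim: "locally_uniform_limit (sol_space T) Ws W"
  shows "monotone_solution M T F G W"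
proof -
  have cont: "continuous_map (sol_space T) euclidean (Ws n)" for n
    using mono[of n] by (simp add: monotone_solution_def)
  have grF: "norm (Fn n (x, \<mu>, u)) \<le> C * (1 + norm x + norm u + sqrt (enn2real (E_law 2 \<mu>)))"
    and grG: "norm (Gn n (x, \<mu>, u)) \<le> C * (1 + norm x + norm u + sqrt (enn2real (E_law 2 \<mu>)))"
    if "\<mu> \<in> P2" for n x \<mu> u
    using grFG[OF that, of n x u] norm_ge_zero[of "Fn n (x, \<mu>, u)"] norm_ge_zero[of "Gn n (x, \<mu>, u)"] by linarith+
  \<comment> \<open>Testing the growth bound at a single law of finite second moment forces
    \<open>C \<ge> 0\<close>, which the multiplications of estimates by \<open>C\<close>
    require.\<close>
  have "law M (\<lambda>w. 0 :: 'b) \<in> P2" by (rule law_in_P2) simp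
  define e where "e = sqrt (enn2real (E_law 2 (law M (\<lambda>w. 0 :: 'b))))"
  have "e \<ge> 0" by (simp add: e_def)
  have "0 \<le> C * (1 + norm (0 :: 'b) + norm (0 :: 'b) + e)"
    unfolding e_def by (rule order_trans[OF norm_ge_zero grF[OF \<open>law M (\<lambda>w. 0 :: 'b) \<in> P2\<close>]])
  then have C: "C \<ge> 0" using \<open>e \<ge> 0\<close> by (simp add: zero_le_mult_iff)
  show ?thesis
    unfolding monotone_solution_def
  proof (intro conjI ballI allI impI)
    show "continuous_map (sol_space T) euclidean W" by (rule sol_space_limit_continuous[OF cont lim])
    show "\<exists>C. linear_growth T C W" using linear_growth_limit[OF gr lim] by blast
    fix Y V :: "'a \<Rightarrow> 'b" and \<phi> h \<alpha> l t X
    assume Y: "Y \<in> Lspace M 2" and V: "V \<in> Lspace M 2" and td: "test_data M T \<phi> h \<alpha> l"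
      and t: "t \<in> {0<..<T}" and X: "X \<in> Lspace M 4"
      and min: "\<forall>s\<in>{0..<T}. \<forall>Z\<in>Lspace M 2. penalized M W V Y (test_fun M \<phi> h \<alpha> l) t X
        \<le> penalized M W V Y (test_fun M \<phi> h \<alpha> l) s Z"
    have \<alpha>: "\<alpha> > 0" using td by (simp add: test_data_def)
    \<comment> \<open>Any time strictly between \<open>t\<close> and \<open>T\<close> would do: it
      makes \<open>t\<close> interior to an interval on which \<open>\<phi>\<close> is of class
      C^1.\<close>
    have "0 < (t + T) / 2" "(t + T) / 2 < T" "t < (t + T) / 2" using t by auto
    then obtain d where d: "(\<phi> has_real_derivative d) (at t)"
      using td t C1_derivative[of "(t + T) / 2" \<phi>] unfolding test_data_def
      by (metis greaterThanLessThan_iff)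
    have "viscosity_gap F G W V Y d h \<alpha> l t X \<ge> 0"
    proof (rule stability_inequality[OF contF limF contG limG grF grG C mono gr less_imp_le[OF C'] lim V Y td t X _ d])
      show "cost W V Y \<phi> h \<alpha> l t X \<le> cost W V Y \<phi> h \<alpha> l s Z" if "s \<in> {0..<T}" "Z \<in> Lspace M 4" for s Z
        using min[unfolded penalized_minimum_iff[OF X \<alpha>]] that by blast
    qed
    then show "let U = lift_sol M W t X in
        test_dt M \<phi> h \<alpha> l t X + test_grad M h \<alpha> l t X (lift_coef M F X U)
        \<ge> pairing M (lift_coef M F X U) (\<lambda>w. U w - V w) + pairing M (lift_coef M G X U) (\<lambda>w. X w - Y w)"
      by (simp add: viscosity_gap_def Let_def test_dt_eq[OF X d])
  qed
qed

end

theorem theorem2p12: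
  fixes M :: "'w measure"
    and B :: "'i \<Rightarrow> real \<Rightarrow> 'w \<Rightarrow> real" and I :: "'i set"
    and T C C' :: real
    and Fn Gn :: "nat \<Rightarrow> (real ^ 'd) coef"
    and F G :: "(real ^ 'd) coef"
    and Wn :: "nat \<Rightarrow> (real ^ 'd) sol"
    and W :: "(real ^ 'd) sol"
  assumes "T > 0"
    and "prob_space M"
    and "I \<noteq> {}" and "indep_brownian_motions M B I"
    and "\<And>n. continuous_map coef_space euclidean (Fn n)"
    and "\<And>n. continuous_map coef_space euclidean (Gn n)"
    and "\<And>n x \<mu> u. \<mu> \<in> P2 \<Longrightarrow>
           norm (Fn n (x, \<mu>, u)) + norm (Gn n (x, \<mu>, u))
           \<le> C * (1 + norm x + norm u + sqrt (enn2real (E_law 2 \<mu>)))"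
    and "locally_uniform_limit coef_space Fn F"
    and "locally_uniform_limit coef_space Gn G"
    and "\<And>n. monotone_solution M T (Fn n) (Gn n) (Wn n)"
    and "C' > 0" and "\<And>n. linear_growth T C' (Wn n)"
    and "locally_uniform_limit (sol_space T) Wn W"
  shows "monotone_solution M T F G W"
  by (rule prob_space.monotone_solution_stable[OF assms(2,5,8,6,9,7,10,11,12,13)])

end
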